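(* For every integer $t\ge 1$, one has $p(t+1)<p(t)$, where $p(t)$ denotes the limiting optimal success probability, as the number of hats per player tends to infinity, in Levine's hat game with $t$ players.
   Context: Levine's hat game. Let $t,n\ge 1$ be integers and $B=\{0,1\}^n$. There are $t$ players; player $i$ carries a stack of $n$ hats, encoded by a vector $x_i\in B$ (entry $1$ means a black hat, entry $0$ a white hat). All hats are independently black or white with probability $1/2$ each, so $x=(x_1,\dots,x_t)$ is uniform on $B^t$. Each player sees the stacks of all other players but not her own. Simultaneously each player picks one hat (a coordinate in $\{1,\dots,n\}$) from her own stack. The players win if and only if every player picks a black hat. They may agree on a strategy beforehand. A strategy is a tuple $(f_1,\dots,f_t)$ of functions $f_i:B^{t-1}\to\{1,\dots,n\}$ (for $t=1$, $B^0$ is a single point, so a strategy is a choice of one coordinate). Let $x^{-i}\in B^{t-1}$ be obtained from $x$ by deleting $x_i$. The success probability of the strategy is the probability, over uniform $x\in B^t$, that for every $i$ the coordinate number $f_i(x^{-i})$ of $x_i$ equals $1$. $p(t,n)$ is the maximum success probability over all strategies, and $p(t)=\lim_{n\to\infty}p(t,n)$. *)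

theory Defs
  imports "HOL-Probability.Probability"
begin

definition stacks :: "nat \<Rightarrow> (nat \<Rightarrow> nat) set" where
  "stacks n = {1..n} \<rightarrow>\<^sub>E {0, 1}"

definition stacks_of :: "nat set \<Rightarrow> nat \<Rightarrow> (nat \<Rightarrow> nat \<Rightarrow> nat) set" where
  "stacks_of P n = P \<rightarrow>\<^sub>E stacks n"

definition others :: "nat \<Rightarrow> nat \<Rightarrow> nat set" where
  "others t i = {1..t} - {i}"

text \<open>
  The set \<open>B\<^sup>t\<^sup>-\<^sup>1\<close> of views of player \<open>i\<close> is encoded as the set of families of stacks
  indexed by the other players; deleting the \<open>i\<close>-th entry of a configuration is restriction
  to this index set.
\<close>

definition strategies :: "nat \<Rightarrow> nat \<Rightarrow> (nat \<Rightarrow> (nat \<Rightarrow> nat \<Rightarrow> nat) \<Rightarrow> nat) set" where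
  "strategies t n = (\<Pi>\<^sub>E i\<in>{1..t}. stacks_of (others t i) n \<rightarrow>\<^sub>E {1..n})"

definition wins :: "nat \<Rightarrow> (nat \<Rightarrow> (nat \<Rightarrow> nat \<Rightarrow> nat) \<Rightarrow> nat) \<Rightarrow> (nat \<Rightarrow> nat \<Rightarrow> nat) \<Rightarrow> bool" where
  "wins t f x \<longleftrightarrow> (\<forall>i\<in>{1..t}. x i (f i (restrict x (others t i))) = 1)"

definition success_prob :: "nat \<Rightarrow> nat \<Rightarrow> (nat \<Rightarrow> (nat \<Rightarrow> nat \<Rightarrow> nat) \<Rightarrow> nat) \<Rightarrow> real" where
  "success_prob t n f = measure_pmf.prob (pmf_of_set (stacks_of {1..t} n)) {x. wins t f x}"

text \<open>For \<open>t \<ge> 1\<close> and \<open>n = 0\<close> there is no strategy and the value below is unspecified; this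
  does not affect the limit.\<close>

definition opt_prob :: "nat \<Rightarrow> nat \<Rightarrow> real" where
  "opt_prob t n = Max (success_prob t n ` strategies t n)"

definition limit_prob :: "nat \<Rightarrow> real" where
  "limit_prob t = lim (\<lambda>n. opt_prob t n)"


text \<open>The maximum is attained, and the limit exists.\<close>

lemma finite_stacks_of: "finite P \<Longrightarrow> finite (stacks_of P n)"
  by (auto simp: stacks_of_def stacks_def intro!: finite_PiE)

lemma stacks_of_nonempty: "stacks_of P n \<noteq> {}"
  by (auto simp: stacks_of_def stacks_def PiE_eq_empty_iff)

lemma finite_strategies: "finite (strategies t n)"
  unfolding strategies_def
  by (intro finite_PiE finite_stacks_of) (auto simp: others_def)

lemma strategies_nonempty: "n \<ge> 1 \<Longrightarrow> strategies t n \<noteq> {}"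
  by (auto simp: strategies_def PiE_eq_empty_iff)

lemma success_prob_card:
  "success_prob t n f =
     card {x \<in> stacks_of {1..t} n. wins t f x} / card (stacks_of {1..t} n)"
  unfolding success_prob_def
  by (subst measure_pmf_of_set)
     (simp_all add: finite_stacks_of stacks_of_nonempty Collect_conj_eq)

lemma opt_prob_attained:
  assumes "n \<ge> 1"
  shows "\<exists>f\<in>strategies t n. opt_prob t n = success_prob t n f"
proof -
  have "opt_prob t n \<in> success_prob t n ` strategies t n"
    unfolding opt_prob_def
    by (rule Max_in) (simp_all add: finite_strategies strategies_nonempty[OF assms])
  then show ?thesis
    by blast
qed

lemma opt_prob_ge: "f \<in> strategies t n \<Longrightarrow> success_prob t n f \<le> opt_prob t n"
  unfolding opt_prob_def by (intro Max_ge) (auto simp: finite_strategies)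

lemma opt_prob_mono:
  assumes "1 \<le> n" "n \<le> m"
  shows "opt_prob t n \<le> opt_prob t m"
proof -
  obtain f where f: "f \<in> strategies t n" "opt_prob t n = success_prob t n f"
    using opt_prob_attained[OF assms(1)] by blast
  define cut where "cut = (\<lambda>P (y :: nat \<Rightarrow> nat \<Rightarrow> nat). \<lambda>j\<in>P. restrict (y j) {1..n})"
  define g where "g = (\<lambda>i\<in>{1..t}. \<lambda>y\<in>stacks_of (others t i) m. f i (cut (others t i) y))"
  have cut_in: "cut P y \<in> stacks_of P n" if "y \<in> stacks_of P m" for P y
    using that assms by (fastforce simp: cut_def stacks_of_def stacks_def PiE_iff)
  have f_in: "f i y \<in> {1..n}" if "i \<in> {1..t}" "y \<in> stacks_of (others t i) n" for i y
    using f(1) that by (auto simp: strategies_def PiE_iff)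
  have g: "g \<in> strategies t m"
    unfolding strategies_def
  proof (rule PiE_I)
    fix i assume i: "i \<in> {1..t}"
    have "f i (cut (others t i) y) \<in> {1..m}" if "y \<in> stacks_of (others t i) m" for y
      using f_in[OF i cut_in[OF that]] assms by auto
    with i show "g i \<in> stacks_of (others t i) m \<rightarrow>\<^sub>E {1..m}"
      by (auto simp: g_def)
  qed (auto simp: g_def)
  define Rest where "Rest = {1..t} \<rightarrow>\<^sub>E ({n+1..m} \<rightarrow>\<^sub>E {0, 1::nat})"
  define F where "F = (\<lambda>x. (cut {1..t} x, \<lambda>j\<in>{1..t}. restrict (x j) {n+1..m}))"
  define G where "G = (\<lambda>(y :: nat \<Rightarrow> nat \<Rightarrow> nat, z :: nat \<Rightarrow> nat \<Rightarrow> nat).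
     \<lambda>j\<in>{1..t}. \<lambda>k\<in>{1..m}. if k \<le> n then y j k else z j k)"
  have wins: "wins t g x \<longleftrightarrow> wins t f (cut {1..t} x)" if x: "x \<in> stacks_of {1..t} m" for x
    unfolding wins_def
  proof (rule ball_cong)
    fix i assume i: "i \<in> {1..t}"
    have r: "restrict x (others t i) \<in> stacks_of (others t i) m"
      using x by (auto simp: stacks_of_def others_def PiE_iff)
    have e: "cut (others t i) (restrict x (others t i)) = restrict (cut {1..t} x) (others t i)"
      by (rule ext) (auto simp: cut_def others_def restrict_def)
    have "g i y = f i (cut (others t i) y)" if "y \<in> stacks_of (others t i) m" for y
      unfolding g_def using i that by (simp only: restrict_apply if_True)
    from this[OF r]
    have gi: "g i (restrict x (others t i)) = f i (restrict (cut {1..t} x) (others t i))"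
      unfolding e .
    have "cut {1..t} x i k = x i k" if "k \<in> {1..n}" for k
      unfolding cut_def using i that by (simp only: restrict_apply if_True)
    then have "cut {1..t} x i (f i (restrict (cut {1..t} x) (others t i))) =
        x i (f i (restrict (cut {1..t} x) (others t i)))"
      using f_in[OF i cut_in[OF r]] unfolding e by blast
    then show "(x i (g i (restrict x (others t i))) = 1) =
          (cut {1..t} x i (f i (restrict (cut {1..t} x) (others t i))) = 1)"
      unfolding gi by simp
  qed simp
  have GF: "G (F x) = x" if x: "x \<in> stacks_of {1..t} m" for x
  proof (intro ext)
    fix j k show "G (F x) j k = x j k"
    proof (cases "j \<in> {1..t}")
      case True
      then have "x j \<in> {1..m} \<rightarrow>\<^sub>E {0, 1}"
        using x by (auto simp: stacks_of_def stacks_def PiE_iff)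
      then have "x j k = undefined" if "k \<notin> {1..m}"
        using that by (rule PiE_arb)
      with True show ?thesis
        by (cases "k \<in> {1..m}") (simp_all add: G_def F_def cut_def)
    next
      case False
      then have "x j = undefined"
        using x PiE_arb unfolding stacks_of_def by metis
      with False show ?thesis
        by (auto simp: G_def F_def)
    qed
  qed
  have FG: "F (G (y, z)) = (y, z)" if y: "y \<in> stacks_of {1..t} n" and z: "z \<in> Rest" for y z
  proof -
    have "cut {1..t} (G (y, z)) j k = y j k" for j k
    proof (cases "j \<in> {1..t}")
      case True
      then have "y j \<in> {1..n} \<rightarrow>\<^sub>E {0, 1}"
        using y by (auto simp: stacks_of_def stacks_def PiE_iff)
      then have "y j k = undefined" if "k \<notin> {1..n}"
        using that by (rule PiE_arb)
      with True assms show ?thesis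
        by (cases "k \<in> {1..n}") (simp_all add: G_def cut_def)
    next
      case False
      then have "y j = undefined"
        using y PiE_arb unfolding stacks_of_def by metis
      with False show ?thesis
        by (auto simp: cut_def)
    qed
    moreover have "(\<lambda>j\<in>{1..t}. restrict (G (y, z) j) {n+1..m}) j k = z j k" for j k
    proof (cases "j \<in> {1..t}")
      case True
      then have "z j \<in> {n+1..m} \<rightarrow>\<^sub>E {0, 1}"
        using z by (auto simp: Rest_def PiE_iff)
      then have "z j k = undefined" if "k \<notin> {n+1..m}"
        using that by (rule PiE_arb)
      with True assms show ?thesis
        by (cases "k \<in> {n+1..m}") (simp_all add: G_def)
    next
      case False
      then have "z j = undefined"
        using z PiE_arb unfolding Rest_def by metis
      with False show ?thesis
        by auto
    qed
    ultimately show ?thesis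
      unfolding F_def by (intro prod_eqI) (simp_all add: fun_eq_iff)
  qed
  have F_in: "F x \<in> stacks_of {1..t} n \<times> Rest" if "x \<in> stacks_of {1..t} m" for x
    using cut_in[OF that] that
    by (auto simp: F_def Rest_def stacks_of_def stacks_def PiE_iff)
  have G_in: "G (y, z) \<in> stacks_of {1..t} m" if "y \<in> stacks_of {1..t} n" "z \<in> Rest" for y z
    using that by (auto simp: G_def Rest_def stacks_of_def stacks_def PiE_iff)
  have card_eq: "card {x \<in> stacks_of {1..t} m. Q (cut {1..t} x)} =
      card {y \<in> stacks_of {1..t} n. Q y} * card Rest" for Q
  proof -
    have "bij_betw F {x \<in> stacks_of {1..t} m. Q (cut {1..t} x)}
            ({y \<in> stacks_of {1..t} n. Q y} \<times> Rest)"
    proof (rule bij_betw_byWitness[where f' = G])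
      show "F ` {x \<in> stacks_of {1..t} m. Q (cut {1..t} x)}
              \<subseteq> {y \<in> stacks_of {1..t} n. Q y} \<times> Rest"
        using F_in by (force simp: F_def)
      have "Q (cut {1..t} (G (y, z)))" if "y \<in> stacks_of {1..t} n" "z \<in> Rest" "Q y" for y z
        using FG[OF that(1,2)] that(3) by (simp add: F_def)
      then show "G ` ({y \<in> stacks_of {1..t} n. Q y} \<times> Rest)
              \<subseteq> {x \<in> stacks_of {1..t} m. Q (cut {1..t} x)}"
        using G_in by blast
    qed (use GF FG in auto)
    then show ?thesis
      by (simp add: bij_betw_same_card card_cartesian_product)
  qed
  have "finite Rest" "Rest \<noteq> {}"
    by (auto simp: Rest_def PiE_eq_empty_iff intro!: finite_PiE)
  then have "card Rest > 0"
    by (simp add: card_gt_0_iff)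
  moreover have "{x \<in> stacks_of {1..t} m. wins t g x} =
      {x \<in> stacks_of {1..t} m. wins t f (cut {1..t} x)}"
    using wins by blast
  ultimately have "success_prob t m g = success_prob t n f"
    using card_eq[of "wins t f"] card_eq[of "\<lambda>_. True"]
    by (simp add: success_prob_card)
  then show ?thesis
    using opt_prob_ge[OF g] f(2) by simp
qed

lemma opt_prob_convergent: "convergent (\<lambda>n. opt_prob t n)"
proof -
  have "convergent (\<lambda>n. opt_prob t (Suc n))"
  proof (rule Bseq_monoseq_convergent)
    show "monoseq (\<lambda>n. opt_prob t (Suc n))"
      by (intro monoI1) (auto intro: opt_prob_mono)
    have "norm (opt_prob t (Suc n)) \<le> 1" for n
      using opt_prob_attained[of "Suc n" t] by (auto simp: success_prob_def)
    then show "Bseq (\<lambda>n. opt_prob t (Suc n))"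
      by (rule BseqI')
  qed
  then show ?thesis
    by (simp add: convergent_Suc_iff)
qed

lemma opt_prob_tendsto: "(\<lambda>n. opt_prob t n) \<longlonglongrightarrow> limit_prob t"
  using opt_prob_convergent unfolding limit_prob_def convergent_LIMSEQ_iff .

end

theory Submission
  imports Defs "HOL-Real_Asymp.Real_Asymp"
begin

text \<open>
  Fix \<open>t\<close> and write \<open>p\<close> for \<open>p(t)\<close>. With one more player, her choice of a hat is a colouring of the
  configurations \<open>x\<close> of the first \<open>t\<close> stacks: the colour of \<open>x\<close> is the hat that she picks when she sees
  \<open>x\<close>. If her own stack is \<open>y\<close>, the team can win only at configurations whose colour is black in \<open>y\<close>.
  For every single \<open>y\<close> the first \<open>t\<close> players play the \<open>t\<close>-player game, so they win with probability at
  most \<open>p\<close>. It has to be shown that averaging over \<open>y\<close> costs a fixed amount \<open>\<gamma> > 0\<close>, whatever the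
  number of hats (\<open>blind_val_gap\<close>). Two mechanisms are played against each other.

  Conditioning (\<open>blind_val_drop_big\<close>). Suppose the average over \<open>y\<close> is at least \<open>p - \<gamma>\<close>. As no \<open>y\<close>
  gives more than \<open>p\<close>, conditioning on an event of probability \<open>2\<^sup>-\<^sup>L\<close> still leaves at least
  \<open>p - 2\<^sup>L \<gamma>\<close>. There are at most \<open>L = 1/a\<close> colours whose classes have measure above \<open>a\<close>, and all of
  them are white with probability at least \<open>2\<^sup>-\<^sup>L\<close>. So a near-optimal team does not need large colour
  classes: it stays near-optimal when all configurations in them are declared lost.

  Blinding (\<open>blind_player\<close>). Suppose the colour classes are small in the direction of the stack of
  player \<open>i\<close>, for fixed stacks of the others. If the others have boundedly many hats and player \<open>i\<close> has
  many more, the number of possible behaviours of player \<open>i\<close> is small compared with the number of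
  independent bits of \<open>y\<close> involved. Every fixed behaviour has a value concentrated around its mean over
  \<open>y\<close>, so player \<open>i\<close> gains almost nothing from seeing \<open>y\<close> and may be assumed to ignore these bits.

  The argument is a downward induction on the set \<open>I\<close> of players who ignore \<open>y\<close>. The claim
  (\<open>robust\<close>) is that a team whose value is close to \<open>p\<close> keeps a value close to \<open>p\<close> when all coloured
  configurations are declared lost. If all players ignore \<open>y\<close> this is clear: a coloured configuration
  is lost with probability \<open>1/2\<close> anyway, so a near-optimal team wins at few of them. For smaller \<open>I\<close>
  one first removes the colours that are large for given stacks \<open>x\<^sub>I\<close>. This may be done separately for each
  \<open>x\<^sub>I\<close>, because everybody who looks at \<open>y\<close> also sees \<open>x\<^sub>I\<close>. Then, for one player \<open>i\<close> outside \<open>I\<close>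
  after the other, one removes the colours that are small in the direction of \<open>i\<close>, by blinding \<open>i\<close> and
  applying the claim to \<open>I \<union> {i}\<close>. A colour that survives all these removals would be large in every
  direction, hence large for given \<open>x\<^sub>I\<close>, and such colours are gone. In the original game \<open>I\<close> is empty and
  every configuration is coloured; a value close to \<open>p\<close> would therefore give \<open>0 \<ge> p/2\<close>.

  The number of hats is made bounded by sampling (\<open>random_hats\<close>). Each of the given hats is identified
  with one of \<open>m\<close> new hats at random, and the new stack is first altered in few places so that exactly
  half of it is black. Then the simulated stack is exactly uniform, so no configuration is favoured, while
  the hat chosen in the simulation is black in the real stack except with probability \<open>1/(2\<surd>m)\<close>. Small colour
  classes stay small, by a correlation inequality on the cube (\<open>pullback_correlation\<close>). All sizes are
  chosen independently of the number of hats in the original game, which makes \<open>\<gamma>\<close> uniform.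
\<close>

section \<open>Averages and means\<close>

definition avg :: "'a set \<Rightarrow> ('a \<Rightarrow> real) \<Rightarrow> real" where
  "avg S g = (\<Sum>x\<in>S. g x) / real (card S)"

text \<open>
  An expectation, described only through its properties, so that compositions of random choices need no
  common index set. The set \<open>S\<close> carries the expectation: values outside \<open>S\<close> do not matter.
\<close>
definition mean :: "'a set \<Rightarrow> (('a \<Rightarrow> real) \<Rightarrow> real) \<Rightarrow> bool" where
  "mean S M \<longleftrightarrow> (\<forall>f g. M (\<lambda>x. f x + g x) = M f + M g) \<and> (\<forall>c f. M (\<lambda>x. c * f x) = c * M f)
     \<and> (\<forall>f g. (\<forall>x\<in>S. f x \<le> g x) \<longrightarrow> M f \<le> M g) \<and> M (\<lambda>_. 1) = 1"

lemma mean_avg: "finite S \<Longrightarrow> S \<noteq> {} \<Longrightarrow> mean S (avg S)"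
  by (auto simp: mean_def avg_def sum.distrib add_divide_distrib sum_distrib_left[symmetric]
      intro!: divide_right_mono sum_mono)

lemma mean_add: "mean S M \<Longrightarrow> M (\<lambda>x. f x + g x) = M f + M g"
  and mean_cmult: "mean S M \<Longrightarrow> M (\<lambda>x. c * f x) = c * M f"
  and mean_mono: "mean S M \<Longrightarrow> (\<And>x. x \<in> S \<Longrightarrow> f x \<le> g x) \<Longrightarrow> M f \<le> M g"
  and mean_one: "mean S M \<Longrightarrow> M (\<lambda>_. 1) = 1"
  unfolding mean_def by blast+

lemma mean_const: "mean S M \<Longrightarrow> M (\<lambda>_. c) = c"
  using mean_cmult[of S M c "\<lambda>_. 1"] mean_one[of S M] by simp

lemma mean_diff: "mean S M \<Longrightarrow> M (\<lambda>x. f x - g x) = M f - M g"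
  using mean_add[of S M f "\<lambda>x. -1 * g x"] mean_cmult[of S M "-1" g] by simp

lemma mean_cong: assumes "mean S M" "\<And>x. x \<in> S \<Longrightarrow> f x = g x" shows "M f = M g"
  by (rule antisym) (use assms in \<open>auto intro!: mean_mono[of S M]\<close>)

lemma mean_divide: "mean S M \<Longrightarrow> M (\<lambda>x. f x / c) = M f / c"
  using mean_cmult[of S M "1/c" f] by simp

lemma mean_sum: assumes M: "mean S M" shows "M (\<lambda>x. \<Sum>i\<in>A. f i x) = (\<Sum>i\<in>A. M (\<lambda>x. f i x))"
proof (induction A rule: infinite_finite_induct)
  case (insert a A)
  then show ?case by (simp add: mean_add[OF M, of "f a" "\<lambda>x. \<Sum>i\<in>A. f i x"])
qed (auto simp: mean_const[OF M])

lemma mean_avg_swap: assumes M: "mean S M" shows "M (\<lambda>s. avg A (\<lambda>x. g s x)) = avg A (\<lambda>x. M (\<lambda>s. g s x))"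
  unfolding avg_def by (simp only: mean_divide[OF M] mean_sum[OF M])

lemma mean_le: "mean S M \<Longrightarrow> (\<And>x. x \<in> S \<Longrightarrow> f x \<le> c) \<Longrightarrow> M f \<le> c"
  using mean_mono[of S M f "\<lambda>_. c"] by (simp add: mean_const)

lemma mean_ge: "mean S M \<Longrightarrow> (\<And>x. x \<in> S \<Longrightarrow> c \<le> f x) \<Longrightarrow> c \<le> M f"
  using mean_mono[of S M "\<lambda>_. c" f] by (simp add: mean_const)

lemma mean_square: assumes M: "mean S M" shows "(M f)\<^sup>2 \<le> M (\<lambda>x. (f x)\<^sup>2)"
proof -
  let ?m = "M f"
  have "0 \<le> M (\<lambda>x. (f x - ?m)\<^sup>2)" by (rule mean_ge[OF M]) auto
  also have "(\<lambda>x. (f x - ?m)\<^sup>2) = (\<lambda>x. ((f x)\<^sup>2 - (2 * ?m) * f x) + ?m\<^sup>2)"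
    by (auto simp: power2_eq_square algebra_simps)
  also have "M \<dots> = M (\<lambda>x. (f x)\<^sup>2) - 2 * ?m * ?m + ?m\<^sup>2"
    by (simp only: mean_add[OF M] mean_diff[OF M] mean_cmult[OF M] mean_const[OF M])
  finally show ?thesis by (simp add: power2_eq_square)
qed

lemma mean_sqrt: assumes M: "mean S M" and nn: "\<And>x. x \<in> S \<Longrightarrow> 0 \<le> f x"
  shows "M (\<lambda>x. sqrt (f x)) \<le> sqrt (M f)"
proof (rule real_le_rsqrt)
  have "(M (\<lambda>x. sqrt (f x)))\<^sup>2 \<le> M (\<lambda>x. (sqrt (f x))\<^sup>2)" by (rule mean_square[OF M])
  also have "\<dots> = M f" by (rule mean_cong[OF M]) (use nn in auto)
  finally show "(M (\<lambda>x. sqrt (f x)))\<^sup>2 \<le> M f" .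
qed

lemma mean_abs_le: assumes M: "mean S M" shows "M (\<lambda>x. \<bar>f x\<bar>) \<le> sqrt (M (\<lambda>x. (f x)\<^sup>2))"
  using mean_sqrt[OF M, of "\<lambda>x. (f x)\<^sup>2"] by simp

lemma mean_markov:
  assumes M: "mean S M" and nn: "\<And>x. x \<in> S \<Longrightarrow> 0 \<le> f x" and a: "a > 0"
  shows "M (\<lambda>x. of_bool (f x > a)) \<le> M f / a"
proof -
  have "M (\<lambda>x. of_bool (f x > a)) \<le> M (\<lambda>x. f x / a)"
    by (rule mean_mono[OF M]) (use nn a in \<open>auto simp: field_simps of_bool_def\<close>)
  then show ?thesis by (simp add: mean_divide[OF M])
qed

lemma mean_bind:
  assumes M: "mean S M" and K: "\<And>s. s \<in> S \<Longrightarrow> mean T (K s)" and c: "\<And>s t. s \<in> S \<Longrightarrow> t \<in> T \<Longrightarrow> c s t \<in> R"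
  shows "mean R (\<lambda>g. M (\<lambda>s. K s (\<lambda>t. g (c s t))))"
  unfolding mean_def
proof (intro conjI allI impI)
  fix f g :: "'c \<Rightarrow> real" and a :: real
  have "M (\<lambda>s. K s (\<lambda>t. f (c s t) + g (c s t))) = M (\<lambda>s. K s (\<lambda>t. f (c s t)) + K s (\<lambda>t. g (c s t)))"
    by (rule mean_cong[OF M]) (rule mean_add[OF K])
  then show "M (\<lambda>s. K s (\<lambda>t. f (c s t) + g (c s t))) = M (\<lambda>s. K s (\<lambda>t. f (c s t))) + M (\<lambda>s. K s (\<lambda>t. g (c s t)))"
    by (simp add: mean_add[OF M])
  have "M (\<lambda>s. K s (\<lambda>t. a * f (c s t))) = M (\<lambda>s. a * K s (\<lambda>t. f (c s t)))"
    by (rule mean_cong[OF M]) (rule mean_cmult[OF K])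
  then show "M (\<lambda>s. K s (\<lambda>t. a * f (c s t))) = a * M (\<lambda>s. K s (\<lambda>t. f (c s t)))"
    by (simp add: mean_cmult[OF M])
  have "M (\<lambda>s. K s (\<lambda>t. 1)) = M (\<lambda>s. 1)"
    by (rule mean_cong[OF M]) (rule mean_one[OF K])
  then show "M (\<lambda>s. K s (\<lambda>t. 1)) = 1" by (simp add: mean_one[OF M])
next
  fix f g :: "'c \<Rightarrow> real" assume "\<forall>x\<in>R. f x \<le> g x"
  then show "M (\<lambda>s. K s (\<lambda>t. f (c s t))) \<le> M (\<lambda>s. K s (\<lambda>t. g (c s t)))"
    by (intro mean_mono[OF M] mean_mono[OF K]) (use c in auto)
qed

definition mix :: "'a set \<Rightarrow> ('a \<Rightarrow> 'b) \<Rightarrow> ('a \<Rightarrow> 'b) \<Rightarrow> 'a \<Rightarrow> 'b" where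
  "mix I x y = (\<lambda>j. if j \<in> I then x j else y j)"

lemma avg_prod: "avg A (\<lambda>x. avg B (\<lambda>y. g x y)) = avg (A \<times> B) (\<lambda>(x,y). g x y)"
  by (simp add: avg_def sum.cartesian_product card_cartesian_product sum_divide_distrib[symmetric] mult.commute)

lemma avg_bij: assumes "bij_betw f A B" shows "avg B g = avg A (\<lambda>x. g (f x))"
  using sum.reindex_bij_betw[OF assms, of g] bij_betw_same_card[OF assms] by (simp add: avg_def)

lemma avg_swap: "avg A (\<lambda>x. avg B (\<lambda>y. g x y)) = avg B (\<lambda>y. avg A (\<lambda>x. g x y))"
  unfolding avg_def by (subst sum.swap[of _ B A] | simp add: sum_divide_distrib[symmetric] mult.commute divide_divide_eq_left)+
 

text \<open>
  Exchanging the coordinates in \<open>I\<close> between two independent points is a bijection on pairs. This is how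
  all conditional expectations over some of the stacks are treated below.
\<close>
lemma avg_mix:
  assumes "finite (Pi UNIV S)" "Pi UNIV S \<noteq> {}"
  shows "avg (Pi UNIV S) (\<lambda>x. avg (Pi UNIV S) (\<lambda>y. g (mix I x y))) = avg (Pi UNIV S) g"
proof -
  let ?P = "Pi UNIV S"
  have "bij_betw (\<lambda>(x,y). (mix I x y, mix I y x)) (?P \<times> ?P) (?P \<times> ?P)"
    by (rule bij_betw_byWitness[where f' = "\<lambda>(x,y). (mix I x y, mix I y x)"])
       (auto simp: mix_def Pi_def fun_eq_iff)
  from avg_bij[OF this, of "\<lambda>(x,y). g x"]
  have "avg ?P (\<lambda>x. avg ?P (\<lambda>y. g (mix I x y))) = avg ?P (\<lambda>x. avg ?P (\<lambda>y. g x))"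
    unfolding avg_prod by (simp add: case_prod_beta')
  also have "\<dots> = avg ?P g" using mean_const[OF mean_avg[OF assms]] by simp
  finally show ?thesis .
qed

section \<open>The game with stacks of different sizes\<close>

type_synonym config = "nat \<Rightarrow> nat set"
type_synonym strategy = "nat \<Rightarrow> config \<Rightarrow> nat"

text \<open>
  A stack is the set of its black hats, and player \<open>j\<close> has the hats \<open>H j\<close>. Indices that are not players have no
  hats and the empty stack, so the number of players is carried by \<open>H\<close>.
\<close>
definition configs :: "config \<Rightarrow> config set" where
  "configs H = Pi UNIV (\<lambda>j. Pow (H j))"

definition valid :: "nat set \<Rightarrow> config \<Rightarrow> bool" where
  "valid P H \<longleftrightarrow> (\<forall>j. finite (H j)) \<and> (\<forall>j. j \<notin> P \<longrightarrow> H j = {})"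

text \<open>
  The view of player \<open>j\<close> is the configuration with her own stack replaced by the empty one, so every function
  is a legal strategy.
\<close>
definition win :: "nat set \<Rightarrow> strategy \<Rightarrow> config \<Rightarrow> bool" where
  "win P f x \<longleftrightarrow> (\<forall>j\<in>P. f j (x(j := {})) \<in> x j)"

definition success :: "nat set \<Rightarrow> config \<Rightarrow> strategy \<Rightarrow> (config \<Rightarrow> real) \<Rightarrow> real" where
  "success P H f A = avg (configs H) (\<lambda>x. of_bool (win P f x) * A x)"

text \<open>
  The best result of the players outside \<open>I\<close>, when those in \<open>I\<close> are committed to \<open>g\<close> and a win at \<open>x\<close>
  is worth \<open>A x\<close>.
\<close>
definition val :: "nat set \<Rightarrow> config \<Rightarrow> nat set \<Rightarrow> strategy \<Rightarrow> (config \<Rightarrow> real) \<Rightarrow> real" where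
  "val P H I g A = Max {success P H f A | f. \<forall>i\<in>I. f i = g i}"

text \<open>
  Configurations live in a product over all indices in which all but finitely many factors are trivial.
\<close>
lemma finite_Pi_UNIV:
  assumes "finite P" "\<And>j. finite (S j)" "\<And>j. j \<notin> P \<Longrightarrow> \<exists>a. S j \<subseteq> {a}"
  shows "finite (Pi UNIV S)"
proof (rule inj_on_finite)
  show "inj_on (\<lambda>x. restrict x P) (Pi UNIV S)"
  proof (rule inj_onI)
    fix x y assume xy: "x \<in> Pi UNIV S" "y \<in> Pi UNIV S" and e: "restrict x P = restrict y P"
    show "x = y"
    proof
      fix j show "x j = y j"
      proof (cases "j \<in> P")
        case True then show ?thesis using e by (metis restrict_apply')
      next
        case False then obtain a where "S j \<subseteq> {a}" using assms(3) by blast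
        then show ?thesis using xy by (auto simp: Pi_def)
      qed
    qed
  qed
  show "(\<lambda>x. restrict x P) ` Pi UNIV S \<subseteq> PiE P S" by auto
  show "finite (PiE P S)" using assms by (intro finite_PiE) auto
qed

lemma finite_configs: "finite P \<Longrightarrow> valid P H \<Longrightarrow> finite (configs H)"
  unfolding configs_def by (rule finite_Pi_UNIV[of P]) (auto simp: valid_def)

lemma configs_ne: "configs H \<noteq> {}"
proof -
  have "(\<lambda>_. {}) \<in> configs H" by (auto simp: configs_def)
  then show ?thesis by blast
qed

lemma configs_sub: "x \<in> configs H \<Longrightarrow> x j \<subseteq> H j"
  by (auto simp: configs_def Pi_def)

lemma mix_single: "mix (- {i}) x y = x(i := y i)"
  by (auto simp: mix_def fun_eq_iff)

text \<open>
  Up to the very end, \<open>p\<close> enters only as a bound for the success probability for all stack sizes.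
\<close>
locale hat_game =
  fixes P :: "nat set" and p :: real
  assumes finP: "finite P" and p_le_1: "p \<le> 1"
    and win_le: "\<And>H f. valid P H \<Longrightarrow> avg (configs H) (\<lambda>x. of_bool (win P f x)) \<le> p"
begin

lemma mean_configs: "valid P H \<Longrightarrow> mean (configs H) (avg (configs H))"
  by (rule mean_avg) (auto simp: finite_configs[OF finP] configs_ne)

lemma configs_resample: "valid P H \<Longrightarrow> avg (configs H) (\<lambda>x. avg (configs H) (\<lambda>y. g (mix I x y))) = avg (configs H) g"
  using avg_mix[of "\<lambda>j. Pow (H j)" g I] finite_configs[OF finP, of H] configs_ne[of H] by (simp add: configs_def)

lemma configs_resample1: "valid P H \<Longrightarrow> avg (configs H) (\<lambda>x. avg (configs H) (\<lambda>y. g (x(i := y i)))) = avg (configs H) g"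
  using configs_resample[of H g "- {i}"] by (simp add: mix_single)

text \<open>
  There are infinitely many strategies, but the success depends only on the set of configurations that are won.
\<close>
lemma finite_successes: assumes "valid P H" shows "finite {success P H f A | f. Q f}"
proof (rule finite_subset)
  show "{success P H f A | f. Q f} \<subseteq> (\<lambda>W. avg (configs H) (\<lambda>x. of_bool (x \<in> W) * A x)) ` Pow (configs H)"
  proof clarify
    fix f
    have "success P H f A = avg (configs H) (\<lambda>x. of_bool (x \<in> {x \<in> configs H. win P f x}) * A x)"
      unfolding success_def by (rule mean_cong[OF mean_configs[OF assms]]) auto
    then show "success P H f A \<in> (\<lambda>W. avg (configs H) (\<lambda>x. of_bool (x \<in> W) * A x)) ` Pow (configs H)" by blast
  qed
  show "finite ((\<lambda>W. avg (configs H) (\<lambda>x. of_bool (x \<in> W) * A x)) ` Pow (configs H))"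
    using finite_configs[OF finP assms] by simp
qed

lemma val_attained: assumes "valid P H" obtains f where "\<forall>i\<in>I. f i = g i" "val P H I g A = success P H f A"
proof -
  have "val P H I g A \<in> {success P H f A | f. \<forall>i\<in>I. f i = g i}"
    unfolding val_def by (rule Max_in[OF finite_successes[OF assms]]) blast
  then show ?thesis using that by blast
qed

lemma success_le_val: "valid P H \<Longrightarrow> \<forall>i\<in>I. f i = g i \<Longrightarrow> success P H f A \<le> val P H I g A"
  unfolding val_def by (rule Max_ge[OF finite_successes]) auto

lemma val_lipschitz:
  assumes v: "valid P H" and A: "\<And>x. x \<in> configs H \<Longrightarrow> A x \<le> A' x + d x" "\<And>x. x \<in> configs H \<Longrightarrow> 0 \<le> d x"
  shows "val P H I g A \<le> val P H I g A' + avg (configs H) d"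
proof -
  obtain f where f: "\<forall>i\<in>I. f i = g i" "val P H I g A = success P H f A" by (rule val_attained[OF v])
  have "success P H f A \<le> avg (configs H) (\<lambda>x. of_bool (win P f x) * A' x + d x)"
    unfolding success_def by (rule mean_mono[OF mean_configs[OF v]]) (use A in \<open>auto simp: of_bool_def\<close>)
  also have "\<dots> = success P H f A' + avg (configs H) d"
    unfolding success_def by (rule mean_add[OF mean_configs[OF v]])
  finally show ?thesis using success_le_val[OF v f(1), of A'] f(2) by simp
qed

lemma val_mono:
  assumes v: "valid P H" and A: "\<And>x. x \<in> configs H \<Longrightarrow> A x \<le> A' x"
  shows "val P H I g A \<le> val P H I g A'"
  using val_lipschitz[OF v, of A A' "\<lambda>_. 0"] A mean_const[OF mean_configs[OF v]] by simp

lemma val_cong: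
  assumes v: "valid P H" and A: "\<And>x. x \<in> configs H \<Longrightarrow> A x = A' x"
  shows "val P H I g A = val P H I g A'"
  by (rule antisym; rule val_mono[OF v]) (use A in auto)

lemma success_le_p: assumes v: "valid P H" and A: "\<And>x. x \<in> configs H \<Longrightarrow> A x \<le> 1" shows "success P H f A \<le> p"
proof -
  have "success P H f A \<le> avg (configs H) (\<lambda>x. of_bool (win P f x))"
    unfolding success_def by (rule mean_mono[OF mean_configs[OF v]]) (use A in \<open>auto simp: of_bool_def\<close>)
  then show ?thesis using win_le[OF v, of f] by simp
qed

lemma val_le_p: "valid P H \<Longrightarrow> (\<And>x. x \<in> configs H \<Longrightarrow> A x \<le> 1) \<Longrightarrow> val P H I g A \<le> p"
  using val_attained[of H I g A] success_le_p by metis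

lemma val_nonneg: assumes v: "valid P H" and A: "\<And>x. x \<in> configs H \<Longrightarrow> 0 \<le> A x" shows "0 \<le> val P H I g A"
proof -
  have "0 \<le> success P H g A" unfolding success_def
    by (rule mean_ge[OF mean_configs[OF v]]) (use A in auto)
  then show ?thesis using success_le_val[OF v, of I g g A] by simp
qed

lemma val_subset:
  assumes v: "valid P H" and "J \<subseteq> I" "\<forall>i\<in>J. g i = g' i"
  shows "val P H I g A \<le> val P H J g' A"
proof -
  obtain f where f: "\<forall>i\<in>I. f i = g i" "val P H I g A = success P H f A" by (rule val_attained[OF v])
  have "\<forall>i\<in>J. f i = g' i" using f(1) assms(2,3) by (metis subsetD)
  then show ?thesis using success_le_val[OF v, of J f g' A] f(2) by simp
qed

text \<open>
  The finitely many behaviours of player \<open>i\<close> that can make a difference; their number is the entropy that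
  competes with concentration in \<open>blind_player\<close>.
\<close>
definition responses :: "config \<Rightarrow> nat \<Rightarrow> (config \<Rightarrow> nat) set" where
  "responses H i = PiE (configs (H(i := {}))) (\<lambda>_. H i)"

lemma val_choose:
  assumes v: "valid P H" and "i \<notin> I" "H i \<noteq> {}" and A: "\<And>x. x \<in> configs H \<Longrightarrow> 0 \<le> A x"
  obtains r where "r \<in> responses H i" "val P H I g A \<le> val P H (insert i I) (g(i := r)) A"
proof -
  obtain f where f: "\<forall>i\<in>I. f i = g i" "val P H I g A = success P H f A" by (rule val_attained[OF v])
  obtain a where a: "a \<in> H i" using assms by blast
  define r where "r = (\<lambda>z\<in>configs (H(i := {})). if f i z \<in> H i then f i z else a)"
  have r: "r \<in> responses H i" by (auto simp: r_def responses_def a)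
  have "win P (f(i := r)) x" if "win P f x" and x: "x \<in> configs H" for x
    unfolding win_def
  proof
    fix j assume "j \<in> P"
    then have w: "f j (x(j := {})) \<in> x j" using that by (auto simp: win_def)
    have "x(i := {}) \<in> configs (H(i := {}))" using x by (auto simp: configs_def Pi_def)
    moreover have "x j \<subseteq> H j" using x by (rule configs_sub)
    ultimately show "(f(i := r)) j (x(j := {})) \<in> x j" using w by (auto simp: r_def)
  qed
  then have "success P H f A \<le> success P H (f(i := r)) A"
    unfolding success_def by (intro mean_mono[OF mean_configs[OF v]]) (use A in \<open>auto simp: of_bool_def\<close>)
  also have "\<dots> \<le> val P H (insert i I) (g(i := r)) A"
    by (rule success_le_val[OF v]) (use f assms in auto)
  finally show ?thesis using that[OF r] f by simp
qed

lemma card_responses: assumes v: "valid P H" shows "card (responses H i) = card (H i) ^ card (configs (H(i := {})))"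
proof -
  have "finite (configs (H(i := {})))" by (rule finite_configs[OF finP]) (use v in \<open>auto simp: valid_def\<close>)
  then show ?thesis unfolding responses_def by (subst card_PiE) auto
qed

lemma finite_responses: assumes v: "valid P H" shows "finite (responses H i)"
proof -
  have "finite (configs (H(i := {})))" by (rule finite_configs[OF finP]) (use v in \<open>auto simp: valid_def\<close>)
  then show ?thesis unfolding responses_def by (rule finite_PiE) (use v in \<open>auto simp: valid_def\<close>)
qed

end

section \<open>Colourings and samplers\<close>

text \<open>
  A configuration is uncoloured (it counts), deleted (it is lost), or it has a colour and counts if that colour
  is switched on. In the application the colour is the hat picked by the last player, and it is on when
  that hat is black.
\<close>
datatype label = Free | Del | Col nat
type_synonym colouring = "config \<Rightarrow> label"

lemma sum_colour_le_1: assumes "finite C" shows "(\<Sum>c\<in>C. of_bool (L = Col c)) \<le> (1::real)"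
proof (cases "\<exists>c\<in>C. L = Col c")
  case True
  then obtain c where c: "c \<in> C" "L = Col c" by blast
  have "(\<Sum>c'\<in>C. of_bool (L = Col c')) = (\<Sum>c'\<in>C. if c' = c then 1 else (0::real))" using c by (intro sum.cong) auto
  then show ?thesis using c assms by simp
next
  case False
  then have "(\<Sum>c'\<in>C. of_bool (L = Col c')) = (0::real)" by (intro sum.neutral) auto
  then show ?thesis by simp
qed

definition live :: "colouring \<Rightarrow> nat set \<Rightarrow> config \<Rightarrow> real" where
  "live F y x = (case F x of Free \<Rightarrow> 1 | Del \<Rightarrow> 0 | Col c \<Rightarrow> of_bool (c \<in> y))"

lemma live_bounds: "0 \<le> live F y x" "live F y x \<le> 1"
  by (auto simp: live_def split: label.split)

text \<open>
  The measure of a colour class on the line through \<open>r\<close> in direction \<open>i\<close>; it does not depend on \<open>r i\<close>.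
\<close>
definition class_size :: "config \<Rightarrow> nat \<Rightarrow> colouring \<Rightarrow> config \<Rightarrow> nat \<Rightarrow> real" where
  "class_size H i F r c = avg (configs H) (\<lambda>z. of_bool (F (r(i := z i)) = Col c))"

definition max_class :: "config \<Rightarrow> nat \<Rightarrow> colouring \<Rightarrow> config \<Rightarrow> real" where
  "max_class H i F r = (SUP c. class_size H i F r c)"

text \<open>
  A sampler simulates a game with hats \<open>H\<close> inside a game with hats \<open>H'\<close>: its first component turns real
  stacks into simulated ones, its second component turns a chosen simulated hat into the real hat that is
  picked.
\<close>
type_synonym sampler = "(nat \<Rightarrow> nat set \<Rightarrow> nat set) \<times> (nat \<Rightarrow> nat \<Rightarrow> nat)"
type_synonym law = "(sampler \<Rightarrow> real) \<Rightarrow> real"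

definition sim :: "sampler \<Rightarrow> config \<Rightarrow> config" where
  "sim s x = (\<lambda>j. fst s j (x j))"

definition pull :: "sampler \<Rightarrow> strategy \<Rightarrow> strategy" where
  "pull s g = (\<lambda>j z. snd s j (g j ((sim s z)(j := {}))))"

definition compose :: "sampler \<Rightarrow> sampler \<Rightarrow> sampler" where
  "compose s s' = ((\<lambda>j. fst s j \<circ> fst s' j), (\<lambda>j. snd s' j \<circ> snd s j))"

definition samplers :: "config \<Rightarrow> config \<Rightarrow> sampler set" where
  "samplers H' H = {s. \<forall>j. \<forall>u. u \<subseteq> H' j \<longrightarrow> fst s j u \<subseteq> H j}"

lemma sim_compose: "sim (compose s s') x = sim s (sim s' x)"
  by (simp add: sim_def compose_def)

lemma sim_upd: "(sim s (x(j := u)))(j := v) = (sim s x)(j := v)"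
  by (auto simp: sim_def fun_eq_iff)

lemma sim_upd': "sim s (x(j := u)) = (sim s x)(j := fst s j u)"
  by (auto simp: sim_def fun_eq_iff)

lemma pull_compose: "pull (compose s s') g = pull s' (pull s g)"
proof -
  have "snd (compose s s') j = snd s' j \<circ> snd s j" for j by (simp add: compose_def)
  then show ?thesis by (simp add: pull_def sim_compose fun_eq_iff sim_upd)
qed

lemma sim_configs: "s \<in> samplers H' H \<Longrightarrow> x \<in> configs H' \<Longrightarrow> sim s x \<in> configs H"
  by (auto simp: samplers_def sim_def configs_def Pi_def)

lemma compose_samplers: "s \<in> samplers H' H \<Longrightarrow> s' \<in> samplers H'' H' \<Longrightarrow> compose s s' \<in> samplers H'' H"
  by (auto simp: samplers_def compose_def)

lemma win_pull: "win P (pull s g) x \<longleftrightarrow> (\<forall>j\<in>P. snd s j (g j ((sim s x)(j := {}))) \<in> x j)"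
  by (simp add: win_def pull_def sim_upd)

text \<open>
  A uniform real configuration yields, on average over the random sampler, a uniform simulated one.
\<close>
definition faithful :: "config \<Rightarrow> config \<Rightarrow> law \<Rightarrow> bool" where
  "faithful H' H D \<longleftrightarrow> (\<forall>G. D (\<lambda>s. avg (configs H') (\<lambda>x. G (sim s x))) = avg (configs H) G)"

lemma faithfulD: "faithful H' H D \<Longrightarrow> D (\<lambda>s. avg (configs H') (\<lambda>x. G (sim s x))) = avg (configs H) G"
  by (simp add: faithful_def)

text \<open>
  Colour classes that are small on all lines in direction \<open>i\<close> have, on average, small preimages on the
  lines of the simulating game. This is what allows smallness to be measured once and for all in the
  original game, while concentration takes place in the simulating one.
\<close>
definition spreads :: "config \<Rightarrow> config \<Rightarrow> law \<Rightarrow> nat \<Rightarrow> real \<Rightarrow> real \<Rightarrow> bool" where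
  "spreads H' H D i \<eta> \<rho> \<longleftrightarrow> (\<forall>F. (\<forall>x\<in>configs H. \<forall>c. class_size H i F x c \<le> \<eta>) \<longrightarrow>
     D (\<lambda>s. avg (configs H') (max_class H' i (\<lambda>x. F (sim s x)))) \<le> \<rho>)"

definition bind_sampler :: "law \<Rightarrow> law \<Rightarrow> law" where
  "bind_sampler D D' = (\<lambda>g. D (\<lambda>s. D' (\<lambda>d. g (compose s d))))"

context hat_game begin

lemma class_size_bounds: assumes v: "valid P H" shows "0 \<le> class_size H i F r c" "class_size H i F r c \<le> 1"
  unfolding class_size_def by (rule mean_ge[OF mean_configs[OF v]] mean_le[OF mean_configs[OF v]], simp)+

lemma class_size_le_max: assumes v: "valid P H" shows "class_size H i F r c \<le> max_class H i F r"
  unfolding max_class_def by (rule cSUP_upper) (auto intro!: bdd_aboveI2[where M=1] class_size_bounds[OF v])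

lemma max_class_le: "(\<And>c. class_size H i F r c \<le> a) \<Longrightarrow> max_class H i F r \<le> a"
  unfolding max_class_def by (rule cSUP_least) auto

lemma max_class_bounds: assumes v: "valid P H" shows "0 \<le> max_class H i F r" "max_class H i F r \<le> 1"
  using class_size_bounds[OF v, of i F r] class_size_le_max[OF v, of i F r] order_trans by (blast, intro max_class_le)

lemma class_size_upd: "class_size H i F (r(i := u)) c = class_size H i F r c"
  by (simp add: class_size_def)

lemma max_class_upd: "max_class H i F (r(i := u)) = max_class H i F r"
  by (simp add: max_class_def class_size_upd)

lemma mean_bind_sampler:
  "mean (samplers H' H) D \<Longrightarrow> mean (samplers H'' H') D' \<Longrightarrow> mean (samplers H'' H) (bind_sampler D D')"
  unfolding bind_sampler_def by (rule mean_bind[of "samplers H' H" D "samplers H'' H'" "\<lambda>_. D'"]) (auto intro: compose_samplers)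

lemma faithful_bind:
  assumes "mean (samplers H' H) D" "faithful H' H D" "faithful H'' H' D'"
  shows "faithful H'' H (bind_sampler D D')"
  unfolding faithful_def
proof
  fix G
  have "bind_sampler D D' (\<lambda>s. avg (configs H'') (\<lambda>x. G (sim s x)))
      = D (\<lambda>s. D' (\<lambda>d. avg (configs H'') (\<lambda>x. G (sim s (sim d x)))))"
    by (simp add: bind_sampler_def sim_compose)
  also have "\<dots> = D (\<lambda>s. avg (configs H') (\<lambda>x. G (sim s x)))"
    by (rule mean_cong[OF assms(1)]) (rule faithfulD[OF assms(3)])
  also have "\<dots> = avg (configs H) G" using assms(2) by (simp add: faithful_def)
  finally show "bind_sampler D D' (\<lambda>s. avg (configs H'') (\<lambda>x. G (sim s x))) = avg (configs H) G" .
qed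

text \<open>
  By Markov's inequality the classes seen by the second sampler exceed \<open>\<eta>'\<close> only on lines of measure
  \<open>\<rho> / \<eta>'\<close>; erasing the colours there makes the second property applicable. This gives smallness after any
  number of simulations, without following the correlations through them.
\<close>
lemma spreads_bind:
  assumes v: "valid P H" "valid P H'" "valid P H''"
    and D: "mean (samplers H' H) D" and D': "mean (samplers H'' H') D'" and f': "faithful H'' H' D'"
    and s: "spreads H' H D i \<eta> \<rho>" and s': "spreads H'' H' D' i \<eta>' \<rho>'" and pos: "\<eta>' > 0"
  shows "spreads H'' H (bind_sampler D D') i \<eta> (\<rho> / \<eta>' + \<rho>')"
  unfolding spreads_def
proof (intro allI impI)
  fix F assume F: "\<forall>x\<in>configs H. \<forall>c. class_size H i F x c \<le> \<eta>"
  have D1: "D (\<lambda>s. avg (configs H') (max_class H' i (\<lambda>x. F (sim s x)))) \<le> \<rho>"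
    using s F by (auto simp: spreads_def)
  have step: "D' (\<lambda>d. avg (configs H'') (max_class H'' i (\<lambda>x. F (sim (compose s d) x))))
      \<le> avg (configs H') (max_class H' i (\<lambda>x. F (sim s x))) / \<eta>' + \<rho>'" (is "?L \<le> _") for s
  proof -
    define T where "T = max_class H' i (\<lambda>x. F (sim s x))"
    define G where "G = (\<lambda>x. if T x \<le> \<eta>' then F (sim s x) else Del)"
    have Tu: "T (r(i := u)) = T r" for r u by (simp add: T_def max_class_upd)
    have "class_size H' i G r c \<le> \<eta>'" for r c
    proof (cases "T r \<le> \<eta>'")
      case True
      then have "class_size H' i G r c = class_size H' i (\<lambda>x. F (sim s x)) r c" by (simp add: class_size_def G_def Tu)
      also have "\<dots> \<le> T r" unfolding T_def by (rule class_size_le_max[OF v(2)])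
      finally show ?thesis using True by simp
    next
      case False then show ?thesis using pos mean_const[OF mean_configs[OF v(2)], of 0] by (simp add: class_size_def G_def Tu)
    qed
    then have G: "D' (\<lambda>d. avg (configs H'') (max_class H'' i (\<lambda>x. G (sim d x)))) \<le> \<rho>'"
      using s' by (auto simp: spreads_def)
    have pt: "max_class H'' i (\<lambda>x. F (sim (compose s d) x)) r \<le> max_class H'' i (\<lambda>x. G (sim d x)) r + of_bool (T (sim d r) > \<eta>')" for d r
    proof (cases "T (sim d r) \<le> \<eta>'")
      case True
      have "class_size H'' i (\<lambda>x. F (sim (compose s d) x)) r c = class_size H'' i (\<lambda>x. G (sim d x)) r c" for c
        using True by (simp add: class_size_def G_def Tu sim_compose sim_upd')
      then show ?thesis using True by (simp add: max_class_def)
    next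
      case False then show ?thesis using max_class_bounds[OF v(3), of i] by (simp add: add_increasing)
    qed
    have "?L \<le> D' (\<lambda>d. avg (configs H'') (\<lambda>r. max_class H'' i (\<lambda>x. G (sim d x)) r + of_bool (T (sim d r) > \<eta>')))"
      by (intro mean_mono[OF D'] mean_mono[OF mean_configs[OF v(3)]] pt)
    also have "\<dots> = D' (\<lambda>d. avg (configs H'') (max_class H'' i (\<lambda>x. G (sim d x)))) + D' (\<lambda>d. avg (configs H'') (\<lambda>r. of_bool (T (sim d r) > \<eta>')))"
      by (simp only: mean_add[OF mean_configs[OF v(3)]] mean_add[OF D'])
    also have "D' (\<lambda>d. avg (configs H'') (\<lambda>r. of_bool (T (sim d r) > \<eta>'))) = avg (configs H') (\<lambda>r. of_bool (T r > \<eta>'))"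
      by (rule faithfulD[OF f'])
    also have "\<dots> \<le> avg (configs H') T / \<eta>'"
      by (rule mean_markov[OF mean_configs[OF v(2)]]) (use pos max_class_bounds[OF v(2)] in \<open>auto simp: T_def\<close>)
    finally show ?thesis using G by (simp add: T_def)
  qed
  have "bind_sampler D D' (\<lambda>s. avg (configs H'') (max_class H'' i (\<lambda>x. F (sim s x))))
     \<le> D (\<lambda>s. avg (configs H') (max_class H' i (\<lambda>x. F (sim s x))) / \<eta>' + \<rho>')"
    unfolding bind_sampler_def by (intro mean_mono[OF D] step)
  also have "\<dots> = D (\<lambda>s. avg (configs H') (max_class H' i (\<lambda>x. F (sim s x)))) / \<eta>' + \<rho>'"
    by (simp only: mean_add[OF D] mean_divide[OF D] mean_const[OF D])
  also have "\<dots> \<le> \<rho> / \<eta>' + \<rho>'" using D1 pos by (simp add: divide_right_mono)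
  finally show "bind_sampler D D' (\<lambda>s. avg (configs H'') (max_class H'' i (\<lambda>x. F (sim s x)))) \<le> \<rho> / \<eta>' + \<rho>'" .
qed

end

section \<open>Pull-backs of balanced sets\<close>

lemma avg_upd:
  assumes "S k \<noteq> {}" "finite (S k)"
  shows "avg (Pi UNIV S) (\<lambda>x. avg (S k) (\<lambda>u. G (x(k := u)))) = avg (Pi UNIV S) G"
proof -
  let ?P = "Pi UNIV S"
  have "bij_betw (\<lambda>(x,u). (x(k := u), x k)) (?P \<times> S k) (?P \<times> S k)"
    by (rule bij_betw_byWitness[where f' = "\<lambda>(x,u). (x(k := u), x k)"])
       (auto simp: Pi_def fun_eq_iff)
  from avg_bij[OF this, of "\<lambda>(x,u). G x"]
  have "avg ?P (\<lambda>x. avg (S k) (\<lambda>u. G (x(k := u)))) = avg ?P (\<lambda>x. avg (S k) (\<lambda>u. G x))"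
    unfolding avg_prod by (simp add: case_prod_beta')
  also have "\<dots> = avg ?P G" using mean_const[OF mean_avg[OF assms(2,1)]] by simp
  finally show ?thesis .
qed

lemma avg_marginal:
  assumes "finite (Pi UNIV S)" "Pi UNIV S \<noteq> {}" "finite (S k)"
  shows "avg (Pi UNIV S) (\<lambda>x. g (x k)) = avg (S k) g"
proof -
  have "S k \<noteq> {}" using assms(2) by auto
  then have "avg (Pi UNIV S) (\<lambda>x. g (x k)) = avg (Pi UNIV S) (\<lambda>x. avg (S k) (\<lambda>u. g u))"
    using avg_upd[of S k "\<lambda>x. g (x k)"] assms by simp
  also have "\<dots> = avg (S k) g" using mean_const[OF mean_avg[OF assms(1,2)]] by simp
  finally show ?thesis .
qed

lemma PiE_as_Pi: "PiE A S = Pi UNIV (\<lambda>j. if j \<in> A then S j else {undefined})"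
  by (auto simp: PiE_def Pi_def extensional_def)

lemma avg_PiE_marginal:
  assumes A: "finite A" and a: "a \<in> A" and M: "finite M" "M \<noteq> {}"
  shows "avg (PiE A (\<lambda>_. M)) (\<lambda>\<phi>. g (\<phi> a)) = avg M g"
proof -
  let ?S = "\<lambda>j. if j \<in> A then M else {undefined}"
  have "avg (Pi UNIV ?S) (\<lambda>x. g (x a)) = avg (?S a) g"
  proof (rule avg_marginal)
    show "finite (Pi UNIV ?S)" using finite_PiE[OF A, of "\<lambda>_. M"] M by (simp add: PiE_as_Pi)
    have "PiE A (\<lambda>_. M) \<noteq> {}" using M by (simp add: PiE_eq_empty_iff)
    then show "Pi UNIV ?S \<noteq> {}" by (simp add: PiE_as_Pi)
  qed (use M in auto)
  then show ?thesis using a by (simp add: PiE_as_Pi)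
qed

lemma avg_PiE_insert:
  assumes "a \<notin> A"
  shows "avg (PiE (insert a A) (\<lambda>_. M)) g = avg M (\<lambda>b. avg (PiE A (\<lambda>_. M)) (\<lambda>\<phi>. g (\<phi>(a := b))))"
proof -
  have "bij_betw (\<lambda>(b, \<phi>). \<phi>(a := b)) (M \<times> PiE A (\<lambda>_. M)) (PiE (insert a A) (\<lambda>_. M))"
    unfolding bij_betw_def
    by (metis (no_types) PiE_insert_eq inj_combinator[OF assms])
  from avg_bij[OF this, of g] show ?thesis unfolding avg_prod by (simp add: case_prod_beta')
qed

lemma avg_Pow_insert:
  assumes "finite A" "a \<notin> A"
  shows "avg (Pow (insert a A)) g = (avg (Pow A) g + avg (Pow A) (\<lambda>S. g (insert a S))) / 2"
proof -
  have "inj_on (insert a) (Pow A)" using assms by (auto simp: inj_on_def)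
  moreover have "Pow A \<inter> insert a ` Pow A = {}" using assms by auto
  ultimately have "sum g (Pow (insert a A)) = sum g (Pow A) + (\<Sum>S\<in>Pow A. g (insert a S))"
    using assms by (simp add: Pow_insert sum.union_disjoint sum.reindex)
  moreover have "real (card (Pow (insert a A))) = 2 * real (card (Pow A))"
    using assms by (simp add: card_Pow)
  ultimately show ?thesis by (simp only: avg_def) (simp add: add_divide_distrib mult.commute del: card_Pow)
qed

definition sign_in :: "nat set \<Rightarrow> nat \<Rightarrow> real" where "sign_in u b = (if b \<in> u then 1 else -1)"

text \<open>
  With exactly half of \<open>M\<close> in \<open>Z\<close>, a uniform element of \<open>M\<close> is a fair coin for \<open>Z\<close>.
\<close>
definition balanced :: "nat set \<Rightarrow> nat set \<Rightarrow> bool" where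
  "balanced M Z \<longleftrightarrow> Z \<subseteq> M \<and> 2 * card Z = card M"

lemma balanced_avg: assumes "finite M" "M \<noteq> {}" "balanced M Z" shows "avg M (sign_in Z) = 0"
proof -
  have "(\<Sum>b\<in>M. sign_in Z b) = (\<Sum>b\<in>Z. 1) + (\<Sum>b\<in>M - Z. -1)"
    using assms by (subst sum.subset_diff[of Z M]) (auto simp: balanced_def sign_in_def)
  also have "\<dots> = 0"
  proof -
    have "finite Z" using assms by (auto simp: balanced_def intro: finite_subset)
    then show ?thesis using assms by (simp add: balanced_def card_Diff_subset of_nat_diff)
  qed
  finally show ?thesis by (simp add: avg_def)
qed

text \<open>
  A random identification of hats pulls a balanced stack back to an exactly uniform one. An exact statement is
  essential: a bias per hat, however small, would add up over the unbounded number of hats.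
\<close>
lemma pullback_uniform:
  assumes M: "finite M" "M \<noteq> {}" and Z: "balanced M Z" and A: "finite A"
  shows "avg (PiE A (\<lambda>_. M)) (\<lambda>\<phi>. G {a \<in> A. \<phi> a \<in> Z}) = avg (Pow A) G"
  using A
proof (induction A arbitrary: G)
  case empty show ?case by (simp add: avg_def)
next
  case (insert a A)
  have eq: "{x \<in> insert a A. (\<phi>(a := b)) x \<in> Z} = (if b \<in> Z then insert a {x \<in> A. \<phi> x \<in> Z} else {x \<in> A. \<phi> x \<in> Z})" for \<phi> b
    using insert.hyps by auto
  let ?g0 = "avg (Pow A) G" and ?g1 = "avg (Pow A) (\<lambda>S. G (insert a S))"
  have "avg (PiE (insert a A) (\<lambda>_. M)) (\<lambda>\<phi>. G {x \<in> insert a A. \<phi> x \<in> Z})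
    = avg M (\<lambda>b. avg (PiE A (\<lambda>_. M)) (\<lambda>\<phi>. G (if b \<in> Z then insert a {x \<in> A. \<phi> x \<in> Z} else {x \<in> A. \<phi> x \<in> Z})))"
    by (subst avg_PiE_insert[OF insert.hyps(2)]) (simp only: eq)
  also have "\<dots> = avg M (\<lambda>b. if b \<in> Z then ?g1 else ?g0)"
    using insert.IH[of G] insert.IH[of "\<lambda>S. G (insert a S)"]
    by (intro mean_cong[OF mean_avg[OF M]]) simp
  also have "\<dots> = avg M (\<lambda>b. (?g1 + ?g0) / 2 + (?g1 - ?g0) / 2 * sign_in Z b)"
    by (intro mean_cong[OF mean_avg[OF M]]) (simp add: sign_in_def field_simps)
  also have "\<dots> = (?g1 + ?g0) / 2"
    by (simp only: mean_add[OF mean_avg[OF M]] mean_cmult[OF mean_avg[OF M]] mean_const[OF mean_avg[OF M]] balanced_avg[OF M Z] mult_zero_right add_0_right)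
  finally show ?case using avg_Pow_insert[OF insert.hyps, of G] by simp
qed

text \<open>
  The first step of a Fourier expansion: even and odd part of \<open>f\<close> in the coordinate \<open>a\<close>.
\<close>
lemma avg_square_Pow_insert:
  fixes f :: "'a set \<Rightarrow> real"
  assumes "finite A" "a \<notin> A"
  defines "fa \<equiv> \<lambda>S. (f (insert a S) + f S) / 2" and "fd \<equiv> \<lambda>S. (f (insert a S) - f S) / 2"
  shows "avg (Pow (insert a A)) (\<lambda>S. (f S)\<^sup>2) = avg (Pow A) (\<lambda>S. (fa S)\<^sup>2) + avg (Pow A) (\<lambda>S. (fd S)\<^sup>2)"
    and "avg (Pow (insert a A)) f = avg (Pow A) fa"
proof -
  have m: "mean (Pow A) (avg (Pow A))" using assms(1) by (intro mean_avg) auto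
  show "avg (Pow (insert a A)) (\<lambda>S. (f S)\<^sup>2) = avg (Pow A) (\<lambda>S. (fa S)\<^sup>2) + avg (Pow A) (\<lambda>S. (fd S)\<^sup>2)"
    unfolding avg_Pow_insert[OF assms(1,2)] mean_add[OF m, symmetric] mean_divide[OF m, symmetric]
    by (rule mean_cong[OF m]) (simp add: fa_def fd_def power2_eq_square field_simps)
  show "avg (Pow (insert a A)) f = avg (Pow A) fa"
    unfolding avg_Pow_insert[OF assms(1,2)] mean_add[OF m, symmetric] mean_divide[OF m, symmetric]
    by (rule mean_cong[OF m]) (simp add: fa_def field_simps)
qed

text \<open>
  Two balanced stacks with correlation \<open>\<theta>\<close> pull back to two uniform points whose coordinates are independent
  and have correlation \<open>\<theta>\<close>. Their maximal correlation is at most \<open>\<bar>\<theta>\<bar>\<close>; for \<open>f\<close> the indicator of a class of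
  measure \<open>\<mu>\<close> this bounds the probability that both points lie in it by
  \<open>\<mu>\<^sup>2 + \<bar>\<theta>\<bar> \<mu>\<close>. The induction splits \<open>f\<close> into even and odd part in one coordinate; the mixed terms vanish because the two stacks are balanced.
\<close>
lemma pullback_correlation:
  assumes M: "finite M" "M \<noteq> {}" and Z: "balanced M Z" "balanced M Z'" and A: "finite A"
  defines "\<theta> \<equiv> avg M (\<lambda>b. sign_in Z b * sign_in Z' b)"
  shows "avg (PiE A (\<lambda>_. M)) (\<lambda>\<phi>. f {a \<in> A. \<phi> a \<in> Z} * f {a \<in> A. \<phi> a \<in> Z'})
     \<le> (avg (Pow A) f)\<^sup>2 + \<bar>\<theta>\<bar> * (avg (Pow A) (\<lambda>S. (f S)\<^sup>2) - (avg (Pow A) f)\<^sup>2)"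
  using A
proof (induction A arbitrary: f)
  case empty show ?case by (simp add: avg_def power2_eq_square)
next
  case (insert a A)
  let ?E = "PiE A (\<lambda>_. M)"
  let ?S = "\<lambda>\<phi>. {x \<in> A. \<phi> x \<in> Z}" and ?S' = "\<lambda>\<phi>. {x \<in> A. \<phi> x \<in> Z'}"
  have mM: "mean M (avg M)" by (rule mean_avg[OF M])
  have mE: "mean ?E (avg ?E)" using M insert.hyps by (intro mean_avg finite_PiE) (auto simp: PiE_eq_empty_iff)
  define fa where "fa S = (f (insert a S) + f S) / 2" for S
  define fd where "fd S = (f (insert a S) - f S) / 2" for S
  have eq: "f {x \<in> insert a A. (\<phi>(a := b)) x \<in> Z} = fa {x \<in> A. \<phi> x \<in> Z} + sign_in Z b * fd {x \<in> A. \<phi> x \<in> Z}" for \<phi> b Z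
  proof -
    have "{x \<in> insert a A. (\<phi>(a := b)) x \<in> Z} = (if b \<in> Z then insert a {x \<in> A. \<phi> x \<in> Z} else {x \<in> A. \<phi> x \<in> Z})"
      using insert.hyps by auto
    then show ?thesis by (simp add: fa_def fd_def sign_in_def field_simps)
  qed
  define aa where "aa = avg ?E (\<lambda>\<phi>. fa (?S \<phi>) * fa (?S' \<phi>))"
  define ad where "ad = avg ?E (\<lambda>\<phi>. fa (?S \<phi>) * fd (?S' \<phi>))"
  define da where "da = avg ?E (\<lambda>\<phi>. fd (?S \<phi>) * fa (?S' \<phi>))"
  define dd where "dd = avg ?E (\<lambda>\<phi>. fd (?S \<phi>) * fd (?S' \<phi>))"
  have "avg (PiE (insert a A) (\<lambda>_. M)) (\<lambda>\<phi>. f {x \<in> insert a A. \<phi> x \<in> Z} * f {x \<in> insert a A. \<phi> x \<in> Z'})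
    = avg M (\<lambda>b. avg ?E (\<lambda>\<phi>. (fa (?S \<phi>) + sign_in Z b * fd (?S \<phi>)) * (fa (?S' \<phi>) + sign_in Z' b * fd (?S' \<phi>))))"
    by (subst avg_PiE_insert[OF insert.hyps(2)]) (simp only: eq)
  also have "\<dots> = avg M (\<lambda>b. aa + ad * sign_in Z' b + da * sign_in Z b + dd * (sign_in Z b * sign_in Z' b))"
  proof (rule mean_cong[OF mM])
    fix b
    have "avg ?E (\<lambda>\<phi>. (fa (?S \<phi>) + sign_in Z b * fd (?S \<phi>)) * (fa (?S' \<phi>) + sign_in Z' b * fd (?S' \<phi>)))
      = avg ?E (\<lambda>\<phi>. fa (?S \<phi>) * fa (?S' \<phi>) + sign_in Z' b * (fa (?S \<phi>) * fd (?S' \<phi>)) + sign_in Z b * (fd (?S \<phi>) * fa (?S' \<phi>))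
          + sign_in Z b * sign_in Z' b * (fd (?S \<phi>) * fd (?S' \<phi>)))"
      by (intro mean_cong[OF mE]) (simp add: algebra_simps)
    then show "avg ?E (\<lambda>\<phi>. (fa (?S \<phi>) + sign_in Z b * fd (?S \<phi>)) * (fa (?S' \<phi>) + sign_in Z' b * fd (?S' \<phi>)))
       = aa + ad * sign_in Z' b + da * sign_in Z b + dd * (sign_in Z b * sign_in Z' b)"
      by (simp only: mean_add[OF mE] mean_cmult[OF mE] aa_def ad_def da_def dd_def mult_ac)
  qed
  also have "\<dots> = aa + \<theta> * dd"
    by (simp only: mean_add[OF mM] mean_cmult[OF mM] mean_const[OF mM] balanced_avg[OF M Z(1)] balanced_avg[OF M Z(2)] \<theta>_def)
       simp
  also have "\<dots> \<le> ((avg (Pow A) fa)\<^sup>2 + \<bar>\<theta>\<bar> * (avg (Pow A) (\<lambda>S. (fa S)\<^sup>2) - (avg (Pow A) fa)\<^sup>2)) + \<bar>\<theta>\<bar> * avg (Pow A) (\<lambda>S. (fd S)\<^sup>2)"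
  proof (rule add_mono)
    show "aa \<le> (avg (Pow A) fa)\<^sup>2 + \<bar>\<theta>\<bar> * (avg (Pow A) (\<lambda>S. (fa S)\<^sup>2) - (avg (Pow A) fa)\<^sup>2)"
      unfolding aa_def by (rule insert.IH)
    have u: "avg ?E (\<lambda>\<phi>. (fd (?S \<phi>))\<^sup>2) = avg (Pow A) (\<lambda>S. (fd S)\<^sup>2)" "avg ?E (\<lambda>\<phi>. (fd (?S' \<phi>))\<^sup>2) = avg (Pow A) (\<lambda>S. (fd S)\<^sup>2)"
      using pullback_uniform[OF M Z(1) insert.hyps(1), of "\<lambda>S. (fd S)\<^sup>2"] pullback_uniform[OF M Z(2) insert.hyps(1), of "\<lambda>S. (fd S)\<^sup>2"] by auto
    have b1: "fd S * fd S' \<le> ((fd S)\<^sup>2 + (fd S')\<^sup>2) / 2" "- ((fd S)\<^sup>2 + (fd S')\<^sup>2) / 2 \<le> fd S * fd S'" for S S'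
      using sum_squares_bound[of "fd S" "fd S'"] sum_squares_bound[of "fd S" "- fd S'"] by auto
    have "dd \<le> avg ?E (\<lambda>\<phi>. ((fd (?S \<phi>))\<^sup>2 + (fd (?S' \<phi>))\<^sup>2) / 2)"
      unfolding dd_def by (rule mean_mono[OF mE]) (rule b1)
    also have "\<dots> = avg (Pow A) (\<lambda>S. (fd S)\<^sup>2)" by (simp only: mean_divide[OF mE] mean_add[OF mE] u) simp
    finally have 1: "dd \<le> avg (Pow A) (\<lambda>S. (fd S)\<^sup>2)" .
    have "avg ?E (\<lambda>\<phi>. -1 * (((fd (?S \<phi>))\<^sup>2 + (fd (?S' \<phi>))\<^sup>2) / 2)) \<le> dd"
      unfolding dd_def by (rule mean_mono[OF mE]) (use b1 in simp)
    then have 2: "- avg (Pow A) (\<lambda>S. (fd S)\<^sup>2) \<le> dd" by (simp only: mean_cmult[OF mE] mean_divide[OF mE] mean_add[OF mE] u) simp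
    have "\<theta> * dd \<le> \<bar>\<theta>\<bar> * \<bar>dd\<bar>" by (metis abs_ge_self abs_mult)
    also have "\<dots> \<le> \<bar>\<theta>\<bar> * avg (Pow A) (\<lambda>S. (fd S)\<^sup>2)" using 1 2 by (intro mult_left_mono) auto
    finally show "\<theta> * dd \<le> \<bar>\<theta>\<bar> * avg (Pow A) (\<lambda>S. (fd S)\<^sup>2)" .
  qed
  also have "\<dots> = (avg (Pow (insert a A)) f)\<^sup>2 + \<bar>\<theta>\<bar> * (avg (Pow (insert a A)) (\<lambda>S. (f S)\<^sup>2) - (avg (Pow (insert a A)) f)\<^sup>2)"
    unfolding avg_square_Pow_insert[OF insert.hyps, of f] fa_def fd_def by (simp add: algebra_simps)
  finally show ?case .
qed

lemma rademacher_square: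
  assumes "finite M"
  shows "avg (Pow M) (\<lambda>u. (\<Sum>b\<in>M. sign_in u b * w b)\<^sup>2) = (\<Sum>b\<in>M. (w b)\<^sup>2)"
  using assms
proof (induction M)
  case empty show ?case by (simp add: avg_def)
next
  case (insert a M)
  let ?s = "\<lambda>u. \<Sum>b\<in>M. sign_in u b * w b"
  have m: "mean (Pow M) (avg (Pow M))" using insert.hyps by (intro mean_avg) auto
  have 0: "(\<Sum>b\<in>M. sign_in (insert a u) b * w b) = ?s u" for u
    using insert.hyps by (intro sum.cong) (auto simp: sign_in_def)
  have "avg (Pow (insert a M)) (\<lambda>u. (\<Sum>b\<in>insert a M. sign_in u b * w b)\<^sup>2)
     = (avg (Pow M) (\<lambda>u. (- w a + ?s u)\<^sup>2) + avg (Pow M) (\<lambda>u. (w a + ?s u)\<^sup>2)) / 2"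
    unfolding avg_Pow_insert[OF insert.hyps]
  proof (rule arg_cong2[where f = "\<lambda>x y. (x + y) / 2"]; rule mean_cong[OF m])
    fix u assume "u \<in> Pow M"
    then have "a \<notin> u" using insert.hyps by auto
    then show "(\<Sum>b\<in>insert a M. sign_in u b * w b)\<^sup>2 = (- w a + ?s u)\<^sup>2"
      using insert.hyps by (simp add: sign_in_def)
    show "(\<Sum>b\<in>insert a M. sign_in (insert a u) b * w b)\<^sup>2 = (w a + ?s u)\<^sup>2"
      using insert.hyps by (simp add: 0) (simp add: sign_in_def)
  qed
  also have "\<dots> = avg (Pow M) (\<lambda>u. (?s u)\<^sup>2 + (w a)\<^sup>2)"
    unfolding mean_add[OF m, symmetric] mean_divide[OF m, symmetric]
    by (rule mean_cong[OF m]) (simp add: power2_eq_square algebra_simps)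
  also have "\<dots> = (\<Sum>b\<in>M. (w b)\<^sup>2) + (w a)\<^sup>2" by (simp only: mean_add[OF m] mean_const[OF m] insert.IH)
  finally show ?case using insert.hyps by simp
qed

text \<open>
  Being comparable with \<open>u\<close>, the chosen set differs from \<open>u\<close> only by the excess of one colour, which for a
  random stack is of the order of the square root of the number of hats.
\<close>
definition balance :: "nat set \<Rightarrow> nat set \<Rightarrow> nat set" where
  "balance M u = (SOME Z. balanced M Z \<and> (Z \<subseteq> u \<or> u \<subseteq> Z))"

lemma balance:
  assumes "finite M" "even (card M)" "u \<subseteq> M"
  shows "balanced M (balance M u)" "balance M u \<subseteq> u \<or> u \<subseteq> balance M u"
proof -
  obtain k where k: "card M = 2 * k" using assms(2) by blast
  have "\<exists>Z. balanced M Z \<and> (Z \<subseteq> u \<or> u \<subseteq> Z)"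
  proof (cases "k \<le> card u")
    case True
    then obtain Z where "Z \<subseteq> u" "card Z = k" by (meson obtain_subset_with_card_n)
    then show ?thesis using assms k by (auto simp: balanced_def)
  next
    case False
    have fu: "finite u" using assms finite_subset by blast
    have "k - card u \<le> card (M - u)" using assms fu k by (simp add: card_Diff_subset)
    then obtain Y where Y: "Y \<subseteq> M - u" "card Y = k - card u" by (meson obtain_subset_with_card_n)
    have "card (u \<union> Y) = card u + card Y" using Y fu assms
      by (intro card_Un_disjoint) (auto intro: finite_subset)
    then have "balanced M (u \<union> Y)" using Y assms k False by (auto simp: balanced_def)
    then show ?thesis by blast
  qed
  then have "balanced M (balance M u) \<and> (balance M u \<subseteq> u \<or> u \<subseteq> balance M u)" unfolding balance_def by (rule someI_ex)
  then show "balanced M (balance M u)" "balance M u \<subseteq> u \<or> u \<subseteq> balance M u" by auto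
qed

lemma balance_diff:
  assumes "finite M" "even (card M)" "u \<subseteq> M"
  shows "(\<Sum>b\<in>M. \<bar>sign_in (balance M u) b - sign_in u b\<bar>) = \<bar>\<Sum>b\<in>M. sign_in u b\<bar>"
proof (cases "M = {}")
  case False
  have s: "balance M u \<subseteq> u \<or> u \<subseteq> balance M u" and b: "balanced M (balance M u)" by (rule balance[OF assms])+
  have 0: "(\<Sum>b\<in>M. sign_in (balance M u) b) = 0"
    using balanced_avg[OF assms(1) False b] assms(1) False by (simp add: avg_def)
  from s show ?thesis
  proof
    assume "balance M u \<subseteq> u"
    then have "(\<Sum>b\<in>M. \<bar>sign_in (balance M u) b - sign_in u b\<bar>) = (\<Sum>b\<in>M. sign_in u b - sign_in (balance M u) b)"
      by (intro sum.cong) (auto simp: sign_in_def)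
    moreover have "0 \<le> (\<Sum>b\<in>M. \<bar>sign_in (balance M u) b - sign_in u b\<bar>)" by (intro sum_nonneg) auto
    ultimately show ?thesis using 0 by (simp add: sum_subtractf)
  next
    assume "u \<subseteq> balance M u"
    then have "(\<Sum>b\<in>M. \<bar>sign_in (balance M u) b - sign_in u b\<bar>) = (\<Sum>b\<in>M. sign_in (balance M u) b - sign_in u b)"
      by (intro sum.cong) (auto simp: sign_in_def)
    moreover have "0 \<le> (\<Sum>b\<in>M. \<bar>sign_in (balance M u) b - sign_in u b\<bar>)" by (intro sum_nonneg) auto
    ultimately show ?thesis using 0 by (simp add: sum_subtractf)
  qed
qed (simp)

lemma avg_abs_sign_sum:
  assumes "finite M" "\<And>b. \<bar>w b\<bar> = 1"
  shows "avg (Pow M) (\<lambda>u. \<bar>\<Sum>b\<in>M. sign_in u b * w b\<bar>) \<le> sqrt (card M)"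
proof -
  have "(w b)\<^sup>2 = 1" for b using assms(2)[of b] by (metis abs_square_eq_1)
  moreover have "Pow M \<noteq> {}" by auto
  ultimately show ?thesis
    using mean_abs_le[OF mean_avg[of "Pow M"], of "\<lambda>u. \<Sum>b\<in>M. sign_in u b * w b"] assms(1) rademacher_square[OF assms(1), of w]
    by simp
qed

text \<open>
  The excess of a random stack of \<open>m\<close> hats is about \<open>\<surd>m\<close>, so a random hat is altered with probability of
  order \<open>1/\<surd>m\<close>.
\<close>
lemma balance_error:
  assumes M: "finite M" "M \<noteq> {}" "even (card M)"
  shows "avg (Pow M) (\<lambda>u. avg M (\<lambda>b. of_bool (b \<in> balance M u \<and> b \<notin> u))) \<le> 1 / (2 * sqrt (card M))"
proof -
  let ?m = "real (card M)"
  have m: "?m > 0" using M by (simp add: card_gt_0_iff)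
  have mP: "mean (Pow M) (avg (Pow M))" using M by (intro mean_avg) auto
  have "avg M (\<lambda>b. of_bool (b \<in> balance M u \<and> b \<notin> u)) \<le> \<bar>\<Sum>b\<in>M. sign_in u b * 1\<bar> * (1 / (2 * ?m))" if "u \<in> Pow M" for u
  proof -
    have "2 * (\<Sum>b\<in>M. of_bool (b \<in> balance M u \<and> b \<notin> u)) = (\<Sum>b\<in>M. (2::real) * of_bool (b \<in> balance M u \<and> b \<notin> u))"
      by (simp add: sum_distrib_left)
    also have "\<dots> \<le> (\<Sum>b\<in>M. \<bar>sign_in (balance M u) b - sign_in u b\<bar>)"
      by (intro sum_mono) (auto simp: sign_in_def)
    also have "\<dots> = \<bar>\<Sum>b\<in>M. sign_in u b * 1\<bar>" using balance_diff[OF M(1,3)] that by simp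
    finally have "(\<Sum>b\<in>M. of_bool (b \<in> balance M u \<and> b \<notin> u)) \<le> \<bar>\<Sum>b\<in>M. sign_in u b * 1\<bar> / 2" by simp
    then show ?thesis using m unfolding avg_def by (simp add: field_simps)
  qed
  then have "avg (Pow M) (\<lambda>u. avg M (\<lambda>b. of_bool (b \<in> balance M u \<and> b \<notin> u)))
    \<le> avg (Pow M) (\<lambda>u. (1 / (2 * ?m)) * \<bar>\<Sum>b\<in>M. sign_in u b * 1\<bar>)"
    by (intro mean_mono[OF mP]) (simp add: mult.commute)
  also have "\<dots> = (1 / (2 * ?m)) * avg (Pow M) (\<lambda>u. \<bar>\<Sum>b\<in>M. sign_in u b * 1\<bar>)"
    by (rule mean_cmult[OF mP])
  also have "\<dots> \<le> (1 / (2 * ?m)) * sqrt ?m"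
    using avg_abs_sign_sum[OF M(1), of "\<lambda>_. 1"] m by (intro mult_left_mono) auto
  also have "\<dots> = 1 / (2 * sqrt ?m)" using m by (simp add: field_simps)
  finally show ?thesis .
qed

text \<open>
  Two independent stacks have correlation of order \<open>1/\<surd>m\<close>, and balancing them changes it by an amount of the
  same order.
\<close>
lemma balance_correlation:
  assumes M: "finite M" "M \<noteq> {}" "even (card M)"
  shows "avg (Pow M) (\<lambda>u. avg (Pow M) (\<lambda>v. \<bar>avg M (\<lambda>b. sign_in (balance M u) b * sign_in (balance M v) b)\<bar>)) \<le> 3 / sqrt (card M)"
proof -
  let ?m = "real (card M)"
  have m: "?m > 0" using M by (simp add: card_gt_0_iff)
  have mP: "mean (Pow M) (avg (Pow M))" using M by (intro mean_avg) auto
  let ?d = "\<lambda>u. \<bar>\<Sum>b\<in>M. sign_in u b * 1\<bar>"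
  let ?c = "\<lambda>u v. \<bar>\<Sum>b\<in>M. sign_in u b * sign_in v b\<bar>"
  have 1: "\<bar>avg M (\<lambda>b. sign_in (balance M u) b * sign_in (balance M v) b)\<bar> \<le> (1 / ?m) * (?d u + ?d v + ?c v u)"
    if uv: "u \<in> Pow M" "v \<in> Pow M" for u v
  proof -
    have "\<bar>\<Sum>b\<in>M. sign_in (balance M u) b * sign_in (balance M v) b\<bar> - ?c u v
        \<le> \<bar>\<Sum>b\<in>M. sign_in (balance M u) b * sign_in (balance M v) b - sign_in u b * sign_in v b\<bar>"
      by (simp add: sum_subtractf)
    also have "\<dots> \<le> (\<Sum>b\<in>M. \<bar>sign_in (balance M u) b * sign_in (balance M v) b - sign_in u b * sign_in v b\<bar>)"
      by (rule sum_abs)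
    also have "\<dots> \<le> (\<Sum>b\<in>M. \<bar>sign_in (balance M u) b - sign_in u b\<bar> + \<bar>sign_in (balance M v) b - sign_in v b\<bar>)"
      by (intro sum_mono) (auto simp: sign_in_def)
    also have "\<dots> = ?d u + ?d v" using balance_diff[OF M(1,3)] uv by (simp add: sum.distrib)
    finally have "\<bar>\<Sum>b\<in>M. sign_in (balance M u) b * sign_in (balance M v) b\<bar> \<le> ?d u + ?d v + ?c v u" by (simp add: mult.commute)
    then show ?thesis using m unfolding avg_def by (simp add: field_simps)
  qed
  have d: "avg (Pow M) ?d \<le> sqrt ?m" using avg_abs_sign_sum[OF M(1), of "\<lambda>_. 1"] by simp
  have c: "avg (Pow M) (\<lambda>v. ?c v u) \<le> sqrt ?m" for u
    by (rule avg_abs_sign_sum[OF M(1)]) (simp add: sign_in_def)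
  have "avg (Pow M) (\<lambda>u. avg (Pow M) (\<lambda>v. \<bar>avg M (\<lambda>b. sign_in (balance M u) b * sign_in (balance M v) b)\<bar>))
     \<le> avg (Pow M) (\<lambda>u. avg (Pow M) (\<lambda>v. (1 / ?m) * (?d u + ?d v + ?c v u)))"
    by (intro mean_mono[OF mP] 1)
  also have "\<dots> = avg (Pow M) (\<lambda>u. (1 / ?m) * (?d u + avg (Pow M) ?d + avg (Pow M) (\<lambda>v. ?c v u)))"
    by (simp only: mean_cmult[OF mP] mean_add[OF mP] mean_const[OF mP])
  also have "\<dots> \<le> avg (Pow M) (\<lambda>u. (1 / ?m) * (?d u + sqrt ?m + sqrt ?m))"
    using d c m by (intro mean_mono[OF mP] mult_left_mono add_mono) auto
  also have "\<dots> = (1 / ?m) * (avg (Pow M) ?d + sqrt ?m + sqrt ?m)"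
    by (simp only: mean_cmult[OF mP] mean_add[OF mP] mean_const[OF mP])
  also have "\<dots> \<le> (1 / ?m) * (sqrt ?m + sqrt ?m + sqrt ?m)"
    using d m by (intro mult_left_mono add_mono) auto
  also have "\<dots> = 3 / sqrt ?m" using m by (simp add: field_simps)
  finally show ?thesis .
qed

section \<open>Simulation with few hats\<close>

definition hat_maps :: "config \<Rightarrow> config \<Rightarrow> (nat \<Rightarrow> nat \<Rightarrow> nat) set" where
  "hat_maps H' H = Pi UNIV (\<lambda>j. PiE (H j) (\<lambda>_. H' j))"

definition hat_sampler :: "config \<Rightarrow> config \<Rightarrow> (nat \<Rightarrow> nat \<Rightarrow> nat) \<Rightarrow> sampler" where
  "hat_sampler H' H \<phi> = ((\<lambda>j u. {a \<in> H j. \<phi> j a \<in> balance (H' j) u}), \<phi>)"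

text \<open>
  The basic sampler: independently for each player every simulated hat is identified with a random real hat,
  after the real stack has been balanced.
\<close>
definition random_hats :: "config \<Rightarrow> config \<Rightarrow> law" where
  "random_hats H' H = (\<lambda>g. avg (hat_maps H' H) (\<lambda>\<phi>. g (hat_sampler H' H \<phi>)))"

lemma mean_image: "mean S M \<Longrightarrow> (\<And>x. x \<in> S \<Longrightarrow> c x \<in> R) \<Longrightarrow> mean R (\<lambda>g. M (\<lambda>x. g (c x)))"
  unfolding mean_def by auto

context hat_game begin

context
  fixes H H' :: config
  assumes v: "valid P H" and v': "valid P H'"
    and ne: "\<And>j. j \<in> P \<Longrightarrow> H' j \<noteq> {}" and ev: "\<And>j. j \<in> P \<Longrightarrow> even (card (H' j))"
begin

abbreviation "\<Phi> \<equiv> hat_maps H' H"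

lemma H_fin: "finite (H j)" "finite (H' j)" using v v' by (auto simp: valid_def)

lemma maps_fin: "finite \<Phi>"
  unfolding hat_maps_def
proof (rule finite_Pi_UNIV[OF finP])
  fix j show "finite (PiE (H j) (\<lambda>_. H' j))" using H_fin by (intro finite_PiE) auto
  assume "j \<notin> P" then have "H j = {}" using v by (auto simp: valid_def)
  then show "\<exists>a. PiE (H j) (\<lambda>_. H' j) \<subseteq> {a}" by auto
qed

lemma maps_comp: "PiE (H j) (\<lambda>_. H' j) \<noteq> {}" "finite (PiE (H j) (\<lambda>_. H' j))"
proof -
  show "PiE (H j) (\<lambda>_. H' j) \<noteq> {}" using ne v by (cases "j \<in> P") (auto simp: PiE_eq_empty_iff valid_def)
  show "finite (PiE (H j) (\<lambda>_. H' j))" using H_fin by (intro finite_PiE) auto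
qed

lemma maps_ne: "\<Phi> \<noteq> {}"
  unfolding hat_maps_def using maps_comp(1) by (simp add: Pi_eq_empty)

lemma mean_maps: "mean \<Phi> (avg \<Phi>)" by (rule mean_avg[OF maps_fin maps_ne])

lemma avg_maps_upd: "avg \<Phi> (\<lambda>\<phi>. avg (PiE (H k) (\<lambda>_. H' k)) (\<lambda>\<psi>. g (\<phi>(k := \<psi>)))) = avg \<Phi> g"
  unfolding hat_maps_def by (rule avg_upd[of "\<lambda>j. PiE (H j) (\<lambda>_. H' j)"]) (rule maps_comp)+

lemma avg_configs_upd: "avg (configs G) (\<lambda>x. avg (Pow (G k)) (\<lambda>u. g (x(k := u)))) = avg (configs G) g" if "valid P G" for G
  unfolding configs_def by (rule avg_upd[of "\<lambda>j. Pow (G j)"]) (use that in \<open>auto simp: valid_def\<close>)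

lemma avg_configs_marginal: "avg (configs G) (\<lambda>x. g (x k)) = avg (Pow (G k)) g" if "valid P G" for G
  using avg_marginal[of "\<lambda>j. Pow (G j)" k g] finite_configs[OF finP that] configs_ne[of G] that
  by (simp add: configs_def valid_def)

lemma sampler_in: "hat_sampler H' H \<phi> \<in> samplers H' H"
  by (auto simp: hat_sampler_def samplers_def)

lemma mean_random_hats: "mean (samplers H' H) (random_hats H' H)"
  unfolding random_hats_def by (rule mean_image[OF mean_maps]) (rule sampler_in)

lemma sim_sampler: "sim (hat_sampler H' H \<phi>) x = (\<lambda>j. {a \<in> H j. \<phi> j a \<in> balance (H' j) (x j)})"
  by (simp add: sim_def hat_sampler_def)

lemma sim_sampler_upd: "sim (hat_sampler H' H (\<phi>(k := \<psi>))) x = (sim (hat_sampler H' H \<phi>) x)(k := {a \<in> H k. \<psi> a \<in> balance (H' k) (x k)})"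
  by (auto simp: sim_sampler fun_eq_iff)

lemma balance_ok: "k \<in> P \<Longrightarrow> u \<subseteq> H' k \<Longrightarrow> balanced (H' k) (balance (H' k) u)"
  by (rule balance(1)) (auto simp: H_fin ev)

text \<open>
  This holds for each single real configuration, not only on average.
\<close>
lemma random_hats_uniform:
  assumes x: "x \<in> configs H'"
  shows "avg \<Phi> (\<lambda>\<phi>. G (sim (hat_sampler H' H \<phi>) x)) = avg (configs H) G"
proof -
  (* The coordinates in Q are simulated, the others are uniform; they are exchanged one by one. *)
  have "avg \<Phi> (\<lambda>\<phi>. avg (configs H) (\<lambda>y. G (mix Q (sim (hat_sampler H' H \<phi>) x) y))) = avg (configs H) G" if "Q \<subseteq> P" for Q
    using finite_subset[OF that finP] that
  proof (induction Q)
    case empty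
    have "mix {} a y = y" for a y :: config by (auto simp: mix_def)
    then show ?case by (simp add: mean_const[OF mean_maps])
  next
    case (insert k Q)
    have k: "k \<in> P" using insert by auto
    let ?s = "\<lambda>\<psi>. {a \<in> H k. \<psi> a \<in> balance (H' k) (x k)}"
    let ?E = "PiE (H k) (\<lambda>_. H' k)"
    let ?sim = "\<lambda>\<phi>. sim (hat_sampler H' H \<phi>) x"
    have e: "mix (insert k Q) ((?sim \<phi>)(k := S)) y = (mix Q (?sim \<phi>) y)(k := S)" for \<phi> S y
      using insert.hyps by (auto simp: mix_def fun_eq_iff)
    have e2: "mix Q a (y(k := S)) = (mix Q a y)(k := S)" for a S and y :: config
      using insert.hyps by (auto simp: mix_def fun_eq_iff)
    have u: "avg ?E (\<lambda>\<psi>. g (?s \<psi>)) = avg (Pow (H k)) g" for g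
      by (rule pullback_uniform[OF H_fin(2) ne[OF k] balance_ok[OF k configs_sub[OF x]] H_fin(1)])
    have "avg \<Phi> (\<lambda>\<phi>. avg (configs H) (\<lambda>y. G (mix (insert k Q) (?sim \<phi>) y)))
      = avg \<Phi> (\<lambda>\<phi>. avg ?E (\<lambda>\<psi>. avg (configs H) (\<lambda>y. G ((mix Q (?sim \<phi>) y)(k := ?s \<psi>)))))"
      by (subst avg_maps_upd[symmetric, of _ k]) (simp only: sim_sampler_upd e)
    also have "\<dots> = avg \<Phi> (\<lambda>\<phi>. avg (configs H) (\<lambda>y. avg ?E (\<lambda>\<psi>. G ((mix Q (?sim \<phi>) y)(k := ?s \<psi>)))))"
      by (rule mean_cong[OF mean_maps]) (rule avg_swap)
    also have "\<dots> = avg \<Phi> (\<lambda>\<phi>. avg (configs H) (\<lambda>y. avg (Pow (H k)) (\<lambda>S. G (mix Q (?sim \<phi>) (y(k := S))))))"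
      unfolding e2 by (intro mean_cong[OF mean_maps] mean_cong[OF mean_configs[OF v]] u)
    also have "\<dots> = avg \<Phi> (\<lambda>\<phi>. avg (configs H) (\<lambda>y. G (mix Q (?sim \<phi>) y)))"
      by (rule mean_cong[OF mean_maps]) (rule avg_configs_upd[OF v])
    finally show ?case using insert by simp
  qed
  from this[OF order_refl]
  have "avg (configs H) G = avg \<Phi> (\<lambda>\<phi>. avg (configs H) (\<lambda>y. G (mix P (sim (hat_sampler H' H \<phi>) x) y)))" by simp
  also have "\<dots> = avg \<Phi> (\<lambda>\<phi>. avg (configs H) (\<lambda>y. G (sim (hat_sampler H' H \<phi>) x)))"
  proof (intro mean_cong[OF mean_maps] mean_cong[OF mean_configs[OF v]])
    fix \<phi> y assume y: "y \<in> configs H"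
    have "mix P (sim (hat_sampler H' H \<phi>) x) y = sim (hat_sampler H' H \<phi>) x"
    proof -
      have "j \<in> P" if "a \<in> y j" for j a using that configs_sub[OF y, of j] v by (auto simp: valid_def)
      moreover have "j \<in> P" if "a \<in> H j" for j a using that v by (auto simp: valid_def)
      ultimately show ?thesis by (auto simp: mix_def sim_sampler fun_eq_iff)
    qed
    then show "G (mix P (sim (hat_sampler H' H \<phi>) x) y) = G (sim (hat_sampler H' H \<phi>) x)" by simp
  qed
  finally show ?thesis by (simp add: mean_const[OF mean_configs[OF v]])
qed

lemma random_hats_faithful: "faithful H' H (random_hats H' H)"
  unfolding faithful_def
proof
  fix G
  have "random_hats H' H (\<lambda>s. avg (configs H') (\<lambda>x. G (sim s x)))
     = avg (configs H') (\<lambda>x. avg \<Phi> (\<lambda>\<phi>. G (sim (hat_sampler H' H \<phi>) x)))"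
    unfolding random_hats_def by (rule avg_swap)
  also have "\<dots> = avg (configs H') (\<lambda>x. avg (configs H) G)"
    by (rule mean_cong[OF mean_configs[OF v']]) (rule random_hats_uniform)
  finally show "random_hats H' H (\<lambda>s. avg (configs H') (\<lambda>x. G (sim s x))) = avg (configs H) G"
    by (simp add: mean_const[OF mean_configs[OF v']])
qed

text \<open>
  The simulated hat \<open>a\<close> picked by player \<open>j\<close> depends only on the other players, hence is independent of her
  identification and of her stack. So the real hat that stands for \<open>a\<close> is uniform, and balancing is to blame
  for a loss.
\<close>
lemma random_hats_miss:
  fixes f :: "strategy"
  assumes j: "j \<in> P"
  defines "miss \<equiv> \<lambda>\<phi> x. f j ((sim (hat_sampler H' H \<phi>) x)(j := {})) \<in> sim (hat_sampler H' H \<phi>) x j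
              \<and> \<phi> j (f j ((sim (hat_sampler H' H \<phi>) x)(j := {}))) \<notin> x j"
  shows "avg \<Phi> (\<lambda>\<phi>. avg (configs H') (\<lambda>x. of_bool (miss \<phi> x))) \<le> 1 / (2 * sqrt (card (H' j)))"
proof -
  let ?E = "PiE (H j) (\<lambda>_. H' j)"
  let ?h = "\<lambda>\<phi> x. f j ((sim (hat_sampler H' H \<phi>) x)(j := {}))"
  let ?err = "1 / (2 * sqrt (card (H' j)))"
  have 1: "miss (\<phi>(j := \<psi>)) (x(j := u)) \<longleftrightarrow> ?h \<phi> x \<in> H j \<and> \<psi> (?h \<phi> x) \<in> balance (H' j) u \<and> \<psi> (?h \<phi> x) \<notin> u" for \<phi> \<psi> x u
    by (simp add: miss_def sim_sampler_upd sim_upd' sim_upd)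
  have mE: "mean ?E (avg ?E)" by (rule mean_avg) (rule maps_comp)+
  have mP: "mean (Pow (H' j)) (avg (Pow (H' j)))" using H_fin by (intro mean_avg) auto
  have 2: "avg ?E (\<lambda>\<psi>. avg (Pow (H' j)) (\<lambda>u. of_bool (a \<in> H j \<and> \<psi> a \<in> balance (H' j) u \<and> \<psi> a \<notin> u))) \<le> ?err" for a
  proof (cases "a \<in> H j")
    case True
    have "avg ?E (\<lambda>\<psi>. avg (Pow (H' j)) (\<lambda>u. of_bool (a \<in> H j \<and> \<psi> a \<in> balance (H' j) u \<and> \<psi> a \<notin> u)))
      = avg (H' j) (\<lambda>b. avg (Pow (H' j)) (\<lambda>u. of_bool (b \<in> balance (H' j) u \<and> b \<notin> u)))"
      using avg_PiE_marginal[OF H_fin(1) True H_fin(2) ne[OF j], of "\<lambda>b. avg (Pow (H' j)) (\<lambda>u. of_bool (b \<in> balance (H' j) u \<and> b \<notin> u))"] True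
      by simp
    also have "\<dots> = avg (Pow (H' j)) (\<lambda>u. avg (H' j) (\<lambda>b. of_bool (b \<in> balance (H' j) u \<and> b \<notin> u)))" by (rule avg_swap)
    also have "\<dots> \<le> ?err" by (rule balance_error[OF H_fin(2) ne[OF j] ev[OF j]])
    finally show ?thesis .
  next
    case False
    then show ?thesis by (simp add: mean_const[OF mE] mean_const[OF mP])
  qed
  have "avg \<Phi> (\<lambda>\<phi>. avg (configs H') (\<lambda>x. of_bool (miss \<phi> x)))
     = avg \<Phi> (\<lambda>\<phi>. avg ?E (\<lambda>\<psi>. avg (configs H') (\<lambda>x. of_bool (miss (\<phi>(j := \<psi>)) x))))"
    by (rule avg_maps_upd[symmetric])
  also have "\<dots> = avg \<Phi> (\<lambda>\<phi>. avg ?E (\<lambda>\<psi>. avg (configs H') (\<lambda>x. avg (Pow (H' j)) (\<lambda>u. of_bool (miss (\<phi>(j := \<psi>)) (x(j := u)))))))"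
    by (rule mean_cong[OF mean_maps], rule mean_cong[OF mE]) (rule avg_configs_upd[OF v', symmetric])
  also have "\<dots> = avg \<Phi> (\<lambda>\<phi>. avg (configs H') (\<lambda>x. avg ?E (\<lambda>\<psi>. avg (Pow (H' j)) (\<lambda>u. of_bool (miss (\<phi>(j := \<psi>)) (x(j := u)))))))"
    by (rule mean_cong[OF mean_maps]) (rule avg_swap)
  also have "\<dots> \<le> ?err"
    unfolding 1 by (intro mean_le[OF mean_maps] mean_le[OF mean_configs[OF v']] 2)
  finally show ?thesis .
qed

text \<open>
  The others simulate the stacks that they see and follow the strategy for the simulated game. The value drops
  by at most the probability that some player picks a hat altered by balancing.
\<close>
lemma random_hats_val:
  assumes A: "\<And>x. x \<in> configs H \<Longrightarrow> 0 \<le> A x" "\<And>x. x \<in> configs H \<Longrightarrow> A x \<le> 1"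
  shows "val P H I g A - (\<Sum>j\<in>P. 1 / (2 * sqrt (card (H' j))))
     \<le> random_hats H' H (\<lambda>s. val P H' I (pull s g) (\<lambda>x. A (sim s x)))"
proof -
  obtain f where f: "\<forall>i\<in>I. f i = g i" "val P H I g A = success P H f A" by (rule val_attained[OF v])
  let ?s = "hat_sampler H' H"
  define miss where "miss = (\<lambda>j \<phi> x. f j ((sim (?s \<phi>) x)(j := {})) \<in> sim (?s \<phi>) x j
              \<and> \<phi> j (f j ((sim (?s \<phi>) x)(j := {}))) \<notin> x j)"
  have pt: "of_bool (win P f (sim (?s \<phi>) x)) * A (sim (?s \<phi>) x) - (\<Sum>j\<in>P. of_bool (miss j \<phi> x))
      \<le> of_bool (win P (pull (?s \<phi>) f) x) * A (sim (?s \<phi>) x)" if "x \<in> configs H'" for \<phi> x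
  proof (cases "win P f (sim (?s \<phi>) x) \<and> \<not> win P (pull (?s \<phi>) f) x")
    case True
    then have "win P f (sim (?s \<phi>) x)" "\<not> win P (pull (?s \<phi>) f) x" by auto
    then obtain j where j: "j \<in> P" "miss j \<phi> x"
      unfolding win_pull miss_def by (auto simp: win_def hat_sampler_def)
    have "(1::real) = of_bool (miss j \<phi> x)" using j by simp
    also have "\<dots> \<le> (\<Sum>j\<in>P. of_bool (miss j \<phi> x))" by (rule member_le_sum) (use j finP in auto)
    finally show ?thesis using True A(2)[OF sim_configs[OF sampler_in that], of \<phi>] by simp
  next
    case False
    have "0 \<le> (\<Sum>j\<in>P. of_bool (miss j \<phi> x) :: real)" by (intro sum_nonneg) auto
    then show ?thesis using False A(1)[OF sim_configs[OF sampler_in that], of \<phi>] by (auto simp: of_bool_def)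
  qed
  have mc: "mean (configs H') (avg (configs H'))" by (rule mean_configs[OF v'])
  have "val P H I g A - (\<Sum>j\<in>P. 1 / (2 * sqrt (card (H' j))))
     \<le> avg \<Phi> (\<lambda>\<phi>. avg (configs H') (\<lambda>x. of_bool (win P f (sim (?s \<phi>) x)) * A (sim (?s \<phi>) x)))
        - (\<Sum>j\<in>P. avg \<Phi> (\<lambda>\<phi>. avg (configs H') (\<lambda>x. of_bool (miss j \<phi> x))))"
  proof (rule diff_mono)
    show "val P H I g A \<le> avg \<Phi> (\<lambda>\<phi>. avg (configs H') (\<lambda>x. of_bool (win P f (sim (?s \<phi>) x)) * A (sim (?s \<phi>) x)))"
      using faithfulD[OF random_hats_faithful, of "\<lambda>x. of_bool (win P f x) * A x"] f(2) by (simp add: random_hats_def success_def)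
    show "(\<Sum>j\<in>P. avg \<Phi> (\<lambda>\<phi>. avg (configs H') (\<lambda>x. of_bool (miss j \<phi> x)))) \<le> (\<Sum>j\<in>P. 1 / (2 * sqrt (card (H' j))))"
      by (intro sum_mono) (use random_hats_miss[of _ f] in \<open>simp add: miss_def\<close>)
  qed
  also have "\<dots> = avg \<Phi> (\<lambda>\<phi>. avg (configs H') (\<lambda>x. of_bool (win P f (sim (?s \<phi>) x)) * A (sim (?s \<phi>) x) - (\<Sum>j\<in>P. of_bool (miss j \<phi> x))))"
    by (simp only: mean_diff[OF mc] mean_diff[OF mean_maps] mean_sum[OF mc] mean_sum[OF mean_maps])
  also have "\<dots> \<le> avg \<Phi> (\<lambda>\<phi>. success P H' (pull (?s \<phi>) f) (\<lambda>x. A (sim (?s \<phi>) x)))"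
    unfolding success_def by (intro mean_mono[OF mean_maps] mean_mono[OF mc] pt)
  also have "\<dots> \<le> random_hats H' H (\<lambda>s. val P H' I (pull s g) (\<lambda>x. A (sim s x)))"
    unfolding random_hats_def by (intro mean_mono[OF mean_maps] success_le_val[OF v']) (use f in \<open>simp add: pull_def\<close>)
  finally show ?thesis .
qed

text \<open>
  The largest class of the preimage colouring has measure at most the square root of the probability that two
  random points of the line have the same colour. The two simulated points are uniform with the correlation of
  the two balanced stacks, which is small on average.
\<close>
lemma random_hats_spreads:
  assumes i: "i \<in> P" and \<eta>: "0 \<le> \<eta>"
  shows "spreads H' H (random_hats H' H) i \<eta> (sqrt (\<eta> + 3 / sqrt (card (H' i))))"
  unfolding spreads_def
proof (intro allI impI)
  fix F assume F: "\<forall>x\<in>configs H. \<forall>c. class_size H i F x c \<le> \<eta>"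
  let ?s = "hat_sampler H' H" and ?E = "PiE (H i) (\<lambda>_. H' i)"
  have mE: "mean ?E (avg ?E)" by (rule mean_avg) (rule maps_comp)+
  have mc: "mean (configs H') (avg (configs H'))" by (rule mean_configs[OF v'])
  define same where "same x y \<longleftrightarrow> (\<exists>c. F x = Col c \<and> F y = Col c)" for x y
  define q where "q \<phi> r = avg (Pow (H' i)) (\<lambda>u. avg (Pow (H' i)) (\<lambda>u'. of_bool (same (sim (?s \<phi>) (r(i := u))) (sim (?s \<phi>) (r(i := u'))))))" for \<phi> r
  let ?B = "\<lambda>S u. {a \<in> H i. S a \<in> balance (H' i) u}"
  let ?\<theta> = "\<lambda>u u'. \<bar>avg (H' i) (\<lambda>b. sign_in (balance (H' i) u) b * sign_in (balance (H' i) u') b)\<bar>"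
  have mP: "mean (Pow (H' i)) (avg (Pow (H' i)))" using H_fin by (intro mean_avg) auto
  have mQ: "mean (Pow (H i)) (avg (Pow (H i)))" using H_fin by (intro mean_avg) auto
  have top: "max_class H' i (\<lambda>x. F (sim (?s \<phi>) x)) r \<le> sqrt (q \<phi> r)" for \<phi> r
  proof (rule max_class_le, rule real_le_rsqrt)
    fix c
    let ?o = "\<lambda>u. of_bool (F (sim (?s \<phi>) (r(i := u))) = Col c) :: real"
    have "class_size H' i (\<lambda>x. F (sim (?s \<phi>) x)) r c = avg (Pow (H' i)) ?o"
      unfolding class_size_def by (rule avg_configs_marginal[OF v'])
    then have "(class_size H' i (\<lambda>x. F (sim (?s \<phi>) x)) r c)\<^sup>2 = avg (Pow (H' i)) ?o * avg (Pow (H' i)) ?o"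
      by (simp only: power2_eq_square)
    also have "\<dots> = avg (Pow (H' i)) (\<lambda>u. avg (Pow (H' i)) ?o * ?o u)"
      by (rule mean_cmult[OF mP, symmetric])
    also have "\<dots> = avg (Pow (H' i)) (\<lambda>u. ?o u * avg (Pow (H' i)) ?o)"
      by (simp only: mult.commute)
    also have "\<dots> = avg (Pow (H' i)) (\<lambda>u. avg (Pow (H' i)) (\<lambda>u'. ?o u * ?o u'))"
      by (rule mean_cong[OF mP]) (rule mean_cmult[OF mP, symmetric])
    also have "\<dots> \<le> q \<phi> r" unfolding q_def
      by (intro mean_mono[OF mP]) (auto simp: same_def of_bool_def)
    finally show "(class_size H' i (\<lambda>x. F (sim (?s \<phi>) x)) r c)\<^sup>2 \<le> q \<phi> r" .
  qed
  have pair: "avg ?E (\<lambda>\<psi>. of_bool (same (w(i := ?B \<psi> u)) (w(i := ?B \<psi> u')))) \<le> \<eta> + ?\<theta> u u'"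
    if w: "w \<in> configs H" and u: "u \<subseteq> H' i" "u' \<subseteq> H' i" for w u u'
  proof -
    define C where "C = {c. \<exists>S\<in>Pow (H i). F (w(i := S)) = Col c}"
    let ?f = "\<lambda>c S. of_bool (F (w(i := S)) = Col c) :: real"
    have "finite (F ` (\<lambda>S. w(i := S)) ` Pow (H i))" using H_fin by simp
    then have "finite (Col -` (F ` (\<lambda>S. w(i := S)) ` Pow (H i)))" by (intro finite_vimageI) (auto simp: inj_on_def)
    moreover have "C \<subseteq> Col -` (F ` (\<lambda>S. w(i := S)) ` Pow (H i))"
    proof
      fix c assume "c \<in> C"
      then obtain S where "S \<in> Pow (H i)" "F (w(i := S)) = Col c" by (auto simp: C_def)
      then have "Col c \<in> F ` (\<lambda>S. w(i := S)) ` Pow (H i)" by (metis imageI)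
      then show "c \<in> Col -` (F ` (\<lambda>S. w(i := S)) ` Pow (H i))" by simp
    qed
    ultimately have fC: "finite C" using finite_subset by blast
    have "of_bool (same (w(i := S)) (w(i := S'))) \<le> (\<Sum>c\<in>C. ?f c S * ?f c S')" if S: "S \<in> Pow (H i)" for S S'
    proof (cases "same (w(i := S)) (w(i := S'))")
      case True
      then obtain c where c: "F (w(i := S)) = Col c" "F (w(i := S')) = Col c" by (auto simp: same_def)
      then have "c \<in> C" using S by (auto simp: C_def)
      then have "?f c S * ?f c S' \<le> (\<Sum>c\<in>C. ?f c S * ?f c S')" by (intro member_le_sum) (use fC in auto)
      then show ?thesis using c True by simp
    qed (auto intro!: sum_nonneg)
    then have "avg ?E (\<lambda>\<psi>. of_bool (same (w(i := ?B \<psi> u)) (w(i := ?B \<psi> u')))) \<le> avg ?E (\<lambda>\<psi>. \<Sum>c\<in>C. ?f c (?B \<psi> u) * ?f c (?B \<psi> u'))"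
      by (intro mean_mono[OF mE]) auto
    also have "\<dots> = (\<Sum>c\<in>C. avg ?E (\<lambda>\<psi>. ?f c (?B \<psi> u) * ?f c (?B \<psi> u')))" by (rule mean_sum[OF mE])
    also have "\<dots> \<le> (\<Sum>c\<in>C. (\<eta> + ?\<theta> u u') * avg (Pow (H i)) (?f c))"
    proof (rule sum_mono)
      fix c
      let ?a = "avg (Pow (H i)) (?f c)"
      have "avg (Pow (H i)) (?f c) = class_size H i F w c" unfolding class_size_def by (rule avg_configs_marginal[OF v, symmetric])
      then have a: "0 \<le> ?a" "?a \<le> \<eta>" using F w class_size_bounds[OF v] by auto
      have sq: "avg (Pow (H i)) (\<lambda>S. (?f c S)\<^sup>2) = ?a"
        by (rule mean_cong[OF mQ]) simp
      have "avg ?E (\<lambda>\<psi>. ?f c (?B \<psi> u) * ?f c (?B \<psi> u')) \<le> ?a\<^sup>2 + ?\<theta> u u' * (avg (Pow (H i)) (\<lambda>S. (?f c S)\<^sup>2) - ?a\<^sup>2)"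
        by (rule pullback_correlation[OF H_fin(2) ne[OF i] balance_ok[OF i u(1)] balance_ok[OF i u(2)] H_fin(1)])
      also have "\<dots> \<le> \<eta> * ?a + ?\<theta> u u' * ?a"
        unfolding sq by (intro add_mono mult_left_mono) (use a in \<open>auto simp: power2_eq_square intro: mult_right_mono\<close>)
      finally show "avg ?E (\<lambda>\<psi>. ?f c (?B \<psi> u) * ?f c (?B \<psi> u')) \<le> (\<eta> + ?\<theta> u u') * ?a" by (simp add: algebra_simps)
    qed
    also have "\<dots> = (\<eta> + ?\<theta> u u') * avg (Pow (H i)) (\<lambda>S. \<Sum>c\<in>C. ?f c S)"
      by (simp only: sum_distrib_left mean_sum[OF mQ])
    also have "\<dots> \<le> (\<eta> + ?\<theta> u u') * 1"
    proof (rule mult_left_mono)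
      have "(\<Sum>c\<in>C. ?f c S) \<le> 1" for S by (rule sum_colour_le_1[OF fC])
      then show "avg (Pow (H i)) (\<lambda>S. \<Sum>c\<in>C. ?f c S) \<le> 1" by (intro mean_le[OF mQ])
    qed (use \<eta> in simp)
    finally show ?thesis by simp
  qed
  have avgq: "avg \<Phi> (\<lambda>\<phi>. q \<phi> r) \<le> \<eta> + 3 / sqrt (card (H' i))" if r: "r \<in> configs H'" for r
  proof -
    have "avg \<Phi> (\<lambda>\<phi>. q \<phi> r) = avg (Pow (H' i)) (\<lambda>u. avg (Pow (H' i)) (\<lambda>u'. avg \<Phi> (\<lambda>\<phi>. of_bool (same (sim (?s \<phi>) (r(i := u))) (sim (?s \<phi>) (r(i := u')))))))"
      unfolding q_def by (subst avg_swap) (rule mean_cong[OF mP], rule avg_swap)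
    also have "\<dots> \<le> avg (Pow (H' i)) (\<lambda>u. avg (Pow (H' i)) (\<lambda>u'. \<eta> + ?\<theta> u u'))"
    proof (intro mean_mono[OF mP])
      fix u u' assume u: "u \<in> Pow (H' i)" "u' \<in> Pow (H' i)"
      have "avg \<Phi> (\<lambda>\<phi>. of_bool (same (sim (?s \<phi>) (r(i := u))) (sim (?s \<phi>) (r(i := u')))))
         = avg \<Phi> (\<lambda>\<phi>. avg ?E (\<lambda>\<psi>. of_bool (same ((sim (?s \<phi>) r)(i := ?B \<psi> u)) ((sim (?s \<phi>) r)(i := ?B \<psi> u')))))"
        by (subst avg_maps_upd[symmetric, of _ i]) (simp add: sim_sampler_upd sim_upd)
      also have "\<dots> \<le> \<eta> + ?\<theta> u u'"
        using u by (intro mean_le[OF mean_maps] pair sim_configs[OF sampler_in r]) auto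
      finally show "avg \<Phi> (\<lambda>\<phi>. of_bool (same (sim (?s \<phi>) (r(i := u))) (sim (?s \<phi>) (r(i := u'))))) \<le> \<eta> + ?\<theta> u u'" .
    qed
    also have "\<dots> = \<eta> + avg (Pow (H' i)) (\<lambda>u. avg (Pow (H' i)) (\<lambda>u'. ?\<theta> u u'))"
      by (simp only: mean_add[OF mP] mean_const[OF mP])
    also have "\<dots> \<le> \<eta> + 3 / sqrt (card (H' i))"
      using balance_correlation[OF H_fin(2) ne[OF i] ev[OF i]] by simp
    finally show ?thesis .
  qed
  have qnn: "0 \<le> q \<phi> r" for \<phi> r unfolding q_def by (intro mean_ge[OF mP]) auto
  have "random_hats H' H (\<lambda>s. avg (configs H') (max_class H' i (\<lambda>x. F (sim s x))))
     \<le> avg \<Phi> (\<lambda>\<phi>. avg (configs H') (\<lambda>r. sqrt (q \<phi> r)))"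
    unfolding random_hats_def by (intro mean_mono[OF mean_maps] mean_mono[OF mc] top)
  also have "\<dots> = avg (configs H') (\<lambda>r. avg \<Phi> (\<lambda>\<phi>. sqrt (q \<phi> r)))" by (rule avg_swap)
  also have "\<dots> \<le> avg (configs H') (\<lambda>r. sqrt (\<eta> + 3 / sqrt (card (H' i))))"
  proof (rule mean_mono[OF mc])
    fix r assume "r \<in> configs H'"
    have "avg \<Phi> (\<lambda>\<phi>. sqrt (q \<phi> r)) \<le> sqrt (avg \<Phi> (\<lambda>\<phi>. q \<phi> r))" by (rule mean_sqrt[OF mean_maps]) (rule qnn)
    also have "\<dots> \<le> sqrt (\<eta> + 3 / sqrt (card (H' i)))" using avgq[OF \<open>r \<in> configs H'\<close>] by simp
    finally show "avg \<Phi> (\<lambda>\<phi>. sqrt (q \<phi> r)) \<le> sqrt (\<eta> + 3 / sqrt (card (H' i)))" .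
  qed
  finally show "random_hats H' H (\<lambda>s. avg (configs H') (max_class H' i (\<lambda>x. F (sim s x)))) \<le> sqrt (\<eta> + 3 / sqrt (card (H' i)))"
    by (simp add: mean_const[OF mc])
qed

end

end

section \<open>Concentration, and conditioning on the colours\<close>

lemma cosh_le_exp_square: "(exp x + exp (- x)) / 2 \<le> exp (x\<^sup>2 / 2 :: real)"
proof -
  have pos: "(exp x + exp (- x)) / 2 \<le> exp (x\<^sup>2 / 2)" if x: "x \<ge> 0" for x :: real
  proof -
    have h: "- (2 * x) * (1/2) + ln (1 + (1/2) * (exp (2 * x) - 1)) \<le> (2 * x)\<^sup>2 / 8"
      using Hoeffdings_lemma_aux[of "2 * x" "1/2"] x by simp
    have e: "1 + (1/2) * (exp (2 * x) - 1) = (1 + exp (2 * x)) / 2" by (simp add: field_simps)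
    have "ln ((1 + exp (2 * x)) / 2) \<le> x + x\<^sup>2 / 2"
      using h unfolding e by (simp add: power2_eq_square)
    moreover have "0 < (1 + exp (2 * x)) / 2" by (simp add: add_pos_pos)
    ultimately have "(1 + exp (2 * x)) / 2 \<le> exp (x + x\<^sup>2 / 2)" by (metis exp_le_cancel_iff exp_ln)
    then have "exp (- x) * ((1 + exp (2 * x)) / 2) \<le> exp (- x) * exp (x + x\<^sup>2 / 2)" by simp
    also have "exp (- x) * exp (x + x\<^sup>2 / 2) = exp (x\<^sup>2 / 2)" by (simp flip: exp_add)
    also have "exp (- x) * ((1 + exp (2 * x)) / 2) = (exp x + exp (- x)) / 2"
      by (simp add: distrib_left flip: exp_add)
    finally show ?thesis .
  qed
  show ?thesis using pos[of x] pos[of "- x"] by (cases "x \<ge> 0") (auto simp: add.commute)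
qed

lemma mean_Pow: "finite N \<Longrightarrow> mean (Pow N) (avg (Pow N))"
  by (rule mean_avg) auto

text \<open>
  The bounded differences inequality in exponential form; one fair bit at a time contributes
  \<open>cosh (l w / 2)\<close>.
\<close>
lemma exp_moment:
  assumes "finite N" "\<And>c y. c \<in> N \<Longrightarrow> y \<subseteq> N \<Longrightarrow> \<bar>f (insert c y) - f (y - {c})\<bar> \<le> w c"
  shows "avg (Pow N) (\<lambda>y. exp (l * f y)) \<le> exp (l * avg (Pow N) f + l\<^sup>2 * (\<Sum>c\<in>N. (w c)\<^sup>2) / 8)"
  using assms
proof (induction N arbitrary: f)
  case empty then show ?case by (simp add: avg_def)
next
  case (insert a N)
  note m = mean_Pow[OF insert.hyps(1)]
  define g where "g S = (f (insert a S) + f S) / 2" for S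
  have lip: "\<bar>g (insert c y) - g (y - {c})\<bar> \<le> w c" if c: "c \<in> N" "y \<subseteq> N" for c y
  proof -
    have "c \<noteq> a" "a \<notin> y" using c insert.hyps by auto
    then have "insert a (y - {c}) = insert a y - {c}" by auto
    then have "g (insert c y) - g (y - {c}) = ((f (insert c (insert a y)) - f (insert a y - {c})) + (f (insert c y) - f (y - {c}))) / 2"
      by (simp add: g_def insert_commute field_simps)
    moreover have "\<bar>f (insert c (insert a y)) - f (insert a y - {c})\<bar> \<le> w c" "\<bar>f (insert c y) - f (y - {c})\<bar> \<le> w c"
      using c by (auto intro!: insert.prems)
    ultimately show ?thesis by (simp add: abs_le_iff field_simps)
  qed
  have pt: "(exp (l * f S) + exp (l * f (insert a S))) / 2 \<le> exp (l\<^sup>2 * (w a)\<^sup>2 / 8) * exp (l * g S)" if "S \<in> Pow N" for S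
  proof -
    define x where "x = l * (f (insert a S) - f S) / 2"
    have "a \<notin> S" using that insert.hyps by auto
    then have "\<bar>f (insert a S) - f S\<bar> \<le> w a" using insert.prems[of a S] that by auto
    then have "(f (insert a S) - f S)\<^sup>2 \<le> (w a)\<^sup>2" by (simp add: abs_le_square_iff[symmetric])
    then have "x\<^sup>2 / 2 \<le> l\<^sup>2 * (w a)\<^sup>2 / 8"
      by (simp add: x_def power_mult_distrib power_divide mult_left_mono)
    then have "(exp x + exp (- x)) / 2 \<le> exp (l\<^sup>2 * (w a)\<^sup>2 / 8)"
      using cosh_le_exp_square[of x] by (meson exp_le_cancel_iff order_trans)
    then have le: "exp (l * g S) * ((exp x + exp (- x)) / 2) \<le> exp (l * g S) * exp (l\<^sup>2 * (w a)\<^sup>2 / 8)" by simp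
    have "l * f (insert a S) = l * g S + x" "l * f S = l * g S + - x"
      by (simp_all add: g_def x_def field_simps)
    then have "(exp (l * f S) + exp (l * f (insert a S))) / 2 = exp (l * g S) * ((exp x + exp (- x)) / 2)"
      by (simp only: exp_add) (simp add: field_simps)
    with le show ?thesis by (simp only: mult.commute[of "exp (l * g S)"])
  qed
  have "avg (Pow (insert a N)) (\<lambda>y. exp (l * f y)) = avg (Pow N) (\<lambda>S. (exp (l * f S) + exp (l * f (insert a S))) / 2)"
    unfolding avg_Pow_insert[OF insert.hyps(1,2)] by (simp only: mean_divide[OF m] mean_add[OF m])
  also have "\<dots> \<le> avg (Pow N) (\<lambda>S. exp (l\<^sup>2 * (w a)\<^sup>2 / 8) * exp (l * g S))"
    by (rule mean_mono[OF m pt])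
  also have "\<dots> = exp (l\<^sup>2 * (w a)\<^sup>2 / 8) * avg (Pow N) (\<lambda>S. exp (l * g S))" by (rule mean_cmult[OF m])
  also have "\<dots> \<le> exp (l\<^sup>2 * (w a)\<^sup>2 / 8) * exp (l * avg (Pow N) g + l\<^sup>2 * (\<Sum>c\<in>N. (w c)\<^sup>2) / 8)"
    by (intro mult_left_mono insert.IH lip) auto
  also have "\<dots> = exp (l * avg (Pow N) g + l\<^sup>2 * (\<Sum>c\<in>insert a N. (w c)\<^sup>2) / 8)"
    using insert.hyps by (simp add: distrib_left add_divide_distrib flip: exp_add)
  also have "avg (Pow N) g = avg (Pow (insert a N)) f"
    unfolding g_def avg_square_Pow_insert(2)[OF insert.hyps(1,2)] ..
  finally show ?case .
qed

text \<open>
  The maximal inequality behind the blinding step: a choice \<open>k y\<close> made after seeing \<open>y\<close> is better on average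
  than the best fixed choice only by \<open>ln (card K) / l + l \<Sum>w\<^sup>2 / 8\<close>.
\<close>
lemma avg_select_le:
  assumes N: "finite N" and K: "finite K" and l: "l > 0"
    and k: "\<And>y. y \<subseteq> N \<Longrightarrow> k y \<in> K"
    and lip: "\<And>k c y. k \<in> K \<Longrightarrow> c \<in> N \<Longrightarrow> y \<subseteq> N \<Longrightarrow> \<bar>f k (insert c y) - f k (y - {c})\<bar> \<le> w c"
    and B: "\<And>k. k \<in> K \<Longrightarrow> avg (Pow N) (f k) \<le> B"
  shows "avg (Pow N) (\<lambda>y. f (k y) y) \<le> B + ln (card K) / l + l * (\<Sum>c\<in>N. (w c)\<^sup>2) / 8"
proof -
  note m = mean_Pow[OF N]
  let ?W = "\<Sum>c\<in>N. (w c)\<^sup>2" and ?F = "\<lambda>y. f (k y) y"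
  have "K \<noteq> {}" using k[of "{}"] by auto
  then have cK: "real (card K) > 0" using K by (simp add: card_gt_0_iff)
  let ?mu = "avg (Pow N) (\<lambda>y. l * ?F y)"
  have "exp ?mu = avg (Pow N) (\<lambda>y. exp ?mu + (exp ?mu * (l * ?F y) - exp ?mu * ?mu))"
    by (simp only: mean_add[OF m] mean_diff[OF m] mean_const[OF m] mean_cmult[OF m] diff_self add_0_right)
  also have "\<dots> \<le> avg (Pow N) (\<lambda>y. exp (l * ?F y))"
  proof (rule mean_mono[OF m])
    fix y
    have "exp ?mu * (1 + (l * ?F y - ?mu)) \<le> exp ?mu * exp (l * ?F y - ?mu)" by simp
    then show "exp ?mu + (exp ?mu * (l * ?F y) - exp ?mu * ?mu) \<le> exp (l * ?F y)"
      by (simp add: algebra_simps flip: exp_add)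
  qed
  also have "\<dots> \<le> avg (Pow N) (\<lambda>y. \<Sum>k\<in>K. exp (l * f k y))"
  proof (rule mean_mono[OF m])
    fix y assume "y \<in> Pow N"
    then show "exp (l * ?F y) \<le> (\<Sum>k\<in>K. exp (l * f k y))"
      by (intro member_le_sum[of "k y" K "\<lambda>k. exp (l * f k y)"]) (use k K in auto)
  qed
  also have "\<dots> = (\<Sum>k\<in>K. avg (Pow N) (\<lambda>y. exp (l * f k y)))" by (rule mean_sum[OF m])
  also have "\<dots> \<le> (\<Sum>k\<in>K. exp (l * B + l\<^sup>2 * ?W / 8))"
  proof (rule sum_mono)
    fix k assume k: "k \<in> K"
    have "avg (Pow N) (\<lambda>y. exp (l * f k y)) \<le> exp (l * avg (Pow N) (f k) + l\<^sup>2 * ?W / 8)"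
      by (rule exp_moment[OF N]) (rule lip[OF k])
    also have "\<dots> \<le> exp (l * B + l\<^sup>2 * ?W / 8)" using B[OF k] l by simp
    finally show "avg (Pow N) (\<lambda>y. exp (l * f k y)) \<le> exp (l * B + l\<^sup>2 * ?W / 8)" .
  qed
  also have "\<dots> = exp (ln (card K) + (l * B + l\<^sup>2 * ?W / 8))" using cK by (simp add: exp_add)
  finally have "?mu \<le> ln (card K) + (l * B + l\<^sup>2 * ?W / 8)" by simp
  then have "l * avg (Pow N) ?F \<le> l * (B + ln (card K) / l + l * ?W / 8)"
    using l by (simp add: mean_cmult[OF m] algebra_simps power2_eq_square)
  then show ?thesis using l by simp
qed

lemma avg_Pow_mix:
  assumes "finite N"
  shows "avg (Pow N) (\<lambda>e. avg (Pow N) (\<lambda>y. g ((e \<inter> A) \<union> (y - A)))) = avg (Pow N) g"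
proof -
  have "bij_betw (\<lambda>(e,y). ((e \<inter> A) \<union> (y - A), (y \<inter> A) \<union> (e - A))) (Pow N \<times> Pow N) (Pow N \<times> Pow N)"
    by (rule bij_betw_byWitness[where f' = "\<lambda>(e,y). ((e \<inter> A) \<union> (y - A), (y \<inter> A) \<union> (e - A))"]) auto
  from avg_bij[OF this, of "\<lambda>(e,y). g e"]
  have "avg (Pow N) (\<lambda>e. avg (Pow N) (\<lambda>y. g ((e \<inter> A) \<union> (y - A)))) = avg (Pow N) (\<lambda>e. avg (Pow N) (\<lambda>y. g e))"
    unfolding avg_prod by (simp add: case_prod_beta')
  also have "\<dots> = avg (Pow N) g" by (simp only: mean_const[OF mean_Pow[OF assms]])
  finally show ?thesis .
qed

text \<open>
  Switching the colours in \<open>b\<close> off amounts to conditioning on an event of probability at least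
  \<open>1 / 2 ^ card b\<close>.
\<close>
lemma avg_switch_off:
  assumes N: "finite N" and b: "finite b" and h: "\<And>y. y \<subseteq> N \<Longrightarrow> 0 \<le> h y"
  shows "avg (Pow N) (\<lambda>y. h (y - b)) \<le> 2 ^ card b * avg (Pow N) h"
  using b h
proof (induction b arbitrary: h)
  case empty then show ?case by simp
next
  case (insert c b)
  note m = mean_Pow[OF N]
  have one: "avg (Pow N) (\<lambda>y. h (y - {c})) \<le> 2 * avg (Pow N) h"
  proof (cases "c \<in> N")
    case True
    define N' where "N' = N - {c}"
    have N': "N = insert c N'" "c \<notin> N'" "finite N'" using True N by (auto simp: N'_def)
    have e: "avg (Pow N') (\<lambda>y. h (y - {c})) = avg (Pow N') h"
    proof (rule mean_cong[OF mean_Pow[OF N'(3)]])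
      fix y assume "y \<in> Pow N'"
      then have "y - {c} = y" using N' by auto
      then show "h (y - {c}) = h y" by simp
    qed
    have "0 \<le> avg (Pow N') (\<lambda>y. h (insert c y))"
      by (rule mean_ge[OF mean_Pow[OF N'(3)]], rule insert.prems) (use N' in auto)
    moreover have "avg (Pow N') (\<lambda>y. h (insert c y - {c})) = avg (Pow N') (\<lambda>y. h (y - {c}))" by simp
    ultimately show ?thesis unfolding N'(1) avg_Pow_insert[OF N'(3,2)] e by (simp add: e)
  next
    case False
    have "avg (Pow N) (\<lambda>y. h (y - {c})) = avg (Pow N) h" 
    proof (rule mean_cong[OF m])
      fix y assume "y \<in> Pow N"
      then have "y - {c} = y" using False by auto
      then show "h (y - {c}) = h y" by simp
    qed
    moreover have "0 \<le> avg (Pow N) h" by (rule mean_ge[OF m]) (use insert.prems in auto)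
    ultimately show ?thesis by simp
  qed
  have "y - insert c b = (y - b) - {c}" for y by auto
  then have "avg (Pow N) (\<lambda>y. h (y - insert c b)) = avg (Pow N) (\<lambda>y. h ((y - b) - {c}))" by simp
  also have "\<dots> \<le> 2 ^ card b * avg (Pow N) (\<lambda>y. h (y - {c}))"
    by (rule insert.IH, rule insert.prems) auto
  also have "\<dots> \<le> 2 ^ card b * (2 * avg (Pow N) h)" using one by simp
  finally show ?case using insert.hyps by simp
qed

lemma big_colours:
  assumes M: "mean S M" and a: "a > 0"
  shows "finite {c. M (\<lambda>x. of_bool (F x = Col c)) > a} \<and> real (card {c. M (\<lambda>x. of_bool (F x = Col c)) > a}) \<le> 1 / a"
proof -
  let ?B = "{c. M (\<lambda>x. of_bool (F x = Col c)) > a}"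
  have fin: "real (card G) \<le> 1 / a" if G: "G \<subseteq> ?B" "finite G" for G
  proof -
    have s: "(\<Sum>c\<in>G. of_bool (F x = Col c)) \<le> (1::real)" for x by (rule sum_colour_le_1[OF G(2)])
    have "real (card G) * a = (\<Sum>c\<in>G. a)" by simp
    also have "\<dots> \<le> (\<Sum>c\<in>G. M (\<lambda>x. of_bool (F x = Col c)))" using G by (intro sum_mono) auto
    also have "\<dots> = M (\<lambda>x. \<Sum>c\<in>G. of_bool (F x = Col c))" by (rule mean_sum[OF M, symmetric])
    also have "\<dots> \<le> 1" by (rule mean_le[OF M]) (rule s)
    finally show ?thesis using a by (simp add: field_simps)
  qed
  have "finite ?B \<and> card ?B \<le> nat \<lfloor>1 / a\<rfloor>"
    by (rule finite_if_finite_subsets_card_bdd) (use fin in \<open>auto simp: le_nat_floor\<close>)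
  then show ?thesis using fin[of ?B] by auto
qed

context hat_game begin

text \<open>
  The players in \<open>I\<close> are blind: they play \<open>g\<close>, whatever the set \<open>y\<close> of colours that are on, while the others
  adapt their strategies to \<open>y\<close>.
\<close>
definition blind_val where
  "blind_val H I g N F = avg (Pow N) (\<lambda>y. val P H I g (live F y))"

definition drop_small :: "config \<Rightarrow> real \<Rightarrow> nat \<Rightarrow> colouring \<Rightarrow> colouring" where
  "drop_small H \<eta> i F x = (case F x of Col c \<Rightarrow> if class_size H i F x c > \<eta> then Col c else Del | l \<Rightarrow> l)"

fun drop_smalls where
  "drop_smalls H \<eta> [] F = F"
| "drop_smalls H \<eta> (i # is) F = drop_smalls H \<eta> is (drop_small H \<eta> i F)"

lemma drop_smalls_Free: "drop_smalls H \<eta> is F x = Free \<longleftrightarrow> F x = Free"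
  by (induction "is" arbitrary: F) (auto simp: drop_small_def split: label.split)

text \<open>
  If \<open>x\<close> keeps the colour \<open>c\<close> to the end, then at the last step more than a fraction \<open>\<eta>\<close> of the line through \<open>x\<close>
  had this colour; each of these points had passed the step before, and so on. Hence the class
  fills at least a fraction \<open>\<eta> ^ length is\<close> of the subspace through \<open>x\<close> in the directions \<open>is\<close>.
\<close>
lemma drop_smalls_none:
  assumes v: "valid P H" and "distinct is" "\<eta> > 0"
    and "\<And>x c. x \<in> configs H \<Longrightarrow> avg (configs H) (\<lambda>z. of_bool (F (mix (- set is) x z) = Col c)) < \<eta> ^ length is"
    and "x \<in> configs H"
  shows "drop_smalls H \<eta> is F x \<noteq> Col c"
  using assms(2,4,5)
proof (induction "is" arbitrary: F)
  case Nil
  have "mix UNIV x z = x" for z by (auto simp: mix_def)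
  then show ?case using Nil(2)[OF Nil(3), of c] by (auto simp: mean_const[OF mean_configs[OF v]])
next
  case (Cons i "is")
  let ?F1 = "drop_small H \<eta> i F" and ?S = "- set is"
  note m = mean_configs[OF v]
  have "avg (configs H) (\<lambda>z. of_bool (?F1 (mix ?S x z) = Col c)) < \<eta> ^ length is" if x: "x \<in> configs H" for x c
  proof -
    have i: "i \<notin> set is" using Cons by simp
    have e: "(mix ?S x z)(i := u i) = mix (- set (i # is)) x (z(i := u i))" for z u
      using i by (auto simp: mix_def fun_eq_iff)
    have "\<eta> * avg (configs H) (\<lambda>z. of_bool (?F1 (mix ?S x z) = Col c))
       = avg (configs H) (\<lambda>z. \<eta> * of_bool (?F1 (mix ?S x z) = Col c))" by (rule mean_cmult[OF m, symmetric])
    also have "\<dots> \<le> avg (configs H) (\<lambda>z. class_size H i F (mix ?S x z) c)"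
    proof (rule mean_mono[OF m])
      fix z
      show "\<eta> * of_bool (?F1 (mix ?S x z) = Col c) \<le> class_size H i F (mix ?S x z) c"
        using class_size_bounds(1)[OF v, of i F "mix ?S x z" c]
        by (auto simp: drop_small_def split: label.splits if_splits)
    qed
    also have "\<dots> = avg (configs H) (\<lambda>z. avg (configs H) (\<lambda>u. of_bool (F (mix (- set (i # is)) x (z(i := u i))) = Col c)))"
      unfolding class_size_def e ..
    also have "\<dots> = avg (configs H) (\<lambda>z. of_bool (F (mix (- set (i # is)) x z) = Col c))"
      by (rule configs_resample1[OF v])
    also have "\<dots> < \<eta> * \<eta> ^ length is" using Cons.prems(2)[OF x, of c] by simp
    finally show ?thesis using \<open>\<eta> > 0\<close> by simp
  qed
  then show ?case using Cons.IH[of ?F1] Cons.prems by simp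
qed

definition drop_big :: "config \<Rightarrow> nat set \<Rightarrow> real \<Rightarrow> colouring \<Rightarrow> colouring" where
  "drop_big H I a F x = (case F x of Col c \<Rightarrow> if avg (configs H) (\<lambda>z. of_bool (F (mix I x z) = Col c)) > a then Del else Col c | l \<Rightarrow> l)"

lemma mix_mix: "mix I (mix I x z) w = mix I x w"
  by (auto simp: mix_def)

lemma mix_erase: "j \<notin> I \<Longrightarrow> mix I (x(j := u)) w = mix I x w"
  by (auto simp: mix_def)

lemma drop_big_small:
  assumes v: "valid P H" and a: "a \<ge> 0" and x: "x \<in> configs H"
  shows "avg (configs H) (\<lambda>z. of_bool (drop_big H I a F (mix I x z) = Col c)) \<le> a"
proof (cases "avg (configs H) (\<lambda>z. of_bool (F (mix I x z) = Col c)) > a")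
  case True
  then have "drop_big H I a F (mix I x z) \<noteq> Col c" for z
    by (auto simp: drop_big_def mix_mix split: label.split)
  then show ?thesis using a by (simp add: mean_const[OF mean_configs[OF v]])
next
  case False
  have "avg (configs H) (\<lambda>z. of_bool (drop_big H I a F (mix I x z) = Col c)) \<le> avg (configs H) (\<lambda>z. of_bool (F (mix I x z) = Col c))"
    by (rule mean_mono[OF mean_configs[OF v]]) (auto simp: drop_big_def split: label.splits if_splits)
  then show ?thesis using False by simp
qed

lemma drop_big_Free: "drop_big H I a F x = Free \<longleftrightarrow> F x = Free"
  by (auto simp: drop_big_def split: label.split)

text \<open>
  The bound \<open>p\<close> holds not only for each set \<open>y\<close> of colours but for every choice of \<open>y\<close> as a function of
  the stacks of the blind players: the others see these stacks, and the blind ones do not look at \<open>y\<close>. So one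
  may condition separately, for each value of these stacks, on the colours that are big there being off. This
  loses a factor \<open>2 powr (1 / a)\<close> in the distance from \<open>p\<close>, and nothing else: an additive error in the bound
  \<open>p\<close> could not be afforded, because it would be multiplied by the same factor.
\<close>
lemma blind_val_drop_big:
  assumes v: "valid P H" and N: "finite N" and a: "a > 0" and B: "blind_val H I g N F \<ge> p - \<gamma>"
  shows "blind_val H I g N (drop_big H I a F) \<ge> p - 2 powr (1 / a) * \<gamma>"
proof -
  note m = mean_configs[OF v] and mN = mean_Pow[OF N]
  have "\<forall>y. \<exists>f. (\<forall>i\<in>I. f i = g i) \<and> val P H I g (live F y) = success P H f (live F y)"
  proof
    fix y
    obtain f where "\<forall>i\<in>I. f i = g i" "val P H I g (live F y) = success P H f (live F y)" by (rule val_attained[OF v])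
    then show "\<exists>f. (\<forall>i\<in>I. f i = g i) \<and> val P H I g (live F y) = success P H f (live F y)" by blast
  qed
  from choice[OF this] obtain f
    where f': "\<forall>y. (\<forall>i\<in>I. f y i = g i) \<and> val P H I g (live F y) = success P H (f y) (live F y)" ..
  then have f: "\<And>y i. i \<in> I \<Longrightarrow> f y i = g i" "\<And>y. val P H I g (live F y) = success P H (f y) (live F y)" by auto
  define W where "W y x = of_bool (win P (f y) x) * live F y x" for y x
  define Z where "Z x y = avg (configs H) (\<lambda>z. W y (mix I x z))" for x y
  define big where "big x = {c. avg (configs H) (\<lambda>z. of_bool (F (mix I x z) = Col c)) > a}" for x
  have big: "finite (big x)" "real (card (big x)) \<le> 1 / a" for x
    using big_colours[OF m a, of "\<lambda>z. F (mix I x z)"] by (auto simp: big_def)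
  have Zmix: "Z (mix I x z) = Z x" for x z by (rule ext) (simp only: Z_def mix_mix)
  have Zer: "Z (x(j := u)) = Z x" if "j \<notin> I" for x j u by (rule ext) (simp only: Z_def mix_erase[OF that])
  have biger: "big (x(j := u)) = big x" if "j \<notin> I" for x j u using that by (simp add: big_def mix_erase)
  have bigmix: "big (mix I x z) = big x" for x z by (simp add: big_def mix_mix)
  (* The best set of colours is chosen as a function of the profile Z x, which depends on the stacks
     in I only; this makes the choice available to every player outside I. *)
  define best where "best q = (SOME y. y \<in> Pow N \<and> (\<forall>y'\<in>Pow N. q y' \<le> q y))" for q :: "nat set \<Rightarrow> real"
  have best: "best q \<in> Pow N" "\<And>y. y \<in> Pow N \<Longrightarrow> q y \<le> q (best q)" for q
  proof -
    have "Max (q ` Pow N) \<in> q ` Pow N" by (rule Max_in) (use N in auto)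
    then obtain y where y: "y \<in> Pow N" "q y = Max (q ` Pow N)" by force
    then have "\<forall>y'\<in>Pow N. q y' \<le> q y" using N by (auto intro!: Max_ge)
    with y have "\<exists>y. y \<in> Pow N \<and> (\<forall>y'\<in>Pow N. q y' \<le> q y)" by blast
    from someI_ex[OF this] show "best q \<in> Pow N" "\<And>y. y \<in> Pow N \<Longrightarrow> q y \<le> q (best q)" by (auto simp: best_def)
  qed
  define vx where "vx x = Z x (best (Z x))" for x
  (* Letting the best set of colours depend on the stacks in I still gives a legal strategy. *)
  have vbar: "avg (configs H) vx \<le> p"
  proof -
    define f' where "f' j zz = (if j \<in> I then g j zz else f (best (Z zz)) j zz)" for j zz
    have w: "win P f' x \<longleftrightarrow> win P (f (best (Z x))) x" for x
    proof -
      have "f' j (x(j := {})) = f (best (Z x)) j (x(j := {}))" for j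
        by (cases "j \<in> I") (simp_all only: f'_def Zer f(1) if_True if_False simp_thms)
      then show ?thesis by (simp only: win_def)
    qed
    have "avg (configs H) vx = avg (configs H) (\<lambda>x. avg (configs H) (\<lambda>z. W (best (Z (mix I x z))) (mix I x z)))"
      by (rule mean_cong[OF m]) (simp only: vx_def Zmix, rule Z_def)
    also have "\<dots> = avg (configs H) (\<lambda>x. W (best (Z x)) x)" by (rule configs_resample[OF v])
    also have "\<dots> = success P H f' (\<lambda>x. live F (best (Z x)) x)" by (simp add: success_def W_def w)
    also have "\<dots> \<le> p" by (rule success_le_p[OF v]) (rule live_bounds)
    finally show ?thesis .
  qed
  have Zbar: "avg (configs H) (\<lambda>x. avg (Pow N) (Z x)) = blind_val H I g N F"
  proof -
    have "avg (configs H) (\<lambda>x. avg (Pow N) (Z x)) = avg (Pow N) (\<lambda>y. avg (configs H) (\<lambda>x. Z x y))" by (rule avg_swap)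
    also have "\<dots> = avg (Pow N) (\<lambda>y. avg (configs H) (W y))" unfolding Z_def by (simp only: configs_resample[OF v])
    finally show ?thesis by (simp add: blind_val_def f(2) success_def W_def[abs_def])
  qed
  let ?L = "2 powr (1 / a)"
  have pt: "vx x - avg (Pow N) (\<lambda>y. Z x (y - big x)) \<le> ?L * (vx x - avg (Pow N) (Z x))" for x
  proof -
    have "avg (Pow N) (\<lambda>y. vx x - Z x (y - big x)) \<le> 2 ^ card (big x) * avg (Pow N) (\<lambda>y. vx x - Z x y)"
      by (rule avg_switch_off[OF N big(1)]) (use best in \<open>auto simp: vx_def\<close>)
    also have "\<dots> \<le> ?L * avg (Pow N) (\<lambda>y. vx x - Z x y)"
    proof (rule mult_right_mono)
      have "(2::real) ^ card (big x) = 2 powr real (card (big x))" by (simp add: powr_realpow)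
      also have "\<dots> \<le> ?L" using big(2)[of x] by simp
      finally show "(2::real) ^ card (big x) \<le> ?L" .
      show "0 \<le> avg (Pow N) (\<lambda>y. vx x - Z x y)" by (rule mean_ge[OF mN]) (use best in \<open>auto simp: vx_def\<close>)
    qed
    finally show ?thesis by (simp only: mean_diff[OF mN] mean_const[OF mN])
  qed
  have "avg (configs H) vx - avg (configs H) (\<lambda>x. avg (Pow N) (\<lambda>y. Z x (y - big x)))
      = avg (configs H) (\<lambda>x. vx x - avg (Pow N) (\<lambda>y. Z x (y - big x)))" by (rule mean_diff[OF m, symmetric])
  also have "\<dots> \<le> avg (configs H) (\<lambda>x. ?L * (vx x - avg (Pow N) (Z x)))" by (rule mean_mono[OF m pt])
  also have "\<dots> = ?L * (avg (configs H) vx - blind_val H I g N F)"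
    by (simp only: mean_cmult[OF m] mean_diff[OF m] Zbar)
  finally have 1: "avg (configs H) vx - ?L * (avg (configs H) vx - blind_val H I g N F) \<le> avg (configs H) (\<lambda>x. avg (Pow N) (\<lambda>y. Z x (y - big x)))"
    by simp
  (* The average of vx enters with the coefficient 1 - ?L \<le> 0, so its upper bound p is what is needed. *)
  have L1: "?L \<ge> 1" using a by (simp add: ge_one_powr_ge_zero)
  have "(?L - 1) * avg (configs H) vx \<le> (?L - 1) * p" using vbar L1 by (intro mult_left_mono) auto
  moreover have "?L * (p - \<gamma>) \<le> ?L * blind_val H I g N F" using B L1 by (intro mult_left_mono) auto
  ultimately have 2: "p - ?L * \<gamma> \<le> avg (configs H) (\<lambda>x. avg (Pow N) (\<lambda>y. Z x (y - big x)))"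
    using 1 by (simp add: algebra_simps)
  have "avg (configs H) (\<lambda>x. avg (Pow N) (\<lambda>y. Z x (y - big x))) = avg (Pow N) (\<lambda>y. avg (configs H) (\<lambda>x. Z x (y - big x)))"
    by (rule avg_swap)
  also have "\<dots> \<le> avg (Pow N) (\<lambda>y. val P H I g (live (drop_big H I a F) y))"
  proof (rule mean_mono[OF mN])
    fix y
    define f' where "f' j zz = (if j \<in> I then g j zz else f (y - big zz) j zz)" for j zz
    have w: "win P f' x \<longleftrightarrow> win P (f (y - big x)) x" for x
    proof -
      have "f' j (x(j := {})) = f (y - big x) j (x(j := {}))" for j
        by (cases "j \<in> I") (simp_all only: f'_def biger f(1) if_True if_False simp_thms)
      then show ?thesis by (simp only: win_def)
    qed
    have lv: "live (drop_big H I a F) y x = live F (y - big x) x" for x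
      by (auto simp: live_def drop_big_def big_def split: label.split)
    have "avg (configs H) (\<lambda>x. Z x (y - big x)) = avg (configs H) (\<lambda>x. avg (configs H) (\<lambda>z. W (y - big (mix I x z)) (mix I x z)))"
      by (rule mean_cong[OF m]) (simp only: bigmix, rule Z_def)
    also have "\<dots> = avg (configs H) (\<lambda>x. W (y - big x) x)" by (rule configs_resample[OF v])
    also have "\<dots> = success P H f' (live (drop_big H I a F) y)" by (simp add: success_def W_def w lv)
    also have "\<dots> \<le> val P H I g (live (drop_big H I a F) y)" by (rule success_le_val[OF v]) (auto simp: f'_def fun_eq_iff)
    finally show "avg (configs H) (\<lambda>x. Z x (y - big x)) \<le> val P H I g (live (drop_big H I a F) y)" .
  qed
  finally show ?thesis using 2 by (simp add: blind_val_def)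
qed

end

section \<open>Blinding one player\<close>

context hat_game begin

text \<open>
  The colours in \<open>A\<close> are decided by \<open>e\<close> once and for all; the others remain random.
\<close>
definition freeze :: "nat set \<Rightarrow> nat set \<Rightarrow> colouring \<Rightarrow> colouring" where
  "freeze A e F x = (case F x of Col c \<Rightarrow> if c \<in> A then (if c \<in> e then Free else Del) else Col c | l \<Rightarrow> l)"

definition keep :: "nat set \<Rightarrow> colouring \<Rightarrow> colouring" where
  "keep A F x = (case F x of Col c \<Rightarrow> if c \<in> A then Col c else Del | l \<Rightarrow> l)"

text \<open>
  Colours that are big on some line in direction \<open>i\<close>. There are boundedly many of them, as there are boundedly
  many lines; they are the ones for which player \<open>i\<close> cannot be blinded.
\<close>
definition heavy :: "config \<Rightarrow> nat \<Rightarrow> real \<Rightarrow> colouring \<Rightarrow> nat set" where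
  "heavy K i \<tau> F = {c. \<exists>x\<in>configs K. class_size K i F x c > \<tau>}"

lemma live_freeze: "live (freeze A e F) y = live F ((e \<inter> A) \<union> (y - A))"
  by (auto simp: fun_eq_iff live_def freeze_def split: label.split)

lemma live_keep: "live (keep A F) e x = of_bool (freeze A e F x = Free)"
  by (auto simp: live_def freeze_def keep_def split: label.split)

lemma valid_erase: "valid P K \<Longrightarrow> valid P (K(i := {}))"
  by (auto simp: valid_def)

lemma heavy_bound:
  assumes v: "valid P K" and \<tau>: "\<tau> > 0"
  shows "finite (heavy K i \<tau> F)" "real (card (heavy K i \<tau> F)) \<le> card (configs (K(i := {}))) / \<tau>"
proof -
  let ?R = "configs (K(i := {}))" and ?B = "\<lambda>z. {c. class_size K i F z c > \<tau>}"
  have fR: "finite ?R" by (rule finite_configs[OF finP valid_erase[OF v]])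
  have sub: "heavy K i \<tau> F \<subseteq> (\<Union>z\<in>?R. ?B z)"
  proof
    fix c assume "c \<in> heavy K i \<tau> F"
    then obtain x where x: "x \<in> configs K" "class_size K i F x c > \<tau>" by (auto simp: heavy_def)
    then have "x(i := {}) \<in> ?R" by (auto simp: configs_def Pi_def)
    moreover have "c \<in> ?B (x(i := {}))" using x by (simp add: class_size_upd)
    ultimately show "c \<in> (\<Union>z\<in>?R. ?B z)" by blast
  qed
  have B: "finite (?B z)" "real (card (?B z)) \<le> 1 / \<tau>" for z
    using big_colours[OF mean_configs[OF v] \<tau>, of "\<lambda>u. F (z(i := u i))"] by (auto simp: class_size_def)
  have fU: "finite (\<Union>z\<in>?R. ?B z)" using fR B by blast
  then show "finite (heavy K i \<tau> F)" using sub finite_subset by blast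
  have "card (heavy K i \<tau> F) \<le> card (\<Union>z\<in>?R. ?B z)" by (rule card_mono[OF fU sub])
  also have "\<dots> \<le> (\<Sum>z\<in>?R. card (?B z))" by (rule card_UN_le[OF fR])
  finally have "real (card (heavy K i \<tau> F)) \<le> (\<Sum>z\<in>?R. real (card (?B z)))" by (simp flip: of_nat_sum)
  also have "\<dots> \<le> (\<Sum>z\<in>?R. 1 / \<tau>)" by (intro sum_mono B)
  finally show "real (card (heavy K i \<tau> F)) \<le> card ?R / \<tau>" by simp
qed

lemma avg_class_size: "valid P K \<Longrightarrow> avg (configs K) (\<lambda>x. class_size K i F x c) = avg (configs K) (\<lambda>x. of_bool (F x = Col c))"
  unfolding class_size_def by (rule configs_resample1)

text \<open>
  Applied to the part \<open>G\<close> of the colouring that is small in the original game: a colour may be heavy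
  because of one line and yet be small on the line at hand. The estimate shows that this concerns few
  configurations.
\<close>
lemma heavy_mass:
  assumes v: "valid P K" and A: "finite A"
  shows "avg (configs K) (\<lambda>x. of_bool (\<exists>c\<in>A. G x = Col c)) \<le> card A * avg (configs K) (max_class K i G)"
proof -
  note m = mean_configs[OF v]
  have "avg (configs K) (\<lambda>x. of_bool (\<exists>c\<in>A. G x = Col c)) \<le> avg (configs K) (\<lambda>x. \<Sum>c\<in>A. of_bool (G x = Col c))"
  proof (rule mean_mono[OF m])
    fix x show "of_bool (\<exists>c\<in>A. G x = Col c) \<le> (\<Sum>c\<in>A. of_bool (G x = Col c) :: real)"
    proof (cases "\<exists>c\<in>A. G x = Col c")
      case True
      then obtain c where c: "c \<in> A" "G x = Col c" by blast
      have "of_bool (G x = Col c) \<le> (\<Sum>c\<in>A. of_bool (G x = Col c) :: real)"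
        by (rule member_le_sum) (use c A in auto)
      then show ?thesis using c by auto
    qed (auto intro!: sum_nonneg)
  qed
  also have "\<dots> = (\<Sum>c\<in>A. avg (configs K) (\<lambda>x. class_size K i G x c))" by (simp only: mean_sum[OF m] avg_class_size[OF v])
  also have "\<dots> \<le> (\<Sum>c\<in>A. avg (configs K) (max_class K i G))"
    by (intro sum_mono mean_mono[OF m] class_size_le_max[OF v])
  finally show ?thesis by simp
qed

text \<open>
  For a fixed state \<open>e\<close> of the heavy colours, each of the remaining colours has measure at most \<open>\<tau>\<close>, so the value
  for a fixed behaviour of player \<open>i\<close> is concentrated. By the maximal inequality player \<open>i\<close> may fix her
  behaviour \<open>r e\<close> before the remaining colours are drawn.
\<close>
lemma blind_player:
  fixes F :: "colouring"
  assumes v: "valid P K" and N: "finite N" and i: "i \<notin> I" "K i \<noteq> {}" and \<tau>: "\<tau> > 0" and l: "l > 0"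
  defines "A \<equiv> heavy K i \<tau> F"
  shows "\<exists>r. blind_val K I g N F \<le> avg (Pow N) (\<lambda>e. blind_val K (insert i I) (g(i := r e)) N (freeze A e F))
            + (ln (card (responses K i)) / l + l * \<tau> / 8)"
proof -
  note m = mean_configs[OF v] and mN = mean_Pow[OF N]
  let ?f = "\<lambda>e k y. val P K (insert i I) (g(i := k)) (live (freeze A e F) y)"
  let ?dev = "ln (card (responses K i)) / l + l * \<tau> / 8"
  have fin: "finite (responses K i)" by (rule finite_responses[OF v])
  have "\<exists>k. avg (Pow N) (\<lambda>y. val P K I g (live (freeze A e F) y)) \<le> avg (Pow N) (?f e k) + ?dev" for e
  proof -
    have "\<forall>y. \<exists>k. k \<in> responses K i \<and> val P K I g (live (freeze A e F) y) \<le> ?f e k y"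
    proof
      fix y
      obtain k where "k \<in> responses K i" "val P K I g (live (freeze A e F) y) \<le> ?f e k y"
        by (rule val_choose[OF v i, of "live (freeze A e F) y" g]) (use live_bounds in auto)
      then show "\<exists>k. k \<in> responses K i \<and> val P K I g (live (freeze A e F) y) \<le> ?f e k y" by blast
    qed
    from choice[OF this] obtain k where k: "\<And>y. k y \<in> responses K i"
       "\<And>y. val P K I g (live (freeze A e F) y) \<le> ?f e (k y) y" by auto
    define B where "B = Max ((\<lambda>k. avg (Pow N) (?f e k)) ` responses K i)"
    have "B \<in> (\<lambda>k. avg (Pow N) (?f e k)) ` responses K i"
      unfolding B_def by (rule Max_in) (use fin k(1) in auto)
    then obtain k0 where k0: "B = avg (Pow N) (?f e k0)" by blast
    define w where "w c = avg (configs K) (\<lambda>x. of_bool (freeze A e F x = Col c))" for c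
    have w0: "0 \<le> w c" for c unfolding w_def by (rule mean_ge[OF m]) auto
    have w\<tau>: "w c \<le> \<tau>" for c
    proof (cases "c \<in> A")
      case True
      then have "freeze A e F x \<noteq> Col c" for x by (auto simp: freeze_def split: label.split)
      then show ?thesis using \<tau> by (simp add: w_def mean_const[OF m])
    next
      case False
      have "w c \<le> avg (configs K) (\<lambda>x. of_bool (F x = Col c))"
        unfolding w_def by (rule mean_mono[OF m]) (auto simp: freeze_def split: label.splits if_splits)
      also have "\<dots> = avg (configs K) (\<lambda>x. class_size K i F x c)" by (rule avg_class_size[OF v, symmetric])
      also have "\<dots> \<le> \<tau>" by (rule mean_le[OF m]) (use False in \<open>auto simp: A_def heavy_def not_less\<close>)
      finally show ?thesis .
    qed
    have s1: "(\<Sum>c\<in>N. w c) \<le> 1"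
    proof -
      have "avg (configs K) (\<lambda>x. \<Sum>c\<in>N. of_bool (freeze A e F x = Col c)) \<le> 1"
        by (intro mean_le[OF m] sum_colour_le_1 N)
      then show ?thesis by (simp only: w_def mean_sum[OF m])
    qed
    have W: "(\<Sum>c\<in>N. (w c)\<^sup>2) \<le> \<tau>"
    proof -
      have "(\<Sum>c\<in>N. (w c)\<^sup>2) \<le> (\<Sum>c\<in>N. \<tau> * w c)"
        by (intro sum_mono) (use w0 w\<tau> in \<open>auto simp: power2_eq_square intro: mult_right_mono\<close>)
      also have "\<dots> \<le> \<tau> * 1" unfolding sum_distrib_left[symmetric] by (rule mult_left_mono[OF s1]) (use \<tau> in simp)
      finally show ?thesis by simp
    qed
    have "avg (Pow N) (\<lambda>y. val P K I g (live (freeze A e F) y)) \<le> avg (Pow N) (\<lambda>y. ?f e (k y) y)"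
      by (rule mean_mono[OF mN]) (rule k)
    also have "\<dots> \<le> B + ln (card (responses K i)) / l + l * (\<Sum>c\<in>N. (w c)\<^sup>2) / 8"
    proof (rule avg_select_le[OF N fin l])
      fix k' c y
      have "?f e k' (insert c y) \<le> ?f e k' (y - {c}) + w c"
        unfolding w_def by (rule val_lipschitz[OF v]) (auto simp: live_def split: label.split)
      moreover have "?f e k' (y - {c}) \<le> ?f e k' (insert c y) + w c"
        unfolding w_def by (rule val_lipschitz[OF v]) (auto simp: live_def split: label.split)
      ultimately show "\<bar>?f e k' (insert c y) - ?f e k' (y - {c})\<bar> \<le> w c" by linarith
    next
      fix k' assume "k' \<in> responses K i"
      then show "avg (Pow N) (?f e k') \<le> B" unfolding B_def using fin by (intro Max_ge) auto
    qed (rule k)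
    also have "\<dots> \<le> B + ?dev" using W l by simp
    finally show ?thesis unfolding k0 by blast
  qed
  then have "\<forall>e. \<exists>k. avg (Pow N) (\<lambda>y. val P K I g (live (freeze A e F) y)) \<le> avg (Pow N) (?f e k) + ?dev" by blast
  from choice[OF this] obtain r where
    r: "\<And>e. avg (Pow N) (\<lambda>y. val P K I g (live (freeze A e F) y)) \<le> avg (Pow N) (?f e (r e)) + ?dev" by auto
  have "blind_val K I g N F = avg (Pow N) (\<lambda>e. avg (Pow N) (\<lambda>y. val P K I g (live (freeze A e F) y)))"
    unfolding blind_val_def live_freeze by (rule avg_Pow_mix[OF N, symmetric])
  also have "\<dots> \<le> avg (Pow N) (\<lambda>e. avg (Pow N) (?f e (r e)) + ?dev)" by (rule mean_mono[OF mN]) (rule r)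
  also have "\<dots> = avg (Pow N) (\<lambda>e. avg (Pow N) (?f e (r e))) + ?dev" by (simp only: mean_add[OF mN] mean_const[OF mN])
  finally show ?thesis unfolding blind_val_def by blast
qed

lemma blind_val_le_p: "valid P H \<Longrightarrow> finite N \<Longrightarrow> blind_val H I g N F \<le> p"
  unfolding blind_val_def by (intro mean_le[OF mean_Pow] val_le_p live_bounds)

text \<open>
  In a game with blind players \<open>I\<close> whose value is close to \<open>p\<close>, deleting all coloured configurations costs
  little. The conclusion is only claimed in a random simulation of the game, of a law that does not depend on
  the strategy \<open>g\<close> or the colouring \<open>F\<close>; this is what makes it possible to average it over environments
  \<open>e\<close> in \<open>remove_light\<close>. The parameters \<open>\<gamma>\<close> and \<open>\<eta>\<close> do not depend on the number of hats.
\<close>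
definition robust :: "nat set \<Rightarrow> bool" where
  "robust I \<longleftrightarrow> (\<forall>\<xi>>0. \<forall>\<rho>>0. \<exists>\<gamma>>0. \<exists>\<eta>>0. \<forall>H. valid P H \<longrightarrow>
     (\<exists>H' D. valid P H' \<and> mean (samplers H' H) D \<and> faithful H' H D \<and> (\<forall>i\<in>P. spreads H' H D i \<eta> \<rho>) \<and>
       (\<forall>g F N. finite N \<longrightarrow> p - \<gamma> \<le> blind_val H I g N F \<longrightarrow>
          p - \<xi> \<le> D (\<lambda>s. val P H' I (pull s g) (\<lambda>x. of_bool (F (sim s x) = Free))))))"

lemma spreads_mono: "spreads H' H D i \<eta> \<rho> \<Longrightarrow> \<rho> \<le> \<rho>' \<Longrightarrow> spreads H' H D i \<eta> \<rho>'"
  unfolding spreads_def by force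

text \<open>
  One removal. The current game \<open>H1\<close>, a simulation of the original game \<open>H\<close>, is simulated by \<open>K\<close>, where
  player \<open>i\<close> is blinded to the colours that are not heavy. The hypothesis \<open>good\<close> for the blind players
  \<open>insert i I\<close> then deletes these colours in each environment \<open>e\<close>. The heavy colours survive; those of
  them that are small in \<open>H\<close> are deleted too, at a cost bounded by \<open>heavy_mass\<close>.
\<close>
lemma remove_light:
  fixes K H1 H :: config
  assumes v: "valid P H" "valid P H1" "valid P K" "valid P H2"
    and K: "\<And>j. j \<in> P \<Longrightarrow> K j \<noteq> {}" "\<And>j. j \<in> P \<Longrightarrow> even (card (K j))"
    and D: "mean (samplers H1 H) D"
    and DK: "mean (samplers H2 K) DK" "faithful H2 K DK"
    and i: "i \<in> P" "i \<notin> I" and pos: "\<tau> > 0" "l > 0" "\<gamma> > 0" "\<xi> \<ge> 0"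
    and good: "\<And>g F. p - \<gamma> \<le> blind_val K (insert i I) g N F \<Longrightarrow>
          p - \<xi> \<le> DK (\<lambda>s. val P H2 (insert i I) (pull s g) (\<lambda>x. of_bool (F (sim s x) = Free)))"
    and N: "finite N"
    and near: "p - \<xi>' \<le> D (\<lambda>s. blind_val H1 I (pull s g) N (\<lambda>x. F (sim s x)))"
    and sp: "spreads K H (bind_sampler D (random_hats K H1)) i \<eta> \<rho>''" and \<eta>: "0 \<le> \<eta>"
  shows "p - \<xi> - (\<xi>' + (\<Sum>j\<in>P. 1 / (2 * sqrt (card (K j)))) + (ln (card (responses K i)) / l + l * \<tau> / 8)) / \<gamma>
           - card (configs (K(i := {}))) / \<tau> * \<rho>''
       \<le> bind_sampler (bind_sampler D (random_hats K H1)) DK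
           (\<lambda>s. blind_val H2 I (pull s g) N (\<lambda>x. drop_small H \<eta> i F (sim s x)))"
proof -
  let ?S = "bind_sampler D (random_hats K H1)" and ?\<epsilon> = "\<Sum>j\<in>P. 1 / (2 * sqrt (card (K j)))"
  let ?dev = "ln (card (responses K i)) / l + l * \<tau> / 8" and ?k = "card (configs (K(i := {})))"
  note mN = mean_Pow[OF N] and mR = mean_random_hats[OF v(2,3) K]
  have mS: "mean (samplers K H) ?S" by (rule mean_bind_sampler[OF D mR])
  (* Passing to K costs the probability that somebody picks a hat altered by balancing. *)
  have a: "p - \<xi>' - ?\<epsilon> \<le> ?S (\<lambda>s. blind_val K I (pull s g) N (\<lambda>x. F (sim s x)))"
  proof -
    have "blind_val H1 I (pull s g) N (\<lambda>x. F (sim s x)) - ?\<epsilon>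
      \<le> random_hats K H1 (\<lambda>q. blind_val K I (pull (compose s q) g) N (\<lambda>x. F (sim (compose s q) x)))" for s
    proof -
      have lv: "live (\<lambda>x. F (sim s (sim q x))) y = (\<lambda>x. live (\<lambda>x. F (sim s x)) y (sim q x))" for q y
        by (simp add: live_def fun_eq_iff)
      have "blind_val H1 I (pull s g) N (\<lambda>x. F (sim s x)) - ?\<epsilon>
        = avg (Pow N) (\<lambda>y. val P H1 I (pull s g) (live (\<lambda>x. F (sim s x)) y) - ?\<epsilon>)"
        by (simp only: blind_val_def mean_diff[OF mN] mean_const[OF mN])
      also have "\<dots> \<le> avg (Pow N) (\<lambda>y. random_hats K H1 (\<lambda>q. val P K I (pull q (pull s g)) (\<lambda>x. live (\<lambda>x. F (sim s x)) y (sim q x))))"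
        by (intro mean_mono[OF mN] random_hats_val[OF v(2,3) K] live_bounds)
      also have "\<dots> = random_hats K H1 (\<lambda>q. avg (Pow N) (\<lambda>y. val P K I (pull q (pull s g)) (\<lambda>x. live (\<lambda>x. F (sim s x)) y (sim q x))))"
        by (rule mean_avg_swap[OF mR, symmetric])
      finally show ?thesis by (simp only: blind_val_def pull_compose sim_compose lv)
    qed
    then have "D (\<lambda>s. blind_val H1 I (pull s g) N (\<lambda>x. F (sim s x)) - ?\<epsilon>)
       \<le> ?S (\<lambda>s. blind_val K I (pull s g) N (\<lambda>x. F (sim s x)))"
      unfolding bind_sampler_def by (intro mean_mono[OF D])
    then show ?thesis using near by (simp add: mean_diff[OF D] mean_const[OF D])
  qed
  (* The part of the colouring that is to be removed. *)
  define G where "G x = (case F x of Col c \<Rightarrow> if class_size H i F x c \<le> \<eta> then Col c else Del | l \<Rightarrow> Del)" for x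
  have Gclass_size: "class_size H i G x c \<le> \<eta>" for x c
  proof (cases "class_size H i F x c \<le> \<eta>")
    case True
    have "class_size H i G x c \<le> class_size H i F x c" unfolding class_size_def[of H i G] class_size_def[of H i F x]
      by (rule mean_mono[OF mean_configs[OF v(1)]]) (auto simp: G_def split: label.splits if_splits)
    then show ?thesis using True by simp
  next
    case False
    then have "G (x(i := u)) \<noteq> Col c" for u by (auto simp: G_def class_size_upd split: label.split)
    then show ?thesis using \<eta> by (simp add: class_size_def mean_const[OF mean_configs[OF v(1)]])
  qed
  let ?top = "\<lambda>s. avg (configs K) (max_class K i (\<lambda>x. G (sim s x)))"
  have tp: "?S ?top \<le> \<rho>''" using sp Gclass_size by (auto simp: spreads_def)
  have main: "p - \<xi> - (p - (blind_val K I (pull s g) N (\<lambda>x. F (sim s x)) - ?dev)) / \<gamma> - ?k / \<tau> * ?top s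
      \<le> DK (\<lambda>d. blind_val H2 I (pull (compose s d) g) N (\<lambda>x. drop_small H \<eta> i F (sim (compose s d) x)))" for s
  proof -
    let ?F = "\<lambda>x. F (sim s x)"
    define A where "A = heavy K i \<tau> ?F"
    obtain r where r: "blind_val K I (pull s g) N ?F
       \<le> avg (Pow N) (\<lambda>e. blind_val K (insert i I) ((pull s g)(i := r e)) N (freeze A e ?F)) + ?dev"
      using blind_player[OF v(3) N i(2) K(1)[OF i(1)] pos(1,2), of "pull s g" ?F] unfolding A_def by blast
    let ?b = "\<lambda>e. blind_val K (insert i I) ((pull s g)(i := r e)) N (freeze A e ?F)"
    let ?u = "\<lambda>e d. val P H2 I (pull (compose s d) g) (live (\<lambda>x. keep A ?F (sim d x)) e)"
    have lk: "live (\<lambda>x. keep A ?F (sim d x)) e = (\<lambda>x. of_bool (freeze A e ?F (sim d x) = Free))" for d e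
      using live_keep[of A ?F e] by (simp add: fun_eq_iff live_def)
    have u0: "0 \<le> DK (?u e)" for e
      by (rule mean_ge[OF DK(1)]) (auto intro!: val_nonneg[OF v(4)] live_bounds)
    have b_le: "?b e \<le> p" for e by (rule blind_val_le_p[OF v(3) N])
    (* The conclusion for near-optimal environments, in a form that holds trivially for the other ones and is
       linear in the value, so that it can be averaged. *)
    have c1: "p - \<xi> - (p - ?b e) / \<gamma> \<le> DK (?u e)" for e
    proof (cases "p - \<gamma> \<le> ?b e")
      case True
      have "p - \<xi> \<le> DK (\<lambda>d. val P H2 (insert i I) (pull d ((pull s g)(i := r e))) (\<lambda>x. of_bool (freeze A e ?F (sim d x) = Free)))"
        by (rule good[OF True])
      also have "\<dots> \<le> DK (?u e)"
        unfolding lk pull_compose by (intro mean_mono[OF DK(1)] val_subset[OF v(4)]) (use i in \<open>auto simp: pull_def\<close>)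
      finally show ?thesis using b_le[of e] pos(3) by (smt (verit) divide_nonneg_pos)
    next
      case False
      then have "(p - ?b e) / \<gamma> > 1" using pos(3) by (simp add: field_simps)
      then show ?thesis using u0[of e] p_le_1 pos(4) by linarith
    qed
    have bl: "blind_val H2 I (pull (compose s d) g) N (\<lambda>x. keep A ?F (sim d x))
       \<le> blind_val H2 I (pull (compose s d) g) N (\<lambda>x. drop_small H \<eta> i F (sim (compose s d) x))
         + avg (configs H2) (\<lambda>x. of_bool (\<exists>c\<in>A. G (sim s (sim d x)) = Col c))" for d
    proof -
      let ?bad = "\<lambda>x. of_bool (\<exists>c\<in>A. G (sim s (sim d x)) = Col c) :: real"
      have "live (\<lambda>x. keep A ?F (sim d x)) y x \<le> live (\<lambda>x. drop_small H \<eta> i F (sim (compose s d) x)) y x + ?bad x" for y x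
        by (auto simp: live_def keep_def drop_small_def sim_compose G_def split: label.split)
      then have "blind_val H2 I (pull (compose s d) g) N (\<lambda>x. keep A ?F (sim d x))
        \<le> avg (Pow N) (\<lambda>y. val P H2 I (pull (compose s d) g) (live (\<lambda>x. drop_small H \<eta> i F (sim (compose s d) x)) y) + avg (configs H2) ?bad)"
        unfolding blind_val_def by (intro mean_mono[OF mN] val_lipschitz[OF v(4)]) auto
      then show ?thesis by (simp only: blind_val_def mean_add[OF mN] mean_const[OF mN])
    qed
    have "p - \<xi> - (p - (blind_val K I (pull s g) N ?F - ?dev)) / \<gamma> \<le> p - \<xi> - (p - avg (Pow N) ?b) / \<gamma>"
      using r pos(3) by (simp add: divide_right_mono)
    also have "\<dots> = avg (Pow N) (\<lambda>e. p - \<xi> - (p - ?b e) / \<gamma>)"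
      by (simp only: mean_diff[OF mN] mean_const[OF mN] mean_divide[OF mN])
    also have "\<dots> \<le> avg (Pow N) (\<lambda>e. DK (?u e))" by (intro mean_mono[OF mN] c1)
    also have "\<dots> = DK (\<lambda>d. blind_val H2 I (pull (compose s d) g) N (\<lambda>x. keep A ?F (sim d x)))"
      unfolding blind_val_def by (rule mean_avg_swap[OF DK(1), symmetric])
    also have "\<dots> \<le> DK (\<lambda>d. blind_val H2 I (pull (compose s d) g) N (\<lambda>x. drop_small H \<eta> i F (sim (compose s d) x))
         + avg (configs H2) (\<lambda>x. of_bool (\<exists>c\<in>A. G (sim s (sim d x)) = Col c)))" by (intro mean_mono[OF DK(1)] bl)
    also have "\<dots> = DK (\<lambda>d. blind_val H2 I (pull (compose s d) g) N (\<lambda>x. drop_small H \<eta> i F (sim (compose s d) x)))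
         + avg (configs K) (\<lambda>x. of_bool (\<exists>c\<in>A. G (sim s x) = Col c))"
      by (subst mean_add[OF DK(1)]) (simp only: faithfulD[OF DK(2), of "\<lambda>x. of_bool (\<exists>c\<in>A. G (sim s x) = Col c)"])
    also have "avg (configs K) (\<lambda>x. of_bool (\<exists>c\<in>A. G (sim s x) = Col c)) \<le> card A * ?top s"
      by (rule heavy_mass[OF v(3)]) (simp add: A_def heavy_bound[OF v(3) pos(1)])
    also have "card A * ?top s \<le> ?k / \<tau> * ?top s"
      by (rule mult_right_mono) (auto simp: A_def heavy_bound[OF v(3) pos(1)] intro!: mean_ge[OF mean_configs[OF v(3)]] max_class_bounds[OF v(3)])
    finally show ?thesis by simp
  qed
  have "p - \<xi> - (\<xi>' + ?\<epsilon> + ?dev) / \<gamma> - ?k / \<tau> * \<rho>''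
     \<le> p - \<xi> - (p - (?S (\<lambda>s. blind_val K I (pull s g) N (\<lambda>x. F (sim s x))) - ?dev)) / \<gamma> - ?k / \<tau> * ?S ?top"
  proof (rule diff_mono)
    have "p - (?S (\<lambda>s. blind_val K I (pull s g) N (\<lambda>x. F (sim s x))) - ?dev) \<le> \<xi>' + ?\<epsilon> + ?dev" using a by linarith
    then show "p - \<xi> - (\<xi>' + ?\<epsilon> + ?dev) / \<gamma> \<le> p - \<xi> - (p - (?S (\<lambda>s. blind_val K I (pull s g) N (\<lambda>x. F (sim s x))) - ?dev)) / \<gamma>"
      using pos(3) by (intro diff_left_mono divide_right_mono) auto
    show "?k / \<tau> * ?S ?top \<le> ?k / \<tau> * \<rho>''" using tp pos(1) by (intro mult_left_mono) auto
  qed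
  also have "\<dots> = ?S (\<lambda>s. p - \<xi> - (p - (blind_val K I (pull s g) N (\<lambda>x. F (sim s x)) - ?dev)) / \<gamma> - ?k / \<tau> * ?top s)"
    by (simp only: mean_diff[OF mS] mean_const[OF mS] mean_divide[OF mS] mean_cmult[OF mS])
  also have "\<dots> \<le> ?S (\<lambda>s. DK (\<lambda>d. blind_val H2 I (pull (compose s d) g) N (\<lambda>x. drop_small H \<eta> i F (sim (compose s d) x))))"
    by (rule mean_mono[OF mS main])
  finally show ?thesis by (simp only: bind_sampler_def[of ?S DK])
qed

end

section \<open>Induction on the blind players\<close>

context hat_game begin

definition id_sampler :: sampler where "id_sampler = ((\<lambda>j u. u), (\<lambda>j a. a))"

lemma sim_id_sampler: "sim id_sampler x = x" by (simp add: sim_def id_sampler_def)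

lemma mean_id_sampler: "mean (samplers H H) (\<lambda>g. g id_sampler)"
  by (auto simp: mean_def samplers_def id_sampler_def)

lemma faithful_id_sampler: "faithful H H (\<lambda>g. g id_sampler)"
  by (simp add: faithful_def sim_id_sampler)

lemma spreads_id_sampler:
  assumes v: "valid P H" shows "spreads H H (\<lambda>g. g id_sampler) i \<eta> \<eta>"
  unfolding spreads_def sim_id_sampler by (auto intro!: mean_le[OF mean_configs[OF v]] max_class_le)

lemma pull_id_sampler: "pull id_sampler g j (x(j := {})) = g j (x(j := {}))"
  by (simp add: pull_def sim_id_sampler) (simp add: id_sampler_def)

text \<open>
  The two commitments are not equal as functions, but they agree on all legal views.
\<close>
lemma val_id_sampler:
  assumes v: "valid P H" shows "val P H I g A \<le> val P H I (pull id_sampler g) A"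
proof -
  obtain f where f: "\<forall>i\<in>I. f i = g i" "val P H I g A = success P H f A" by (rule val_attained[OF v])
  define f' where "f' i = (if i \<in> I then pull id_sampler g i else f i)" for i
  have "f' j (x(j := {})) = f j (x(j := {}))" for j x
    using f(1) by (cases "j \<in> I") (simp_all add: f'_def pull_id_sampler)
  then have "win P f' x = win P f x" for x by (simp add: win_def)
  then have "success P H f A = success P H f' A" by (simp add: success_def)
  also have "\<dots> \<le> val P H I (pull id_sampler g) A" by (rule success_le_val[OF v]) (simp add: f'_def)
  finally show ?thesis using f by simp
qed

lemma avg_live_le:
  assumes N: "finite N" shows "avg (Pow N) (\<lambda>y. live F y x) \<le> (1 + of_bool (F x = Free)) / 2"
proof (cases "F x")
  case (Col c)
  have "avg (Pow N) (\<lambda>y. of_bool (c \<in> y)) \<le> 1 / 2"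
  proof (cases "c \<in> N")
    case True
    then obtain N' where N': "N = insert c N'" "c \<notin> N'" by (meson mk_disjoint_insert)
    then have fN: "finite N'" using N by simp
    have "avg (Pow N') (\<lambda>y. of_bool (c \<in> y)) = avg (Pow N') (\<lambda>_. 0)"
      by (rule mean_cong[OF mean_Pow[OF fN]]) (use N' in auto)
    then show ?thesis unfolding N'(1) avg_Pow_insert[OF fN N'(2)] by (simp add: mean_const[OF mean_Pow[OF fN]])
  next
    case False
    have "avg (Pow N) (\<lambda>y. of_bool (c \<in> y)) = avg (Pow N) (\<lambda>_. 0)"
      by (rule mean_cong[OF mean_Pow[OF N]]) (use False in auto)
    then show ?thesis by (simp add: mean_const[OF mean_Pow[OF N]])
  qed
  then show ?thesis using Col by (simp add: live_def)
qed (auto simp: live_def mean_const[OF mean_Pow[OF N]])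

text \<open>
  If everybody is blind, the set of won configurations is fixed, and a coloured configuration counts at most
  half of the time. As the total is at most \<open>p\<close>, a value \<open>p - \<xi> / 2\<close> forces the uncoloured part to be at
  least \<open>p - \<xi>\<close>.
\<close>
lemma robust_all: "robust P"
  unfolding robust_def
proof (intro allI impI)
  fix \<xi> \<rho> :: real assume pos: "0 < \<xi>" "0 < \<rho>"
  show "\<exists>\<gamma>>0. \<exists>\<eta>>0. \<forall>H. valid P H \<longrightarrow>
     (\<exists>H' D. valid P H' \<and> mean (samplers H' H) D \<and> faithful H' H D \<and> (\<forall>i\<in>P. spreads H' H D i \<eta> \<rho>) \<and>
       (\<forall>g F N. finite N \<longrightarrow> p - \<gamma> \<le> blind_val H P g N F \<longrightarrow>
          p - \<xi> \<le> D (\<lambda>s. val P H' P (pull s g) (\<lambda>x. of_bool (F (sim s x) = Free)))))"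
  proof (rule exI[of _ "\<xi> / 2"], intro conjI, use pos in simp, rule exI[of _ \<rho>], intro conjI, rule pos(2), intro allI impI)
    fix H assume v: "valid P H"
    note m = mean_configs[OF v]
    have "p - \<xi> \<le> val P H P (pull id_sampler g) (\<lambda>x. of_bool (F (sim id_sampler x) = Free))"
      if N: "finite N" and B: "p - \<xi> / 2 \<le> blind_val H P g N F" for g F N
    proof -
      let ?w = "\<lambda>x. of_bool (win P g x) :: real"
      have "val P H P g A = success P H g A" for A
      proof -
        obtain f where f: "\<forall>i\<in>P. f i = g i" "val P H P g A = success P H f A" by (rule val_attained[OF v])
        then have "win P f = win P g" by (auto simp: win_def fun_eq_iff)
        then show ?thesis using f by (simp add: success_def)
      qed
      then have "blind_val H P g N F = avg (Pow N) (\<lambda>y. avg (configs H) (\<lambda>x. ?w x * live F y x))"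
        by (simp add: blind_val_def success_def)
      also have "\<dots> = avg (configs H) (\<lambda>x. avg (Pow N) (\<lambda>y. ?w x * live F y x))" by (rule avg_swap)
      also have "\<dots> = avg (configs H) (\<lambda>x. ?w x * avg (Pow N) (\<lambda>y. live F y x))"
        by (simp only: mean_cmult[OF mean_Pow[OF N]])
      also have "\<dots> \<le> avg (configs H) (\<lambda>x. (?w x + ?w x * of_bool (F x = Free)) / 2)"
      proof (rule mean_mono[OF m])
        fix x show "?w x * avg (Pow N) (\<lambda>y. live F y x) \<le> (?w x + ?w x * of_bool (F x = Free)) / 2"
          using avg_live_le[OF N, of F x] by (cases "win P g x") auto
      qed
      also have "\<dots> = (avg (configs H) ?w + success P H g (\<lambda>x. of_bool (F x = Free))) / 2"
        by (simp only: mean_add[OF m] mean_divide[OF m] success_def)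
      finally have "2 * p - \<xi> \<le> avg (configs H) ?w + success P H g (\<lambda>x. of_bool (F x = Free))" using B by simp
      then have "p - \<xi> \<le> success P H g (\<lambda>x. of_bool (F x = Free))" using win_le[OF v, of g] by simp
      also have "\<dots> \<le> val P H P g (\<lambda>x. of_bool (F x = Free))" by (rule success_le_val[OF v]) simp
      also have "\<dots> \<le> val P H P (pull id_sampler g) (\<lambda>x. of_bool (F x = Free))" by (rule val_id_sampler[OF v])
      finally show ?thesis by (simp add: sim_id_sampler)
    qed
    then show "\<exists>H' D. valid P H' \<and> mean (samplers H' H) D \<and> faithful H' H D \<and> (\<forall>i\<in>P. spreads H' H D i \<rho> \<rho>) \<and>
       (\<forall>g F N. finite N \<longrightarrow> p - \<xi> / 2 \<le> blind_val H P g N F \<longrightarrow>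
          p - \<xi> \<le> D (\<lambda>s. val P H' P (pull s g) (\<lambda>x. of_bool (F (sim s x) = Free))))"
      using v mean_id_sampler faithful_id_sampler spreads_id_sampler[OF v]
      by (intro exI[of _ H] exI[of _ "\<lambda>g. g id_sampler"]) blast
  qed
qed

text \<open>
  The removal \<open>R\<close> of colours keeps near-optimality, with loss from \<open>\<xi>'\<close> to \<open>\<xi>\<close>, at the price of one more
  simulation, which weakens the spreading from \<open>\<rho>'\<close> to \<open>\<rho>\<close>. Colour classes are always measured in the original game \<open>H\<close>,
  so that successive removals can be compared.
\<close>
definition removable where
  "removable I R \<xi> \<rho> \<xi>' \<rho>' \<longleftrightarrow> (\<forall>H H1 D \<eta>. valid P H \<longrightarrow> valid P H1 \<longrightarrow> mean (samplers H1 H) D \<longrightarrow> faithful H1 H D \<longrightarrow>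
      (\<forall>j\<in>P. spreads H1 H D j \<eta> \<rho>') \<longrightarrow> 0 \<le> \<eta> \<longrightarrow>
      (\<exists>H2 D2. valid P H2 \<and> mean (samplers H2 H) D2 \<and> faithful H2 H D2 \<and> (\<forall>j\<in>P. spreads H2 H D2 j \<eta> \<rho>) \<and>
        (\<forall>g F N. finite N \<longrightarrow> p - \<xi>' \<le> D (\<lambda>s. blind_val H1 I (pull s g) N (\<lambda>x. F (sim s x))) \<longrightarrow>
           p - \<xi> \<le> D2 (\<lambda>s. blind_val H2 I (pull s g) N (\<lambda>x. R H \<eta> F (sim s x))))))"

lemma choose_even:
  assumes "eventually Q at_top" shows "\<exists>m::nat. even m \<and> m \<ge> 2 \<and> Q (real m)"
proof -
  have "filterlim (\<lambda>k::nat. real (2 * k)) at_top sequentially" by real_asymp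
  then have "eventually (\<lambda>k::nat. Q (real (2 * k)) \<and> k \<ge> 1) sequentially"
    using assms eventually_compose_filterlim eventually_ge_at_top eventually_conj by fastforce
  then obtain k :: nat where "Q (real (2 * k))" "k \<ge> 1" by (auto simp: eventually_sequentially)
  then show ?thesis by (intro exI[of _ "2 * k"]) auto
qed

text \<open>
  The sizes are chosen in the order \<open>m\<close> (hats of the other players), then \<open>M\<close> (hats of player \<open>i\<close>). The number \<open>k\<close>
  of lines in direction \<open>i\<close> depends on \<open>m\<close> only. The logarithm of the number of behaviours of player \<open>i\<close> is
  \<open>k ln M\<close>, whereas colours can be kept as small as a power of \<open>1/M\<close>; so for large \<open>M\<close> concentration wins.
\<close>
lemma robust_step:
  assumes R: "robust (insert i I)" and i: "i \<in> P" "i \<notin> I" and pos: "\<xi> > 0" "\<rho> > 0"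
  shows "\<exists>\<xi>'>0. \<exists>\<rho>'>0. removable I (\<lambda>H \<eta>. drop_small H \<eta> i) \<xi> \<rho> \<xi>' \<rho>'"
proof -
  obtain \<gamma> \<eta>D where gd: "\<gamma> > 0" "\<eta>D > 0" and R': "\<And>H. valid P H \<Longrightarrow>
     (\<exists>H' D. valid P H' \<and> mean (samplers H' H) D \<and> faithful H' H D \<and> (\<forall>i\<in>P. spreads H' H D i \<eta>D (\<rho> / 3)) \<and>
       (\<forall>g F N. finite N \<longrightarrow> p - \<gamma> \<le> blind_val H (insert i I) g N F \<longrightarrow>
          p - \<xi> / 4 \<le> D (\<lambda>s. val P H' (insert i I) (pull s g) (\<lambda>x. of_bool (F (sim s x) = Free)))))"
    using R[unfolded robust_def, rule_format, of "\<xi> / 4" "\<rho> / 3"] pos by auto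
  (* The total distance from p that the claim for insert i I can absorb. *)
  define \<kappa> where "\<kappa> = \<gamma> * \<xi> / 4"
  have \<kappa>: "\<kappa> > 0" using gd pos by (simp add: \<kappa>_def)
  define a where "a = \<eta>D * \<rho> / 3"
  have a: "a > 0" using gd pos by (simp add: a_def)
  have "eventually (\<lambda>x. sqrt (6 / sqrt x) < a \<and> real (card P) / (2 * sqrt x) < \<kappa> / 4) at_top"
  proof (rule eventually_conj)
    have "((\<lambda>x::real. sqrt (6 / sqrt x)) \<longlongrightarrow> 0) at_top" by real_asymp
    then show "eventually (\<lambda>x. sqrt (6 / sqrt x) < a) at_top" using a by (rule order_tendstoD)
    have "((\<lambda>x::real. real (card P) / (2 * sqrt x)) \<longlongrightarrow> 0) at_top" by real_asymp
    then show "eventually (\<lambda>x. real (card P) / (2 * sqrt x) < \<kappa> / 4) at_top"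
      by (rule order_tendstoD) (use \<kappa> in simp)
  qed
  then obtain m :: nat where m: "even m" "m \<ge> 2" "sqrt (6 / sqrt m) < a" "real (card P) / (2 * sqrt m) < \<kappa> / 4"
    using choose_even by blast
  (* The hats seen by player i; its configurations are the lines in direction i. *)
  define E where "E = (\<lambda>j. if j \<in> P - {i} then {..<m} else {})"
  define k where "k = real (card (configs E))"
  have vE: "valid P E" by (auto simp: valid_def E_def)
  have k: "k \<ge> 1" using finite_configs[OF finP vE] configs_ne[of E] by (simp add: k_def card_gt_0_iff Suc_leI)
  define b where "b = \<kappa>\<^sup>2 * \<xi> / (16 * k\<^sup>2)"
  have b: "b > 0" using \<kappa> pos k by (simp add: b_def)
  have "eventually (\<lambda>x. sqrt (6 / sqrt x) * ln x < b \<and> x \<ge> real m) at_top"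
  proof (rule eventually_conj)
    have "((\<lambda>x::real. sqrt (6 / sqrt x) * ln x) \<longlongrightarrow> 0) at_top" by real_asymp
    then show "eventually (\<lambda>x. sqrt (6 / sqrt x) * ln x < b) at_top" using b by (rule order_tendstoD)
  qed (rule eventually_ge_at_top)
  then obtain M :: nat where M: "even M" "M \<ge> 2" "sqrt (6 / sqrt M) * ln M < b" "M \<ge> m"
    using choose_even by (metis (no_types, lifting) of_nat_le_iff)
  have lnM: "ln (real M) > 0" using M(2) by simp
  define K where "K = (\<lambda>j. if j = i then {..<M} else if j \<in> P then {..<m} else {})"
  have vK: "valid P K" using i by (auto simp: valid_def K_def)
  have K: "\<And>j. j \<in> P \<Longrightarrow> K j \<noteq> {}" "\<And>j. j \<in> P \<Longrightarrow> even (card (K j))"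
    using m(1,2) M(1,2) by (auto simp: K_def lessThan_empty_iff)
  have Km: "real (card (K j)) \<ge> m" if "j \<in> P" for j using that M(4) by (auto simp: K_def)
  have Ki: "card (K i) = M" by (simp add: K_def)
  have KE: "K(i := {}) = E" by (auto simp: K_def E_def fun_eq_iff)
  have m0: "real m > 0" using m(2) by simp
  define \<zeta> where "\<zeta> = 3 / sqrt M"
  have \<zeta>: "\<zeta> > 0" using M(2) by (simp add: \<zeta>_def)
  (* With this parameter of the maximal inequality its first term is \<kappa>/4, and \<tau> makes the second one \<kappa>/4. *)
  define l where "l = 4 * k * ln M / \<kappa>"
  have l: "l > 0" using k lnM \<kappa> by (simp add: l_def)
  define \<tau> where "\<tau> = 2 * \<kappa> / l"
  have \<tau>: "\<tau> > 0" using \<kappa> l by (simp add: \<tau>_def)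
  define \<beta> where "\<beta> = b / ln M"
  have \<beta>: "\<beta> > 0" using b lnM by (simp add: \<beta>_def)
  define \<rho>' where "\<rho>' = \<zeta> * min \<beta> a"
  have \<rho>': "\<rho>' > 0" "\<rho>' / \<zeta> \<le> \<beta>" "\<rho>' / \<zeta> \<le> a" using \<zeta> \<beta> a by (simp_all add: \<rho>'_def)
  have sq: "sqrt (\<zeta> + 3 / sqrt (card (K j))) \<le> sqrt (6 / sqrt m)" if j: "j \<in> P" for j
  proof -
    have "3 / sqrt M \<le> 3 / sqrt m" "3 / sqrt (card (K j)) \<le> 3 / sqrt m"
      using M(4) Km[OF j] m0 by (intro divide_left_mono; simp)+
    then show ?thesis by (simp add: \<zeta>_def)
  qed
  have sqi: "sqrt (\<zeta> + 3 / sqrt (card (K i))) \<le> \<beta>"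
    using M(3) lnM by (simp add: Ki \<zeta>_def \<beta>_def field_simps)
  have eps: "(\<Sum>j\<in>P. 1 / (2 * sqrt (card (K j)))) \<le> \<kappa> / 4"
  proof -
    have "(\<Sum>j\<in>P. 1 / (2 * sqrt (card (K j)))) \<le> (\<Sum>j\<in>P. 1 / (2 * sqrt m))"
    proof (rule sum_mono)
      fix j assume "j \<in> P"
      then have "real (card (K j)) \<ge> m" by (rule Km)
      then show "1 / (2 * sqrt (card (K j))) \<le> 1 / (2 * sqrt m)" using m0 by (simp add: frac_le)
    qed
    also have "\<dots> = real (card P) / (2 * sqrt m)" by simp
    finally show ?thesis using m(4) by simp
  qed
  have dev: "ln (card (responses K i)) / l + l * \<tau> / 8 \<le> \<kappa> / 2"
  proof -
    have "ln (real (card (responses K i))) = k * ln M"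
      using M(2) by (simp add: card_responses[OF vK] Ki KE k_def ln_realpow)
    then have "ln (card (responses K i)) / l = \<kappa> / 4" using k lnM \<kappa> by (simp add: l_def field_simps)
    moreover have "l * \<tau> / 8 = \<kappa> / 4" using l by (simp add: \<tau>_def)
    ultimately show ?thesis by linarith
  qed
  have mass: "k / \<tau> * (2 * \<beta>) \<le> \<xi> / 4"
    using k lnM \<kappa> by (simp add: \<tau>_def l_def \<beta>_def b_def field_simps power2_eq_square)
  obtain H2 DK where v2: "valid P H2" and DK: "mean (samplers H2 K) DK" "faithful H2 K DK" "\<forall>i\<in>P. spreads H2 K DK i \<eta>D (\<rho> / 3)"
    and good: "\<And>g F N. finite N \<Longrightarrow> p - \<gamma> \<le> blind_val K (insert i I) g N F \<Longrightarrow>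
          p - \<xi> / 4 \<le> DK (\<lambda>s. val P H2 (insert i I) (pull s g) (\<lambda>x. of_bool (F (sim s x) = Free)))"
    using R'[OF vK] by blast
  have "removable I (\<lambda>H \<eta>. drop_small H \<eta> i) \<xi> \<rho> (\<kappa> / 4) \<rho>'"
    unfolding removable_def
  proof (intro allI impI)
    fix H H1 D \<eta>
    assume v: "valid P H" and v1: "valid P H1" and D: "mean (samplers H1 H) D" "faithful H1 H D"
      and sp: "\<forall>j\<in>P. spreads H1 H D j \<eta> \<rho>'" and \<eta>: "0 \<le> \<eta>"
    let ?rh = "random_hats K H1"
    have rh: "mean (samplers K H1) ?rh" "faithful K H1 ?rh"
      "\<And>j. j \<in> P \<Longrightarrow> spreads K H1 ?rh j \<zeta> (sqrt (\<zeta> + 3 / sqrt (card (K j))))"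
      using mean_random_hats[OF v1 vK] random_hats_faithful[OF v1 vK] random_hats_spreads[OF v1 vK] K \<zeta> by auto
    let ?S = "bind_sampler D ?rh"
    have S: "mean (samplers K H) ?S" "faithful K H ?S"
      by (auto intro: mean_bind_sampler[OF D(1) rh(1)] faithful_bind[OF D rh(2)])
    have Ssp: "spreads K H ?S j \<eta> (\<rho>' / \<zeta> + sqrt (\<zeta> + 3 / sqrt (card (K j))))" if j: "j \<in> P" for j
      by (rule spreads_bind[OF v v1 vK D(1) rh(1) rh(2) sp[rule_format, OF j] rh(3)[OF j] \<zeta>])
    have Si: "spreads K H ?S i \<eta> (2 * \<beta>)"
      by (rule spreads_mono[OF Ssp[OF i(1)]]) (use \<rho>' sqi in simp)
    let ?D2 = "bind_sampler ?S DK"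
    have D2: "mean (samplers H2 H) ?D2" "faithful H2 H ?D2"
      by (auto intro: mean_bind_sampler[OF S(1) DK(1)] faithful_bind[OF S DK(2)])
    have D2sp: "spreads H2 H ?D2 j \<eta> \<rho>" if j: "j \<in> P" for j
    proof (rule spreads_mono)
      show "spreads H2 H ?D2 j \<eta> ((\<rho>' / \<zeta> + sqrt (\<zeta> + 3 / sqrt (card (K j)))) / \<eta>D + \<rho> / 3)"
        by (rule spreads_bind[OF v vK v2 S(1) DK(1,2) Ssp[OF j] DK(3)[rule_format, OF j] gd(2)])
      have "\<rho>' / \<zeta> + sqrt (\<zeta> + 3 / sqrt (card (K j))) \<le> a + a"
        using \<rho>'(3) sq[OF j] m(3) by linarith
      then have "(\<rho>' / \<zeta> + sqrt (\<zeta> + 3 / sqrt (card (K j)))) / \<eta>D \<le> (a + a) / \<eta>D"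
        using gd by (intro divide_right_mono) auto
      also have "(a + a) / \<eta>D = 2 * \<rho> / 3" using gd by (simp add: a_def)
      finally show "(\<rho>' / \<zeta> + sqrt (\<zeta> + 3 / sqrt (card (K j)))) / \<eta>D + \<rho> / 3 \<le> \<rho>" by linarith
    qed
    have "p - \<xi> \<le> ?D2 (\<lambda>s. blind_val H2 I (pull s g) N (\<lambda>x. drop_small H \<eta> i F (sim s x)))"
      if N: "finite N" and near: "p - \<kappa> / 4 \<le> D (\<lambda>s. blind_val H1 I (pull s g) N (\<lambda>x. F (sim s x)))" for g F N
    proof -
      let ?\<epsilon> = "\<Sum>j\<in>P. 1 / (2 * sqrt (card (K j)))" and ?dev = "ln (card (responses K i)) / l + l * \<tau> / 8"
      have "\<kappa> / 4 + ?\<epsilon> + ?dev \<le> \<kappa>" using eps dev by linarith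
      then have "(\<kappa> / 4 + ?\<epsilon> + ?dev) / \<gamma> \<le> \<kappa> / \<gamma>" using gd by (intro divide_right_mono) simp_all
      also have "\<dots> = \<xi> / 4" using gd by (simp add: \<kappa>_def)
      finally have 1: "(\<kappa> / 4 + ?\<epsilon> + ?dev) / \<gamma> \<le> \<xi> / 4" .
      have "p - \<xi> / 4 - (\<kappa> / 4 + ?\<epsilon> + ?dev) / \<gamma> - card (configs (K(i := {}))) / \<tau> * (2 * \<beta>)
         \<le> ?D2 (\<lambda>s. blind_val H2 I (pull s g) N (\<lambda>x. drop_small H \<eta> i F (sim s x)))"
        by (rule remove_light[OF v v1 vK v2 K D(1) DK(1,2) i \<tau> l gd(1) _ good[OF N] N near Si \<eta>]) (use pos in auto)
      moreover have "card (configs (K(i := {}))) / \<tau> * (2 * \<beta>) \<le> \<xi> / 4" using mass by (simp add: KE k_def)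
      ultimately show ?thesis using 1 pos by linarith
    qed
    then show "\<exists>H2 D2. valid P H2 \<and> mean (samplers H2 H) D2 \<and> faithful H2 H D2 \<and> (\<forall>j\<in>P. spreads H2 H D2 j \<eta> \<rho>) \<and>
        (\<forall>g F N. finite N \<longrightarrow> p - \<kappa> / 4 \<le> D (\<lambda>s. blind_val H1 I (pull s g) N (\<lambda>x. F (sim s x))) \<longrightarrow>
           p - \<xi> \<le> D2 (\<lambda>s. blind_val H2 I (pull s g) N (\<lambda>x. drop_small H \<eta> i F (sim s x))))"
      using v2 D2 D2sp by blast
  qed
  then show ?thesis using \<kappa> \<rho>'(1) by (intro exI[of _ "\<kappa> / 4"] exI[of _ \<rho>'] conjI) auto
qed

lemma robust_steps:
  assumes "\<And>i. i \<in> set is \<Longrightarrow> robust (insert i I)" "set is \<subseteq> P - I" and "\<xi> > 0" "\<rho> > 0"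
  shows "\<exists>\<xi>'>0. \<exists>\<rho>'>0. removable I (\<lambda>H \<eta>. drop_smalls H \<eta> is) \<xi> \<rho> \<xi>' \<rho>'"
  using assms(1,2)
proof (induction "is")
  case Nil
  have "removable I (\<lambda>H \<eta>. drop_smalls H \<eta> []) \<xi> \<rho> \<xi> \<rho>" unfolding removable_def by auto
  then show ?case using assms(3,4) by blast
next
  case (Cons i "is")
  obtain \<xi>1 \<rho>1 where 1: "\<xi>1 > 0" "\<rho>1 > 0" "removable I (\<lambda>H \<eta>. drop_smalls H \<eta> is) \<xi> \<rho> \<xi>1 \<rho>1"
    using Cons by auto
  obtain \<xi>2 \<rho>2 where 2: "\<xi>2 > 0" "\<rho>2 > 0" "removable I (\<lambda>H \<eta>. drop_small H \<eta> i) \<xi>1 \<rho>1 \<xi>2 \<rho>2"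
    using robust_step[of i I \<xi>1 \<rho>1] Cons.prems 1 by auto
  have "removable I (\<lambda>H \<eta>. drop_smalls H \<eta> (i # is)) \<xi> \<rho> \<xi>2 \<rho>2"
    unfolding removable_def
  proof (intro allI impI)
    fix H H1 D \<eta>
    assume v: "valid P H" and v1: "valid P H1" and D: "mean (samplers H1 H) D" "faithful H1 H D"
      and sp: "\<forall>j\<in>P. spreads H1 H D j \<eta> \<rho>2" and \<eta>: "0 \<le> \<eta>"
    obtain H2 D2 where v2: "valid P H2" and D2: "mean (samplers H2 H) D2" "faithful H2 H D2" "\<forall>j\<in>P. spreads H2 H D2 j \<eta> \<rho>1"
      and a: "\<And>g F N. finite N \<Longrightarrow> p - \<xi>2 \<le> D (\<lambda>s. blind_val H1 I (pull s g) N (\<lambda>x. F (sim s x))) \<Longrightarrow>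
           p - \<xi>1 \<le> D2 (\<lambda>s. blind_val H2 I (pull s g) N (\<lambda>x. drop_small H \<eta> i F (sim s x)))"
      using 2(3)[unfolded removable_def, rule_format, OF v v1 D sp[rule_format] \<eta>] by blast
    obtain H3 D3 where v3: "valid P H3" and D3: "mean (samplers H3 H) D3" "faithful H3 H D3" "\<forall>j\<in>P. spreads H3 H D3 j \<eta> \<rho>"
      and b: "\<And>g F N. finite N \<Longrightarrow> p - \<xi>1 \<le> D2 (\<lambda>s. blind_val H2 I (pull s g) N (\<lambda>x. F (sim s x))) \<Longrightarrow>
           p - \<xi> \<le> D3 (\<lambda>s. blind_val H3 I (pull s g) N (\<lambda>x. drop_smalls H \<eta> is F (sim s x)))"
      using 1(3)[unfolded removable_def, rule_format, OF v v2 D2(1,2) D2(3)[rule_format] \<eta>] by blast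
    show "\<exists>H2 D2. valid P H2 \<and> mean (samplers H2 H) D2 \<and> faithful H2 H D2 \<and> (\<forall>j\<in>P. spreads H2 H D2 j \<eta> \<rho>) \<and>
        (\<forall>g F N. finite N \<longrightarrow> p - \<xi>2 \<le> D (\<lambda>s. blind_val H1 I (pull s g) N (\<lambda>x. F (sim s x))) \<longrightarrow>
           p - \<xi> \<le> D2 (\<lambda>s. blind_val H2 I (pull s g) N (\<lambda>x. drop_smalls H \<eta> (i # is) F (sim s x))))"
      using v3 D3 a b unfolding drop_smalls.simps by blast
  qed
  then show ?case using 2 by blast
qed

text \<open>
  Colours that are big for given stacks of the blind players are removed first, by conditioning, and then the
  colours that are small in some direction outside \<open>I\<close>. The threshold \<open>a\<close> of the first removal is half
  of the measure that a colour must have to survive the others. It depends only on \<open>\<eta>\<close> and the number of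
  players outside \<open>I\<close>, so \<open>\<gamma>\<close> can absorb the factor lost in conditioning.
\<close>
lemma robust_down:
  assumes I: "I \<subset> P" and R: "\<And>i. i \<in> P - I \<Longrightarrow> robust (insert i I)"
  shows "robust I"
  unfolding robust_def
proof (intro allI impI)
  fix \<xi> \<rho> :: real assume pos: "0 < \<xi>" "0 < \<rho>"
  have "finite (P - I)" using finP by simp
  then obtain "is" where is_: "set is = P - I" "distinct is" using finite_distinct_list by blast
  obtain \<xi>' \<eta> where L: "\<xi>' > 0" "\<eta> > 0" "removable I (\<lambda>H \<eta>. drop_smalls H \<eta> is) \<xi> \<rho> \<xi>' \<eta>"
    using robust_steps[of "is" I \<xi> \<rho>] R pos is_ by auto
  define a where "a = \<eta> ^ length is / 2"
  have a: "a > 0" using L by (simp add: a_def)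
  define \<gamma> where "\<gamma> = \<xi>' / 2 powr (1 / a)"
  have \<gamma>: "\<gamma> > 0" using L by (simp add: \<gamma>_def)
  have "\<exists>H' D. valid P H' \<and> mean (samplers H' H) D \<and> faithful H' H D \<and> (\<forall>i\<in>P. spreads H' H D i \<eta> \<rho>) \<and>
       (\<forall>g F N. finite N \<longrightarrow> p - \<gamma> \<le> blind_val H I g N F \<longrightarrow>
          p - \<xi> \<le> D (\<lambda>s. val P H' I (pull s g) (\<lambda>x. of_bool (F (sim s x) = Free))))" if v: "valid P H" for H
  proof -
    obtain H2 D2 where v2: "valid P H2" and D2: "mean (samplers H2 H) D2" "faithful H2 H D2" "\<forall>j\<in>P. spreads H2 H D2 j \<eta> \<rho>"
      and b: "\<And>g F N. finite N \<Longrightarrow> p - \<xi>' \<le> blind_val H I (pull id_sampler g) N F \<Longrightarrow>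
           p - \<xi> \<le> D2 (\<lambda>s. blind_val H2 I (pull s g) N (\<lambda>x. drop_smalls H \<eta> is F (sim s x)))"
      using L(3)[unfolded removable_def, rule_format, OF v v mean_id_sampler faithful_id_sampler spreads_id_sampler[OF v]] L(2)
      unfolding sim_id_sampler by auto
    have "p - \<xi> \<le> D2 (\<lambda>s. val P H2 I (pull s g) (\<lambda>x. of_bool (F (sim s x) = Free)))"
      if N: "finite N" and B: "p - \<gamma> \<le> blind_val H I g N F" for g F N
    proof -
      note mN = mean_Pow[OF N]
      let ?F = "drop_big H I a F"
      have "p - \<xi>' \<le> blind_val H I g N ?F"
        using blind_val_drop_big[OF v N a B] by (simp add: \<gamma>_def)
      also have "\<dots> \<le> blind_val H I (pull id_sampler g) N ?F"
        unfolding blind_val_def by (intro mean_mono[OF mN] val_id_sampler[OF v])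
      finally have 1: "p - \<xi> \<le> D2 (\<lambda>s. blind_val H2 I (pull s g) N (\<lambda>x. drop_smalls H \<eta> is ?F (sim s x)))"
        by (rule b[OF N])
      have small: "avg (configs H) (\<lambda>z. of_bool (?F (mix (- set is) x z) = Col c)) < \<eta> ^ length is" if x: "x \<in> configs H" for x c
      proof -
        have "avg (configs H) (\<lambda>z. of_bool (?F (mix (- set is) x z) = Col c)) = avg (configs H) (\<lambda>z. of_bool (?F (mix I x z) = Col c))"
        proof (rule mean_cong[OF mean_configs[OF v]])
          fix z assume z: "z \<in> configs H"
          have "x j = z j" if "j \<notin> P" for j using configs_sub[OF x, of j] configs_sub[OF z, of j] v that by (auto simp: valid_def)
          then have "mix (- set is) x z = mix I x z" using I by (auto simp: mix_def is_ fun_eq_iff)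
          then show "of_bool (?F (mix (- set is) x z) = Col c) = (of_bool (?F (mix I x z) = Col c) :: real)" by simp
        qed
        also have "\<dots> \<le> a" by (rule drop_big_small[OF v _ x]) (use a in simp)
        also have "a < \<eta> ^ length is" using L by (simp add: a_def)
        finally show ?thesis .
      qed
      have none: "drop_smalls H \<eta> is ?F x \<noteq> Col c" if "x \<in> configs H" for x c
        by (rule drop_smalls_none[OF v is_(2) L(2) small that])
      have "D2 (\<lambda>s. blind_val H2 I (pull s g) N (\<lambda>x. drop_smalls H \<eta> is ?F (sim s x)))
         = D2 (\<lambda>s. val P H2 I (pull s g) (\<lambda>x. of_bool (F (sim s x) = Free)))"
      proof (rule mean_cong[OF D2(1)])
        fix s assume s: "s \<in> samplers H2 H"
        have "live (\<lambda>x. drop_smalls H \<eta> is ?F (sim s x)) y x = of_bool (F (sim s x) = Free)" if x: "x \<in> configs H2" for y x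
          using none[OF sim_configs[OF s x]] drop_smalls_Free[of H \<eta> "is" ?F "sim s x"] drop_big_Free[of H I a F "sim s x"]
          by (auto simp: live_def split: label.split)
        then have "blind_val H2 I (pull s g) N (\<lambda>x. drop_smalls H \<eta> is ?F (sim s x))
          = avg (Pow N) (\<lambda>y. val P H2 I (pull s g) (\<lambda>x. of_bool (F (sim s x) = Free)))"
          unfolding blind_val_def by (intro mean_cong[OF mN] val_cong[OF v2]) auto
        then show "blind_val H2 I (pull s g) N (\<lambda>x. drop_smalls H \<eta> is ?F (sim s x))
          = val P H2 I (pull s g) (\<lambda>x. of_bool (F (sim s x) = Free))" by (simp add: mean_const[OF mN])
      qed
      then show ?thesis using 1 by simp
    qed
    then show ?thesis using v2 D2 by blast
  qed
  then show "\<exists>\<gamma>>0. \<exists>\<eta>>0. \<forall>H. valid P H \<longrightarrow>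
     (\<exists>H' D. valid P H' \<and> mean (samplers H' H) D \<and> faithful H' H D \<and> (\<forall>i\<in>P. spreads H' H D i \<eta> \<rho>) \<and>
       (\<forall>g F N. finite N \<longrightarrow> p - \<gamma> \<le> blind_val H I g N F \<longrightarrow>
          p - \<xi> \<le> D (\<lambda>s. val P H' I (pull s g) (\<lambda>x. of_bool (F (sim s x) = Free)))))"
    using \<gamma> L(2) by blast
qed

lemma robust: "I \<subseteq> P \<Longrightarrow> robust I"
proof (induction "card (P - I)" arbitrary: I rule: less_induct)
  case less
  show ?case
  proof (cases "I = P")
    case True then show ?thesis using robust_all by simp
  next
    case False
    show ?thesis
    proof (rule robust_down)
      show "I \<subset> P" using less False by auto
      fix i assume i: "i \<in> P - I"
      have "card (P - insert i I) < card (P - I)" using i finP by (intro psubset_card_mono) auto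
      then show "robust (insert i I)" using less i by auto
    qed
  qed
qed

text \<open>
  Without uncoloured configurations nothing is left after the removal of all colours, so the value cannot be
  close to \<open>p\<close>.
\<close>
theorem blind_val_gap:
  assumes "p > 0"
  shows "\<exists>\<gamma>>0. \<forall>H N F g. valid P H \<longrightarrow> finite N \<longrightarrow> (\<forall>x. F x \<noteq> Free) \<longrightarrow> blind_val H {} g N F < p - \<gamma>"
proof -
  obtain \<gamma> \<eta> where g: "\<gamma> > 0" and r: "\<And>H. valid P H \<Longrightarrow>
     (\<exists>H' D. valid P H' \<and> mean (samplers H' H) D \<and> faithful H' H D \<and> (\<forall>i\<in>P. spreads H' H D i \<eta> 1) \<and>
       (\<forall>g F N. finite N \<longrightarrow> p - \<gamma> \<le> blind_val H {} g N F \<longrightarrow>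
          p - p / 2 \<le> D (\<lambda>s. val P H' {} (pull s g) (\<lambda>x. of_bool (F (sim s x) = Free)))))"
    using robust[of "{}", unfolded robust_def, rule_format, of "p / 2" 1] assms by auto
  have "blind_val H {} g N F < p - \<gamma>" if v: "valid P H" "finite N" and F: "\<forall>x. F x \<noteq> Free" for H N F g
  proof (rule ccontr)
    assume "\<not> ?thesis"
    then obtain H' D where v': "valid P H'" and D: "mean (samplers H' H) D"
      and le: "p - p / 2 \<le> D (\<lambda>s. val P H' {} (pull s g) (\<lambda>x. of_bool (F (sim s x) = Free)))"
      using r[OF v(1)] v(2) by (meson not_less)
    have "val P H' {} (pull s g) (\<lambda>x. of_bool (F (sim s x) = Free)) \<le> 0" for s
    proof -
      obtain f where "val P H' {} (pull s g) (\<lambda>x. of_bool (F (sim s x) = Free)) = success P H' f (\<lambda>x. of_bool (F (sim s x) = Free))"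
        by (rule val_attained[OF v', of "{}" "pull s g" "\<lambda>x. of_bool (F (sim s x) = Free)"])
      then show ?thesis using F by (simp add: success_def mean_const[OF mean_configs[OF v']])
    qed
    then have "D (\<lambda>s. val P H' {} (pull s g) (\<lambda>x. of_bool (F (sim s x) = Free))) \<le> 0" by (intro mean_le[OF D])
    then show False using le assms by simp
  qed
  then show ?thesis using g by blast
qed

end

section \<open>The hat game of the definitions\<close>

definition hats :: "nat \<Rightarrow> nat \<Rightarrow> config" where
  "hats t n = (\<lambda>j. if j \<in> {1..t} then {..<n} else {})"

definition stack_of :: "nat \<Rightarrow> nat \<Rightarrow> config \<Rightarrow> nat \<Rightarrow> nat \<Rightarrow> nat" where
  "stack_of t n u = (\<lambda>j\<in>{1..t}. \<lambda>k\<in>{1..n}. if k - 1 \<in> u j then 1 else 0)"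

lemma stack_of_apply:
  "j \<in> {1..t} \<Longrightarrow> k \<in> {1..n} \<Longrightarrow> stack_of t n u j k = (if k - 1 \<in> u j then 1 else 0)"
  unfolding stack_of_def by (simp only: restrict_apply if_True)

lemma valid_hats: "valid {1..t} (hats t n)" by (auto simp: valid_def hats_def)

lemma stack_of_bij: "bij_betw (stack_of t n) (configs (hats t n)) (stacks_of {1..t} n)"
proof (rule bij_betw_byWitness[where f' = "\<lambda>x j. if j \<in> {1..t} then {a. a < n \<and> x j (Suc a) = 1} else {}"])
  show "\<forall>u\<in>configs (hats t n). (\<lambda>j. if j \<in> {1..t} then {a. a < n \<and> stack_of t n u j (Suc a) = 1} else {}) = u"
  proof
    fix u assume u: "u \<in> configs (hats t n)"
    show "(\<lambda>j. if j \<in> {1..t} then {a. a < n \<and> stack_of t n u j (Suc a) = 1} else {}) = u"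
    proof
      fix j show "(if j \<in> {1..t} then {a. a < n \<and> stack_of t n u j (Suc a) = 1} else {}) = u j"
        using configs_sub[OF u, of j] by (auto simp: hats_def stack_of_def split: if_splits)
    qed
  qed
  show "\<forall>x\<in>stacks_of {1..t} n. stack_of t n (\<lambda>j. if j \<in> {1..t} then {a. a < n \<and> x j (Suc a) = 1} else {}) = x"
  proof
    fix x assume x: "x \<in> stacks_of {1..t} n"
    show "stack_of t n (\<lambda>j. if j \<in> {1..t} then {a. a < n \<and> x j (Suc a) = 1} else {}) = x"
    proof
      fix j
      show "stack_of t n (\<lambda>j. if j \<in> {1..t} then {a. a < n \<and> x j (Suc a) = 1} else {}) j = x j"
      proof (cases "j \<in> {1..t}")
        case True
        then have xj: "x j \<in> {1..n} \<rightarrow>\<^sub>E {0, 1}" using x by (auto simp: stacks_of_def stacks_def PiE_iff)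
        show ?thesis
        proof
          fix k show "stack_of t n (\<lambda>j. if j \<in> {1..t} then {a. a < n \<and> x j (Suc a) = 1} else {}) j k = x j k"
            using True PiE_mem[OF xj, of k] PiE_arb[OF xj, of k] by (auto simp: stack_of_def)
        qed
      next
        case False
        then have "x j = undefined" using x by (auto simp: stacks_of_def PiE_iff extensional_def)
        then show ?thesis using False by (simp only: stack_of_def restrict_apply if_False)
      qed
    qed
  qed
  show "stack_of t n ` configs (hats t n) \<subseteq> stacks_of {1..t} n"
    by (auto simp: stack_of_def stacks_of_def stacks_def split: if_splits)
  show "(\<lambda>x j. if j \<in> {1..t} then {a. a < n \<and> x j (Suc a) = 1} else {}) ` stacks_of {1..t} n \<subseteq> configs (hats t n)"
    by (auto simp: configs_def hats_def split: if_splits)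
qed

lemma success_prob_avg: "success_prob t n f = avg (configs (hats t n)) (\<lambda>u. of_bool (wins t f (stack_of t n u)))"
proof -
  have "success_prob t n f = avg (stacks_of {1..t} n) (\<lambda>x. of_bool (wins t f x))"
    unfolding success_prob_card avg_def using finite_stacks_of[of "{1..t}" n]
    by (simp add: of_bool_def sum.If_cases Collect_conj_eq Int_commute)
  then show ?thesis by (simp only: avg_bij[OF stack_of_bij])
qed

lemma opt_le_limit: assumes "n \<ge> 1" shows "opt_prob t n \<le> limit_prob t"
  by (rule LIMSEQ_le_const[OF opt_prob_tendsto]) (use opt_prob_mono[OF assms] in blast)

lemma avg_restrict_hats:
  assumes "\<And>j. H j \<subseteq> H' j" "\<And>j. finite (H' j)" "finite (configs H)" "finite (configs H')"
  shows "avg (configs H) g = avg (configs H') (\<lambda>u. g (\<lambda>j. u j \<inter> H j))"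
proof -
  let ?R = "configs (\<lambda>j. H' j - H j)"
  have "bij_betw (\<lambda>(x, y) j. x j \<union> y j) (configs H \<times> ?R) (configs H')"
    by (rule bij_betw_byWitness[where f' = "\<lambda>u. (\<lambda>j. u j \<inter> H j, \<lambda>j. u j - H j)"])
       (use assms(1) in \<open>fastforce simp: configs_def Pi_def fun_eq_iff\<close>)+
  from avg_bij[OF this, of "\<lambda>u. g (\<lambda>j. u j \<inter> H j)"]
  have "avg (configs H') (\<lambda>u. g (\<lambda>j. u j \<inter> H j)) = avg (configs H) (\<lambda>x. avg ?R (\<lambda>y. g (\<lambda>j. (x j \<union> y j) \<inter> H j)))"
    unfolding avg_prod by (simp add: case_prod_beta')
  also have "\<dots> = avg (configs H) (\<lambda>x. avg ?R (\<lambda>y. g x))"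
  proof -
    have "?R \<subseteq> configs H'" by (auto simp: configs_def)
    then have m: "mean ?R (avg ?R)" using assms(4) finite_subset by (intro mean_avg configs_ne) blast
    have mm: "mean (configs H) (avg (configs H))" by (intro mean_avg configs_ne assms)
    have "(\<lambda>j. (x j \<union> y j) \<inter> H j) = x" if "x \<in> configs H" "y \<in> ?R" for x y
      using configs_sub[OF that(1)] configs_sub[OF that(2)] by (auto simp: fun_eq_iff)
    then show ?thesis by (intro mean_cong[OF mm] mean_cong[OF m]) simp
  qed
  also have "\<dots> = avg (configs H) g"
  proof -
    have "?R \<subseteq> configs H'" by (auto simp: configs_def)
    then have m: "mean ?R (avg ?R)" using assms(4) finite_subset by (intro mean_avg configs_ne) blast
    show ?thesis by (simp add: mean_const[OF m])
  qed
  finally show ?thesis by simp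
qed

text \<open>
  A game with stacks of different sizes embeds into one with equally many hats for everybody, where
  the additional hats are ignored.
\<close>
lemma win_le_limit:
  assumes v: "valid {1..t} H"
  shows "avg (configs H) (\<lambda>x. of_bool (win {1..t} f x)) \<le> limit_prob t"
proof -
  have "finite (\<Union>j\<in>{1..t}. H j)" using v by (auto simp: valid_def)
  then obtain n0 where n0': "\<forall>a\<in>(\<Union>j\<in>{1..t}. H j). a < n0" unfolding finite_nat_set_iff_bounded by blast
  have n0: "a < n0" if "a \<in> H j" "j \<in> {1..t}" for a j using n0' that by blast
  define n where "n = Suc n0"
  have H: "H j \<subseteq> hats t n j" for j
  proof (cases "j \<in> {1..t}")
    case True
    then have "hats t n j = {..<n}" by (simp add: hats_def)
    moreover have "a < n" if "a \<in> H j" for a using n0[OF that True] by (simp add: n_def)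
    ultimately show ?thesis by blast
  next
    case False
    then show ?thesis using v by (simp add: valid_def)
  qed
  define cv where "cv Q y = (\<lambda>j. if j \<in> Q then {a \<in> H j. y j (Suc a) = (1::nat)} else {})" for Q :: "nat set" and y
  define g where "g = (\<lambda>i\<in>{1..t}. \<lambda>y\<in>stacks_of (others t i) n. let a = f i (cv (others t i) y) in if a < n then Suc a else 1)"
  have g: "g \<in> strategies t n"
    unfolding strategies_def by (rule PiE_I) (auto simp: g_def Let_def n_def)
  have w: "wins t g (stack_of t n u)" if u: "u \<in> configs (hats t n)" and win: "win {1..t} f (\<lambda>j. u j \<inter> H j)" for u
    unfolding wins_def
  proof
    fix i assume i: "i \<in> {1..t}"
    let ?y = "restrict (stack_of t n u) (others t i)"
    have x: "stack_of t n u \<in> stacks_of {1..t} n" using stack_of_bij u by (auto simp: bij_betw_def)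
    then have y: "?y \<in> stacks_of (others t i) n" by (auto simp: stacks_of_def others_def PiE_iff)
    have "cv (others t i) ?y j = ((\<lambda>j. u j \<inter> H j)(i := {})) j" for j
    proof (cases "j \<in> others t i")
      case True
      then have "j \<noteq> i" "j \<in> {1..t}" by (auto simp: others_def)
      have "stack_of t n u j (Suc a) = 1 \<longleftrightarrow> a \<in> u j" if "a \<in> H j" for a
      proof -
        have "a < n" using H[of j] that \<open>j \<in> {1..t}\<close> by (auto simp: hats_def)
        then show ?thesis using \<open>j \<in> {1..t}\<close> by (simp add: stack_of_def)
      qed
      then show ?thesis using True \<open>j \<noteq> i\<close> by (auto simp: cv_def)
    next
      case False
      then have "j = i \<or> H j = {}" using v by (auto simp: others_def valid_def)
      then show ?thesis using False by (auto simp: cv_def simp del: fun_upd_apply) (auto simp: fun_upd_apply split: if_splits)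
    qed
    then have e: "cv (others t i) ?y = (\<lambda>j. u j \<inter> H j)(i := {})" by (rule ext)
    let ?a = "f i ((\<lambda>j. u j \<inter> H j)(i := {}))"
    have a: "?a \<in> u i" "?a \<in> H i" using win i by (auto simp: win_def)
    then have "?a < n" using H[of i] by (auto simp: hats_def split: if_splits)
    then have "g i ?y = Suc ?a" unfolding g_def using i y by (simp only: restrict_apply if_True e Let_def)
    then show "stack_of t n u i (g i ?y) = 1" using i a(1) \<open>?a < n\<close> by (simp add: stack_of_def)
  qed
  have f1: "finite (configs H)" "finite (configs (hats t n))" by (rule finite_configs[OF finite_atLeastAtMost v], rule finite_configs[OF finite_atLeastAtMost valid_hats])
  have "avg (configs H) (\<lambda>x. of_bool (win {1..t} f x)) = avg (configs (hats t n)) (\<lambda>u. of_bool (win {1..t} f (\<lambda>j. u j \<inter> H j)))"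
    by (rule avg_restrict_hats[OF H _ f1]) (simp add: hats_def)
  also have "\<dots> \<le> avg (configs (hats t n)) (\<lambda>u. of_bool (wins t g (stack_of t n u)))"
    by (rule mean_mono[OF mean_avg[OF f1(2) configs_ne]]) (use w in auto)
  also have "\<dots> = success_prob t n g" by (rule success_prob_avg[symmetric])
  also have "\<dots> \<le> opt_prob t n" by (rule opt_prob_ge[OF g])
  also have "\<dots> \<le> limit_prob t" by (rule opt_le_limit) (simp add: n_def)
  finally show ?thesis .
qed

lemma opt_prob_le_1: "n \<ge> 1 \<Longrightarrow> opt_prob t n \<le> 1"
  using opt_prob_attained[of n t] by (auto simp: success_prob_def)

lemma limit_prob_pos: "limit_prob t > 0"
proof -
  define f where "f = (\<lambda>i\<in>{1..t}. \<lambda>y\<in>stacks_of (others t i) 1. 1::nat)"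
  have f: "f \<in> strategies t 1" unfolding strategies_def by (rule PiE_I) (auto simp: f_def)
  let ?x = "\<lambda>j\<in>{1..t}. \<lambda>k\<in>{1..1::nat}. 1::nat"
  have x: "?x \<in> stacks_of {1..t} 1" by (auto simp: stacks_of_def stacks_def)
  have "wins t f ?x"
    unfolding wins_def
  proof
    fix i assume i: "i \<in> {1..t}"
    have y: "restrict ?x (others t i) \<in> stacks_of (others t i) 1" using x by (auto simp: stacks_of_def others_def PiE_iff)
    have "f i (restrict ?x (others t i)) = 1" unfolding f_def using i y by (simp only: restrict_apply if_True)
    then show "?x i (f i (restrict ?x (others t i))) = 1" using i by simp
  qed
  then have "{x \<in> stacks_of {1..t} 1. wins t f x} \<noteq> {}" using x by blast
  then have "0 < success_prob t 1 f" using finite_stacks_of[of "{1..t}" 1] stacks_of_nonempty[of "{1..t}" 1]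
    by (auto simp: success_prob_card card_gt_0_iff)
  also have "\<dots> \<le> opt_prob t 1" by (rule opt_prob_ge[OF f])
  also have "\<dots> \<le> limit_prob t" by (rule opt_le_limit) simp
  finally show ?thesis .
qed

lemma hat_game_limit: "hat_game {1..t} (limit_prob t)"
proof
  show "limit_prob t \<le> 1"
    by (rule LIMSEQ_le_const2[OF opt_prob_tendsto]) (use opt_prob_le_1 in blast)
  show "avg (configs H) (\<lambda>x. of_bool (win {1..t} f x)) \<le> limit_prob t" if "valid {1..t} H" for H f
    by (rule win_le_limit[OF that])
qed simp

text \<open>
  The colour of a configuration is the hat of the last player; the strategies of the others, for a given stack \<open>y\<close>
  of the last player, are adapted to \<open>y\<close>, so nobody is blind.
\<close>
lemma success_prob_Suc_le:
  assumes f: "f \<in> strategies (t + 1) n"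
  shows "\<exists>F. (\<forall>x. F x \<noteq> Free) \<and> success_prob (t + 1) n f \<le> hat_game.blind_val {1..t} (hats t n) {} g {..<n} F"
proof -
  interpret hat_game "{1..t}" "limit_prob t" by (rule hat_game_limit)
  let ?S = "stack_of (t + 1) n" and ?l = "t + 1"
  define F where "F u = Col (f ?l (restrict (?S u) (others ?l ?l)) - 1)" for u
  have range: "f i (restrict (?S u) (others ?l i)) \<in> {1..n}" if i: "i \<in> {1..?l}" for i u
  proof -
    have "?S u j \<in> stacks n" if "j \<in> others ?l i" for j
    proof -
      have "j \<in> {1..?l}" using that by (simp add: others_def)
      then have "?S u j = (\<lambda>k\<in>{1..n}. if k - 1 \<in> u j then 1 else 0)" by (simp only: stack_of_def restrict_apply if_True)
      then show ?thesis by (simp add: stacks_def)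
    qed
    then have 1: "restrict (?S u) (others ?l i) \<in> stacks_of (others ?l i) n"
      unfolding stacks_of_def by (rule restrict_PiE_iff[THEN iffD2, rule_format])
    have "f i \<in> stacks_of (others ?l i) n \<rightarrow>\<^sub>E {1..n}" using f i unfolding strategies_def by (rule PiE_mem)
    then show ?thesis using 1 by (rule PiE_mem)
  qed
  have black: "?S u i (f i (restrict (?S u) (others ?l i))) = 1 \<longleftrightarrow> f i (restrict (?S u) (others ?l i)) - 1 \<in> u i"
    if i: "i \<in> {1..?l}" for i u
  proof -
    let ?k = "f i (restrict (?S u) (others ?l i))"
    have k: "?k \<in> {1..n}" by (rule range[OF i])
    have "?S u i ?k = (if ?k - 1 \<in> u i then 1 else 0)"
      by (rule stack_of_apply[OF i k])
    then show ?thesis by simp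
  qed
  have restr: "restrict (?S (u(i := w))) (others ?l i) = restrict (?S u) (others ?l i)" for u i w
  proof
    fix j
    have "?S (u(i := w)) j = ?S u j" if "j \<noteq> i" using that by (simp add: stack_of_def)
    then show "restrict (?S (u(i := w))) (others ?l i) j = restrict (?S u) (others ?l i) j"
      by (cases "j = i") (simp_all add: restrict_def others_def)
  qed
  define f' where "f' y i u = f i (restrict (?S (u(?l := y))) (others ?l i)) - 1" for y i u
  have key: "of_bool (wins ?l f (?S (u(?l := y)))) = of_bool (win {1..t} (f' y) u) * live F y u" for u y
  proof -
    have "wins ?l f (?S (u(?l := y))) \<longleftrightarrow> (\<forall>i\<in>{1..?l}. f i (restrict (?S (u(?l := y))) (others ?l i)) - 1 \<in> (u(?l := y)) i)"
      using black by (simp add: wins_def)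
    also have "\<dots> \<longleftrightarrow> f ?l (restrict (?S u) (others ?l ?l)) - 1 \<in> y \<and> (\<forall>i\<in>{1..t}. f' y i u \<in> u i)"
    proof -
      have "{1..?l} = insert ?l {1..t}" by auto
      then have "(\<forall>i\<in>{1..?l}. Q i) \<longleftrightarrow> Q ?l \<and> (\<forall>i\<in>{1..t}. Q i)" for Q :: "nat \<Rightarrow> bool" by (simp only: Set.ball_simps(7))
      moreover have "(u(?l := y)) i = u i" if "i \<in> {1..t}" for i using that by auto
      ultimately show ?thesis by (simp only: restr f'_def fun_upd_same cong: ball_cong)
    qed
    also have "(\<forall>i\<in>{1..t}. f' y i u \<in> u i) \<longleftrightarrow> win {1..t} (f' y) u"
    proof -
      have "f' y i (u(i := {})) = f' y i u" if "i \<in> {1..t}" for i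
      proof -
        have "u(i := {}, ?l := y) = (u(?l := y))(i := {})" using that by (auto simp: fun_eq_iff)
        then show ?thesis by (simp only: f'_def restr)
      qed
      then show ?thesis by (simp add: win_def)
    qed
    finally have "wins ?l f (?S (u(?l := y))) \<longleftrightarrow>
      f ?l (restrict (?S u) (others ?l ?l)) - 1 \<in> y \<and> win {1..t} (f' y) u" .
    moreover have "live F y u = of_bool (f ?l (restrict (?S u) (others ?l ?l)) - 1 \<in> y)"
      by (simp only: live_def F_def label.case)
    ultimately show ?thesis by (simp only: of_bool_conj mult.commute)
  qed
  have hs: "hats ?l n ?l = {..<n}" "hats t n ?l = {}" "\<And>j. j \<noteq> ?l \<Longrightarrow> hats ?l n j = hats t n j"
    by (auto simp: hats_def)
  have bij: "bij_betw (\<lambda>(y, u). u(?l := y)) (Pow {..<n} \<times> configs (hats t n)) (configs (hats ?l n))"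
  proof (rule bij_betw_byWitness[where f' = "\<lambda>u. (u ?l, u(?l := {}))"])
    have "(u(?l := y))(?l := {}) = u" if u: "u \<in> configs (hats t n)" for u y
      using configs_sub[OF u, of ?l] hs(2) by (auto simp: fun_eq_iff)
    then show "\<forall>a\<in>Pow {..<n} \<times> configs (hats t n). (\<lambda>u. (u ?l, u(?l := {}))) ((\<lambda>(y, u). u(?l := y)) a) = a" by auto
    show "\<forall>u\<in>configs (hats ?l n). (\<lambda>(y, u). u(?l := y)) (u ?l, u(?l := {})) = u" by simp
    have "u(?l := y) \<in> configs (hats ?l n)" if y: "y \<subseteq> {..<n}" and u: "u \<in> configs (hats t n)" for u y
    proof -
      have "(u(?l := y)) j \<subseteq> hats ?l n j" for j
        using y configs_sub[OF u, of j] hs(1,3) by (cases "j = ?l") simp_all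
      then show ?thesis by (simp only: configs_def Pi_def mem_Collect_eq Pow_iff) simp
    qed
    then show "(\<lambda>(y, u). u(?l := y)) ` (Pow {..<n} \<times> configs (hats t n)) \<subseteq> configs (hats ?l n)" by auto
    have "u(?l := {}) \<in> configs (hats t n)" if u: "u \<in> configs (hats ?l n)" for u
    proof -
      have "(u(?l := {})) j \<subseteq> hats t n j" for j
        using configs_sub[OF u, of j] hs(3) by (cases "j = ?l") simp_all
      then show ?thesis by (simp only: configs_def Pi_def mem_Collect_eq Pow_iff) simp
    qed
    moreover have "u ?l \<subseteq> {..<n}" if u: "u \<in> configs (hats ?l n)" for u
      using configs_sub[OF u, of ?l] hs(1) by simp
    ultimately show "(\<lambda>u. (u ?l, u(?l := {}))) ` configs (hats ?l n) \<subseteq> Pow {..<n} \<times> configs (hats t n)" by auto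
  qed
  have "success_prob ?l n f = avg (Pow {..<n}) (\<lambda>y. avg (configs (hats t n)) (\<lambda>u. of_bool (wins ?l f (?S (u(?l := y))))))"
    unfolding success_prob_avg avg_bij[OF bij] avg_prod by (simp add: case_prod_beta')
  also have "\<dots> = avg (Pow {..<n}) (\<lambda>y. success {1..t} (hats t n) (f' y) (live F y))" by (simp only: key success_def)
  also have "\<dots> \<le> blind_val (hats t n) {} g {..<n} F"
    unfolding blind_val_def by (intro mean_mono[OF mean_Pow] success_le_val valid_hats) auto
  finally show ?thesis by (intro exI[of _ F]) (simp add: F_def)
qed

theorem theorem1p2:
  fixes t :: nat
  assumes "t \<ge> 1"
  shows "limit_prob (t + 1) < limit_prob t"
proof -
  interpret hat_game "{1..t}" "limit_prob t" by (rule hat_game_limit)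
  obtain \<gamma> where \<gamma>: "\<gamma> > 0" and gap: "\<And>H N F g. valid {1..t} H \<Longrightarrow> finite N \<Longrightarrow> \<forall>x. F x \<noteq> Free \<Longrightarrow> blind_val H {} g N F < limit_prob t - \<gamma>"
    using blind_val_gap[OF limit_prob_pos] by blast
  have "opt_prob (t + 1) n \<le> limit_prob t - \<gamma>" if n: "n \<ge> 1" for n
  proof -
    obtain f where f: "f \<in> strategies (t + 1) n" "opt_prob (t + 1) n = success_prob (t + 1) n f"
      using opt_prob_attained[OF n] by blast
    obtain F where F: "\<forall>x. F x \<noteq> Free" "success_prob (t + 1) n f \<le> blind_val (hats t n) {} (\<lambda>_ _. 0) {..<n} F"
      using success_prob_Suc_le[OF f(1)] by blast
    show ?thesis using gap[OF valid_hats _ F(1), of "{..<n}" n "\<lambda>_ _. 0"] F(2) f(2) by simp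
  qed
  then have "limit_prob (t + 1) \<le> limit_prob t - \<gamma>"
    by (intro LIMSEQ_le_const2[OF opt_prob_tendsto]) blast
  then show ?thesis using \<gamma> by simp
qed

end
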